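(* Fix $Ek>0$ and let $(\boldsymbol u,\boldsymbol B,P,T)$ be a smooth solution of the viscous inertialess model (see context). Suppose that the magnetic flux is exact. If at some instant of time the magnetic field is nontrivial and dynamo action occurs, i.e. $\frac{\mathrm d}{\mathrm dt}\left(\frac12\int_V|\boldsymbol B|^2\,\mathrm dV\right)\ge 0$, then at that instant the (viscous) Archimedean velocity $\boldsymbol u^{\mathrm A}$ satisfies, for every $3\le p\le\infty$, $$ A_p\,\|\boldsymbol u^{\mathrm A}\|_{L^p}\ \ge\ \frac1{Rm}. $$
   Context: Domain: $V=[0,L_x]\times[0,L_y]\times[0,1]$ with $L_x,L_y>0$; all fields are periodic in $x$ and $y$. $S_-=\{z=0\}$, $S_+=\{z=1\}$, $\boldsymbol n_\pm=\pm\boldsymbol e_z$. $L^p$ norms are over $V$. Viscous inertialess model, with positive parameters $Ek,\Lambda,Ra,Rm,Pe$ and heat source $Q=Q(\boldsymbol x)$: velocity $\boldsymbol u$, pressure $P$, magnetic field $\boldsymbol B$, temperature $T$ satisfy $$\boldsymbol e_z\times\boldsymbol u+\nabla P-Ek\nabla^2\boldsymbol u=\Lambda(\nabla\times\boldsymbol B)\times\boldsymbol B+Ra\,T\boldsymbol e_z,\quad\nabla\cdot\boldsymbol u=0,$$ $$\partial_t\boldsymbol B-\nabla\times(\boldsymbol u\times\boldsymbol B)=\tfrac1{Rm}\nabla^2\boldsymbol B,\quad\nabla\cdot\boldsymbol B=0,\quad \partial_tT+\nabla\cdot(\boldsymbol uT)=\tfrac1{Pe}\nabla^2T+\tfrac{Q}{Pe},$$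 with boundary conditions on $S_\pm$: $\boldsymbol u\cdot\boldsymbol n_\pm=0$ (no penetration), $(\nabla\times\boldsymbol u)\times\boldsymbol n_\pm=0$ (stress-free), $\boldsymbol B\times\boldsymbol n_\pm=0$ (ferromagnetic), $T=T_\pm$ with $T_\pm$ constants (isothermal). Magnetic flux is exact if $\int_{S_\pm}\boldsymbol n_\pm\cdot\boldsymbol B\,\mathrm dS_\pm=0$. Archimedean velocity for $Ek>0$: $\boldsymbol u^{\mathrm A}$ is the unique smooth solution (periodic in $x,y$, with periodic pressure $P^{\mathrm A}$) of $$-Ek\nabla^2\boldsymbol u^{\mathrm A}+\boldsymbol e_z\times\boldsymbol u^{\mathrm A}+\nabla P^{\mathrm A}=Ra\,T\boldsymbol e_z,\qquad\nabla\cdot\boldsymbol u^{\mathrm A}=0,$$ subject to the no-penetration and stress-free boundary conditions on $S_\pm$. Constants: $\lambda_1=\min\{\pi,2\pi/L_x,2\pi/L_y\}$, $C_{\mathrm P}=1/\lambda_1$, $C_3=\frac{2^{2/3}}{\pi^{2/3}\sqrt3}$, $C_{\mathrm S}=2\sqrt2\,C_3\Big(1+\frac{\sqrt{1+L_x^{-2}+L_y^{-2}}}{\lambda_1}\Big)$, and $A_p=C_{\mathrm P}^{(p-3)/p}C_{\mathrm S}^{3/p}$ for $3\le p\le\infty$ (so $A_\infty=C_{\mathrm P}$). *)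

theory Defs
  imports "HOL-Analysis.Analysis" "HOL-Probability.Essential_Supremum"
begin

section \<open>Domain\<close>

text \<open>Horizontally periodic fields are functions on the infinite slab that are invariant
  under the two horizontal translations; the box \<open>cell Lx Ly\<close> is one period cell.\<close>

definition slab :: "(real^3) set" where
  "slab = {x. 0 \<le> x$3 \<and> x$3 \<le> 1}"

definition S_minus :: "(real^3) set" where
  "S_minus = {x. x$3 = 0}"

definition S_plus :: "(real^3) set" where
  "S_plus = {x. x$3 = 1}"

definition e_z :: "real^3" where
  "e_z = axis 3 1"

definition n_minus :: "real^3" where
  "n_minus = - e_z"

definition n_plus :: "real^3" where
  "n_plus = e_z"

definition cell :: "real \<Rightarrow> real \<Rightarrow> (real^3) set" where
  "cell Lx Ly = cbox 0 (vector [Lx, Ly, 1])"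

definition periodic_xy :: "real \<Rightarrow> real \<Rightarrow> (real^3 \<Rightarrow> 'b) \<Rightarrow> bool" where
  "periodic_xy Lx Ly f \<longleftrightarrow>
     (\<forall>x\<in>slab. f (x + axis 1 Lx) = f x \<and> f (x + axis 2 Ly) = f x)"


section \<open>Smoothness and differential operators up to the boundary\<close>

text \<open>All derivatives are taken within the set on which the function lives. For convex sets with
  nonempty interior (the slab, or a time interval times the slab) the derivative within the set is
  unique; it is the usual one at interior points and one-sided at the boundary. Values of a
  function outside the set play no role.\<close>

primrec C_k_on :: "nat \<Rightarrow> ('a::euclidean_space) set \<Rightarrow> ('a \<Rightarrow> 'b::real_normed_vector) \<Rightarrow> bool" where
  "C_k_on 0 S f = continuous_on S f"
| "C_k_on (Suc k) S f =
     (f differentiable_on S \<and>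
      (\<forall>b\<in>Basis. C_k_on k S (\<lambda>x. frechet_derivative f (at x within S) b)))"

definition smooth_on :: "('a::euclidean_space) set \<Rightarrow> ('a \<Rightarrow> 'b::real_normed_vector) \<Rightarrow> bool" where
  "smooth_on S f \<longleftrightarrow> (\<forall>k. C_k_on k S f)"

definition pd :: "3 \<Rightarrow> (real^3 \<Rightarrow> 'b::real_normed_vector) \<Rightarrow> real^3 \<Rightarrow> 'b" where
  "pd i f x = frechet_derivative f (at x within slab) (axis i 1)"

definition grad :: "(real^3 \<Rightarrow> real) \<Rightarrow> real^3 \<Rightarrow> real^3" where
  "grad f x = (\<chi> i. pd i f x)"

definition divg :: "(real^3 \<Rightarrow> real^3) \<Rightarrow> real^3 \<Rightarrow> real" where
  "divg v x = (\<Sum>i\<in>UNIV. pd i v x $ i)"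

definition curl :: "(real^3 \<Rightarrow> real^3) \<Rightarrow> real^3 \<Rightarrow> real^3" where
  "curl v x = vector [pd 2 v x $ 3 - pd 3 v x $ 2,
                      pd 3 v x $ 1 - pd 1 v x $ 3,
                      pd 1 v x $ 2 - pd 2 v x $ 1]"

definition lap :: "(real^3 \<Rightarrow> 'b::real_normed_vector) \<Rightarrow> real^3 \<Rightarrow> 'b" where
  "lap f x = (\<Sum>i\<in>UNIV. pd i (pd i f) x)"


section \<open>Boundary conditions\<close>

definition no_penetration :: "(real^3 \<Rightarrow> real^3) \<Rightarrow> bool" where
  "no_penetration u \<longleftrightarrow>
     (\<forall>x\<in>S_minus. u x \<bullet> n_minus = 0) \<and> (\<forall>x\<in>S_plus. u x \<bullet> n_plus = 0)"

definition stress_free :: "(real^3 \<Rightarrow> real^3) \<Rightarrow> bool" where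
  "stress_free u \<longleftrightarrow>
     (\<forall>x\<in>S_minus. cross3 (curl u x) n_minus = 0) \<and> (\<forall>x\<in>S_plus. cross3 (curl u x) n_plus = 0)"

definition ferromagnetic :: "(real^3 \<Rightarrow> real^3) \<Rightarrow> bool" where
  "ferromagnetic B \<longleftrightarrow>
     (\<forall>x\<in>S_minus. cross3 (B x) n_minus = 0) \<and> (\<forall>x\<in>S_plus. cross3 (B x) n_plus = 0)"

definition isothermal :: "real \<Rightarrow> real \<Rightarrow> (real^3 \<Rightarrow> real) \<Rightarrow> bool" where
  "isothermal Tm Tp T \<longleftrightarrow> (\<forall>x\<in>S_minus. T x = Tm) \<and> (\<forall>x\<in>S_plus. T x = Tp)"


section \<open>The viscous inertialess model\<close>

text \<open>\<open>I\<close> is the time interval on which the solution lives; smoothness is joint in time and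
  space. \<open>Tm\<close> and \<open>Tp\<close> are the constant temperatures of the lower and upper walls.\<close>

definition smooth_periodic_evolution ::
    "real \<Rightarrow> real \<Rightarrow> real set \<Rightarrow> (real \<Rightarrow> real^3 \<Rightarrow> 'b::real_normed_vector) \<Rightarrow> bool" where
  "smooth_periodic_evolution Lx Ly I f \<longleftrightarrow>
     smooth_on (I \<times> slab) (\<lambda>(t, x). f t x) \<and> (\<forall>t\<in>I. periodic_xy Lx Ly (f t))"

definition viscous_inertialess_solution ::
    "real \<Rightarrow> real \<Rightarrow> real \<Rightarrow> real \<Rightarrow> real \<Rightarrow> real \<Rightarrow> real \<Rightarrow> (real^3 \<Rightarrow> real) \<Rightarrow> real \<Rightarrow> real \<Rightarrow> real set
     \<Rightarrow> (real \<Rightarrow> real^3 \<Rightarrow> real^3) \<Rightarrow> (real \<Rightarrow> real^3 \<Rightarrow> real^3)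
     \<Rightarrow> (real \<Rightarrow> real^3 \<Rightarrow> real) \<Rightarrow> (real \<Rightarrow> real^3 \<Rightarrow> real) \<Rightarrow> bool" where
  "viscous_inertialess_solution Lx Ly Ek \<Lambda> Ra Rm Pe Q Tm Tp I u B P T \<longleftrightarrow>
     smooth_periodic_evolution Lx Ly I u \<and>
     smooth_periodic_evolution Lx Ly I B \<and>
     smooth_periodic_evolution Lx Ly I P \<and>
     smooth_periodic_evolution Lx Ly I T \<and>
     periodic_xy Lx Ly Q \<and>
     (\<forall>t\<in>I. \<forall>x\<in>slab.
        cross3 e_z (u t x) + grad (P t) x - Ek *\<^sub>R lap (u t) x
          = \<Lambda> *\<^sub>R cross3 (curl (B t) x) (B t x) + (Ra * T t x) *\<^sub>R e_z \<and>
        divg (u t) x = 0 \<and>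
        vector_derivative (\<lambda>s. B s x) (at t within I) - curl (\<lambda>y. cross3 (u t y) (B t y)) x
          = (1 / Rm) *\<^sub>R lap (B t) x \<and>
        divg (B t) x = 0 \<and>
        vector_derivative (\<lambda>s. T s x) (at t within I) + divg (\<lambda>y. T t y *\<^sub>R u t y) x
          = (1 / Pe) * lap (T t) x + Q x / Pe) \<and>
     (\<forall>t\<in>I. no_penetration (u t) \<and> stress_free (u t) \<and> ferromagnetic (B t) \<and>
        isothermal Tm Tp (T t))"


section \<open>Magnetic flux and magnetic energy\<close>

definition flux_minus :: "real \<Rightarrow> real \<Rightarrow> (real^3 \<Rightarrow> real^3) \<Rightarrow> real" where
  "flux_minus Lx Ly B =
     (LINT (x, y)|lebesgue_on (cbox (0, 0) (Lx, Ly)). n_minus \<bullet> B (vector [x, y, 0]))"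

definition flux_plus :: "real \<Rightarrow> real \<Rightarrow> (real^3 \<Rightarrow> real^3) \<Rightarrow> real" where
  "flux_plus Lx Ly B =
     (LINT (x, y)|lebesgue_on (cbox (0, 0) (Lx, Ly)). n_plus \<bullet> B (vector [x, y, 1]))"

definition magnetic_flux_exact :: "real \<Rightarrow> real \<Rightarrow> (real^3 \<Rightarrow> real^3) \<Rightarrow> bool" where
  "magnetic_flux_exact Lx Ly B \<longleftrightarrow> flux_minus Lx Ly B = 0 \<and> flux_plus Lx Ly B = 0"

definition magnetic_energy :: "real \<Rightarrow> real \<Rightarrow> (real^3 \<Rightarrow> real^3) \<Rightarrow> real" where
  "magnetic_energy Lx Ly B = 1/2 * (LINT x|lebesgue_on (cell Lx Ly). (norm (B x))\<^sup>2)"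

definition dynamo_action_at ::
    "real \<Rightarrow> real \<Rightarrow> real set \<Rightarrow> (real \<Rightarrow> real^3 \<Rightarrow> real^3) \<Rightarrow> real \<Rightarrow> bool" where
  "dynamo_action_at Lx Ly I B t \<longleftrightarrow>
     (\<exists>D\<ge>0. ((\<lambda>s. magnetic_energy Lx Ly (B s)) has_real_derivative D) (at t within I))"


section \<open>The viscous Archimedean velocity\<close>

text \<open>The temperature \<open>T\<close> is frozen at one instant. The periodicity of the pressure excludes
  a mean horizontal pressure gradient, hence a nonzero uniform flow, and makes \<open>uA\<close> unique on
  the slab.\<close>

definition archimedean_velocity ::
    "real \<Rightarrow> real \<Rightarrow> real \<Rightarrow> real \<Rightarrow> (real^3 \<Rightarrow> real) \<Rightarrow> (real^3 \<Rightarrow> real^3) \<Rightarrow> bool" where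
  "archimedean_velocity Lx Ly Ek Ra T uA \<longleftrightarrow>
     smooth_on slab uA \<and> periodic_xy Lx Ly uA \<and>
     (\<exists>PA. smooth_on slab PA \<and> periodic_xy Lx Ly PA \<and>
        (\<forall>x\<in>slab. - (Ek *\<^sub>R lap uA x) + cross3 e_z (uA x) + grad PA x = (Ra * T x) *\<^sub>R e_z)) \<and>
     (\<forall>x\<in>slab. divg uA x = 0) \<and>
     no_penetration uA \<and> stress_free uA"


section \<open>Norms and constants\<close>

definition Lp_norm :: "ereal \<Rightarrow> (real^3) set \<Rightarrow> (real^3 \<Rightarrow> real^3) \<Rightarrow> real" where
  "Lp_norm p V f =
     (if p = \<infinity> then real_of_ereal (esssup (lebesgue_on V) (\<lambda>x. ereal (norm (f x))))
      else (LINT x|lebesgue_on V. norm (f x) powr real_of_ereal p) powr (1 / real_of_ereal p))"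

definition lambda1 :: "real \<Rightarrow> real \<Rightarrow> real" where
  "lambda1 Lx Ly = Min {pi, 2 * pi / Lx, 2 * pi / Ly}"

definition C_P :: "real \<Rightarrow> real \<Rightarrow> real" where
  "C_P Lx Ly = 1 / lambda1 Lx Ly"

definition C_3 :: real where
  "C_3 = 2 powr (2/3) / (pi powr (2/3) * sqrt 3)"

definition C_S :: "real \<Rightarrow> real \<Rightarrow> real" where
  "C_S Lx Ly =
     2 * sqrt 2 * C_3 * (1 + sqrt (1 + 1 / Lx\<^sup>2 + 1 / Ly\<^sup>2) / lambda1 Lx Ly)"

definition A_p :: "real \<Rightarrow> real \<Rightarrow> ereal \<Rightarrow> real" where
  "A_p Lx Ly p =
     (if p = \<infinity> then C_P Lx Ly
      else C_P Lx Ly powr ((real_of_ereal p - 3) / real_of_ereal p)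
         * C_S Lx Ly powr (3 / real_of_ereal p))"

end

theory Submission
  imports Defs
begin

text \<open>Testing the induction equation with \<open>B\<close> shows that dynamo action forces
  \<open>(1 / Rm) \<integral>\<bar>\<nabla>B\<bar>\<^sup>2 \<le> - \<integral> u \<bullet> (curl B \<times> B)\<close>. The difference \<open>w = u - uA\<close> solves the Stokes problem driven
  by the Lorentz force alone, and testing it with \<open>w\<close> gives \<open>\<integral> w \<bullet> (curl B \<times> B) \<ge> 0\<close>, so that \<open>u\<close> may be replaced
  by \<open>uA\<close>. The right-hand side is then at most \<open>\<integral> \<bar>uA\<bar> \<bar>B\<bar> \<bar>\<nabla>B\<bar>\<close>, which the Hoelder inequality and interpolation
  between the Poincare inequality for the \<open>L2\<close> norm and the Sobolev inequality for the \<open>L6\<close> norm of \<open>B\<close>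
  bound by \<open>A_p\<close> times the \<open>Lp\<close> norm of \<open>uA\<close> times \<open>\<integral>\<bar>\<nabla>B\<bar>\<^sup>2\<close>.

  The Sobolev inequality does not use the sharp constant of the whole space: an elementary
  Gagliardo-Nirenberg argument carried out directly in the periodic layer already stays below \<open>C_S\<close>.\<close>

section \<open>Inequalities on an interval\<close>

text \<open>The claim names its constants, so most steps cannot afford to lose a factor. The
  Poincare constant comes out as exactly \<open>1 / lambda1\<close> because both Wirtinger
  inequalities are proved with sharp constants and each component of \<open>B\<close> is controlled
  by the directions that suit it. The horizontal components vanish on both walls. The vertical one
  satisfies no boundary condition there; solenoidality and the vanishing flux give it mean zero on
  every horizontal plane instead. The gradient of \<open>B\<close> must also enter with constant
  one, which is why the Lorentz force is rewritten before it is estimated. Only the Sobolev constant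
  has room to spare: \<open>C_3\<close> is the sharp constant of the whole space, and the factors
  around it in \<open>C_S\<close> exceed what a direct argument needs.

  Passing from \<open>u\<close> to \<open>uA\<close> works because both velocities obey the same
  linear problem: in the difference the buoyancy cancels, and the Coriolis force and the pressure do
  no work on it.\<close>

text \<open>The weight \<open>T = \<mu> tan (\<mu> (x - m))\<close> solves the Riccati equation \<open>T' = \<mu>\<^sup>2 + T\<^sup>2\<close>, so that integrating
  \<open>(f' + T f)\<^sup>2\<close> leaves no mixed term. Below the critical frequency \<open>T\<close> has no pole on the interval.\<close>

lemma dirichlet_wirtinger_subcritical:
  fixes f f' :: "real \<Rightarrow> real"
  assumes ab: "a < b"
    and der: "\<And>x. x \<in> {a..b} \<Longrightarrow> (f has_real_derivative f' x) (at x within {a..b})"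
    and cont: "continuous_on {a..b} f'" and zero: "f a = 0" "f b = 0"
    and mu: "0 \<le> \<mu>" "\<mu> * (b - a) < pi"
  shows "\<mu>\<^sup>2 * integral {a..b} (\<lambda>x. (f x)\<^sup>2) \<le> integral {a..b} (\<lambda>x. (f' x)\<^sup>2)"
proof -
  define m where "m = (a + b) / 2"
  define T where "T x = \<mu> * tan (\<mu> * (x - m))" for x
  have cosp: "cos (\<mu> * (x - m)) > 0" if "x \<in> {a..b}" for x
  proof (rule cos_gt_zero_pi)
    have "\<mu> * (x - m) \<le> \<mu> * ((b - a) / 2)" "\<mu> * (m - x) \<le> \<mu> * ((b - a) / 2)"
      using that mu(1) by (intro mult_left_mono; simp add: m_def field_simps)+
    then show "\<mu> * (x - m) < pi / 2" "- (pi / 2) < \<mu> * (x - m)"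
      using mu(2) by (simp_all add: algebra_simps)
  qed
  have contf: "continuous_on {a..b} f"
    by (rule DERIV_continuous_on) (rule der)
  have contT: "continuous_on {a..b} T"
    unfolding T_def using cosp by (intro continuous_intros) fastforce
  have dT: "(T has_real_derivative \<mu>\<^sup>2 + (T x)\<^sup>2) (at x within {a..b})" if "x \<in> {a..b}" for x
  proof -
    have "(T has_real_derivative \<mu> * (inverse ((cos (\<mu> * (x - m)))\<^sup>2) * \<mu>)) (at x within {a..b})"
      unfolding T_def using cosp[OF that] by (auto intro!: derivative_eq_intros)
    moreover have "inverse ((cos (\<mu> * (x - m)))\<^sup>2) = 1 + (tan (\<mu> * (x - m)))\<^sup>2"
      using cosp[OF that] tan_sec[of "\<mu> * (x - m)"] by (simp add: power_inverse)
    ultimately show ?thesis by (simp add: T_def algebra_simps power2_eq_square)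
  qed
  have "((\<lambda>x. (\<mu>\<^sup>2 + (T x)\<^sup>2) * (f x)\<^sup>2 + T x * (2 * f x * f' x)) has_integral
      T b * (f b)\<^sup>2 - T a * (f a)\<^sup>2) {a..b}"
  proof (rule fundamental_theorem_of_calculus)
    show "((\<lambda>x. T x * (f x)\<^sup>2) has_vector_derivative
        (\<mu>\<^sup>2 + (T x)\<^sup>2) * (f x)\<^sup>2 + T x * (2 * f x * f' x)) (at x within {a..b})"
      if "x \<in> {a..b}" for x
      unfolding has_real_derivative_iff_has_vector_derivative[symmetric]
      by (rule derivative_eq_intros dT der that refl)+ (simp add: algebra_simps)
  qed (use ab in simp)
  then have d0: "((\<lambda>x. (\<mu>\<^sup>2 + (T x)\<^sup>2) * (f x)\<^sup>2 + T x * (2 * f x * f' x)) has_integral 0) {a..b}"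
    by (simp add: zero)
  have i1: "((\<lambda>x. (f' x)\<^sup>2) has_integral integral {a..b} (\<lambda>x. (f' x)\<^sup>2)) {a..b}"
    by (intro integrable_integral integrable_continuous_real continuous_intros cont)
  have i2: "((\<lambda>x. (f x)\<^sup>2) has_integral integral {a..b} (\<lambda>x. (f x)\<^sup>2)) {a..b}"
    by (intro integrable_integral integrable_continuous_real continuous_intros contf)
  have "((\<lambda>x. (f' x)\<^sup>2 - \<mu>\<^sup>2 * (f x)\<^sup>2 + ((\<mu>\<^sup>2 + (T x)\<^sup>2) * (f x)\<^sup>2 + T x * (2 * f x * f' x)))
      has_integral integral {a..b} (\<lambda>x. (f' x)\<^sup>2) - \<mu>\<^sup>2 * integral {a..b} (\<lambda>x. (f x)\<^sup>2) + 0) {a..b}"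
    by (intro has_integral_add has_integral_diff has_integral_mult_right d0 i1 i2)
  moreover have "(f' x)\<^sup>2 - \<mu>\<^sup>2 * (f x)\<^sup>2 + ((\<mu>\<^sup>2 + (T x)\<^sup>2) * (f x)\<^sup>2 + T x * (2 * f x * f' x))
      = (f' x + T x * f x)\<^sup>2" for x
    by (simp add: algebra_simps power2_eq_square)
  ultimately show ?thesis
    using has_integral_nonneg[of "\<lambda>x. (f' x + T x * f x)\<^sup>2"]
    by (metis (no_types, lifting) add.right_neutral diff_ge_0_iff_ge has_integral_cong zero_le_power2)
qed

text \<open>At the critical frequency \<open>pi / (b - a)\<close> the tangent weight blows up at
  both ends, so the bound is obtained below it and passed to the limit. The constant is sharp,
  attained by a half wave of the sine.\<close>

lemma dirichlet_wirtinger: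
  fixes f f' :: "real \<Rightarrow> real"
  assumes ab: "a < b"
    and der: "\<And>x. x \<in> {a..b} \<Longrightarrow> (f has_real_derivative f' x) (at x within {a..b})"
    and cont: "continuous_on {a..b} f'" and zero: "f a = 0" "f b = 0"
  shows "integral {a..b} (\<lambda>x. (f x)\<^sup>2) \<le> ((b - a) / pi)\<^sup>2 * integral {a..b} (\<lambda>x. (f' x)\<^sup>2)"
proof -
  let ?F = "integral {a..b} (\<lambda>x. (f x)\<^sup>2)" and ?G = "integral {a..b} (\<lambda>x. (f' x)\<^sup>2)"
  have "((\<lambda>\<theta>. (\<theta> * (pi / (b - a)))\<^sup>2 * ?F) \<longlongrightarrow> (1 * (pi / (b - a)))\<^sup>2 * ?F) (at_left (1::real))"
    by (intro tendsto_intros)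
  moreover have "\<forall>\<^sub>F \<theta> in at_left (1::real). (\<theta> * (pi / (b - a)))\<^sup>2 * ?F \<le> ?G"
    using eventually_at_left_real[of 0 "1::real", OF zero_less_one]
  proof eventually_elim
    case (elim \<theta>)
    show ?case
      by (rule dirichlet_wirtinger_subcritical[OF ab der cont zero]) (use elim ab in auto)
  qed
  ultimately have "(1 * (pi / (b - a)))\<^sup>2 * ?F \<le> ?G"
    by (intro tendsto_upperbound) auto
  then show ?thesis using ab by (simp add: power_divide pos_divide_le_eq pos_le_divide_eq mult.commute)
qed

section \<open>The sharp Wirtinger inequality for periodic functions\<close>

lemma integral_square_diff_const_ge:
  fixes f :: "real \<Rightarrow> real"
  assumes L: "L > 0" and cont: "continuous_on {a..a + L} f"
  shows "integral {a..a + L} (\<lambda>x. (f x)\<^sup>2)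
    \<le> integral {a..a + L} (\<lambda>x. (f x - c)\<^sup>2) + (integral {a..a + L} f)\<^sup>2 / L"
proof -
  let ?F = "integral {a..a + L} f"
  have i1: "((\<lambda>x. (f x)\<^sup>2) has_integral integral {a..a + L} (\<lambda>x. (f x)\<^sup>2)) {a..a + L}"
    and i2: "(f has_integral ?F) {a..a + L}"
    by (intro integrable_integral integrable_continuous_real continuous_intros cont)+
  have i3: "((\<lambda>x. c\<^sup>2) has_integral c\<^sup>2 * L) {a..a + L}"
    using has_integral_const_real[of "c\<^sup>2" a "a + L"] L by (simp add: mult.commute)
  have "((\<lambda>x. (f x)\<^sup>2 - 2 * c * f x + c\<^sup>2) has_integral
      integral {a..a + L} (\<lambda>x. (f x)\<^sup>2) - 2 * c * ?F + c\<^sup>2 * L) {a..a + L}"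
    by (intro has_integral_add has_integral_diff has_integral_mult_right i1 i2 i3)
  then have "integral {a..a + L} (\<lambda>x. (f x - c)\<^sup>2) =
      integral {a..a + L} (\<lambda>x. (f x)\<^sup>2) - 2 * c * ?F + c\<^sup>2 * L"
    by (intro integral_unique) (simp add: power2_eq_square algebra_simps)
  \<comment> \<open>The defect of the inequality is exactly this square, which vanishes when
    \<open>c\<close> is the mean of \<open>f\<close>.\<close>
  moreover have "0 \<le> (?F - c * L)\<^sup>2 / L" using L by simp
  moreover have "(?F - c * L)\<^sup>2 / L = ?F\<^sup>2 / L - 2 * c * ?F + c\<^sup>2 * L"
    using L by (simp add: field_simps power2_eq_square)
  ultimately show ?thesis by linarith
qed

lemma integral_periodic_shift:
  fixes g :: "real \<Rightarrow> real"
  assumes per: "\<And>x. g (x + L) = g x" and cont: "continuous_on UNIV g" and a: "0 \<le> a" "a \<le> L"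
  shows "integral {a..a + L} g = integral {0..L} g"
proof -
  have int: "g integrable_on {c..d}" for c d
    by (intro integrable_continuous_real continuous_on_subset[OF cont]) simp
  have "integral {L..a + L} g = integral {0..a} (\<lambda>x. g (x + L))"
    using integral_shift_Icc_real[of 0 a g L] by (simp add: o_def add.commute)
  then have "integral {L..a + L} g = integral {0..a} g" by (simp add: per)
  moreover have "integral {0..a} g + integral {a..L} g = integral {0..L} g"
    using a int by (intro Henstock_Kurzweil_Integration.integral_combine) auto
  moreover have "integral {a..L} g + integral {L..a + L} g = integral {a..a + L} g"
    using a int by (intro Henstock_Kurzweil_Integration.integral_combine) auto
  ultimately show ?thesis by simp
qed

text \<open>The intermediate value theorem yields two points at distance \<open>L / 2\<close> with a common value \<open>c\<close>;
  the Dirichlet inequality then applies to \<open>f - c\<close> on both halves of the period.\<close>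

lemma periodic_wirtinger:
  fixes f f' :: "real \<Rightarrow> real"
  assumes L: "L > 0" and per: "\<And>x. f (x + L) = f x"
    and der: "\<And>x. (f has_real_derivative f' x) (at x)" and cont: "continuous_on UNIV f'"
  shows "integral {0..L} (\<lambda>x. (f x)\<^sup>2)
    \<le> (L / (2 * pi))\<^sup>2 * integral {0..L} (\<lambda>x. (f' x)\<^sup>2) + (integral {0..L} f)\<^sup>2 / L"
proof -
  have contf: "continuous_on S f" for S
    by (meson DERIV_continuous_on der has_field_derivative_at_within)
  have per': "f' (x + L) = f' x" for x
  proof -
    have "((\<lambda>x. f (x + L)) has_real_derivative f' (x + L)) (at x)"
      using DERIV_shift der by blast
    then show ?thesis using der[of x] by (simp add: per DERIV_unique)
  qed
  \<comment> \<open>By periodicity the difference at \<open>L / 2\<close> is the negative of the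
    difference at \<open>0\<close>, so it has a zero between them.\<close>
  have "\<exists>a\<ge>0. a \<le> L / 2 \<and> f (a + L / 2) - f a = 0"
  proof (cases "f (0 + L / 2) - f 0 \<le> 0")
    case True
    have "f (L / 2 + L / 2) = f 0" using per[of 0] by simp
    then show ?thesis using True L
      by (intro IVT'[of "\<lambda>a. f (a + L / 2) - f a"] continuous_on_diff contf
          continuous_on_compose2[OF contf[of UNIV]] continuous_intros) auto
  next
    case False
    have "f (L / 2 + L / 2) = f 0" using per[of 0] by simp
    then show ?thesis using False L
      by (intro IVT2'[of "\<lambda>a. f (a + L / 2) - f a"] continuous_on_diff contf
          continuous_on_compose2[OF contf[of UNIV]] continuous_intros) auto
  qed
  then obtain a where a: "0 \<le> a" "a \<le> L / 2" and eq: "f (a + L / 2) = f a" by auto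
  \<comment> \<open>Half a period has length \<open>L / 2\<close>, so the sharp Dirichlet constant
    \<open>(L / 2) / pi\<close> is already the sharp periodic one.\<close>
  have half: "integral {b..b + L / 2} (\<lambda>x. (f x - f a)\<^sup>2)
      \<le> (L / (2 * pi))\<^sup>2 * integral {b..b + L / 2} (\<lambda>x. (f' x)\<^sup>2)"
    if "f b = f a" "f (b + L / 2) = f a" for b
  proof -
    have "integral {b..b + L / 2} (\<lambda>x. (f x - f a)\<^sup>2)
      \<le> ((b + L / 2 - b) / pi)\<^sup>2 * integral {b..b + L / 2} (\<lambda>x. (f' x)\<^sup>2)"
      by (rule dirichlet_wirtinger)
        (use that L in \<open>auto intro!: derivative_eq_intros has_field_derivative_at_within[OF der]
            continuous_on_subset[OF cont]\<close>)
    then show ?thesis by simp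
  qed
  have comb: "integral {a..a + L} g = integral {a..a + L / 2} g + integral {a + L / 2..a + L / 2 + L / 2} g"
    if "continuous_on UNIV g" for g :: "real \<Rightarrow> real"
  proof -
    have "integral {a..a + L / 2} g + integral {a + L / 2..a + L} g = integral {a..a + L} g"
      using L by (intro Henstock_Kurzweil_Integration.integral_combine integrable_continuous_real
          continuous_on_subset[OF that]) auto
    then show ?thesis by (simp add: add.assoc)
  qed
  have c1: "continuous_on UNIV (\<lambda>x. (f x - f a)\<^sup>2)" and c2: "continuous_on UNIV (\<lambda>x. (f' x)\<^sup>2)"
    by (intro continuous_intros contf cont)+
  have "f (a + L / 2 + L / 2) = f a" using per[of a] by (simp add: add.assoc)
  then have "integral {a..a + L} (\<lambda>x. (f x - f a)\<^sup>2) \<le> (L / (2 * pi))\<^sup>2 * integral {a..a + L} (\<lambda>x. (f' x)\<^sup>2)"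
    using half[of a] half[of "a + L / 2"] eq
    by (simp add: comb[OF c1] comb[OF c2] distrib_left)
  moreover have "integral {a..a + L} (\<lambda>x. (f x - f a)\<^sup>2) = integral {0..L} (\<lambda>x. (f x - f a)\<^sup>2)"
    using a L by (intro integral_periodic_shift c1) (auto simp: per)
  moreover have "integral {a..a + L} (\<lambda>x. (f' x)\<^sup>2) = integral {0..L} (\<lambda>x. (f' x)\<^sup>2)"
    using a L by (intro integral_periodic_shift c2) (auto simp: per')
  moreover have "integral {0..L} (\<lambda>x. (f x)\<^sup>2)
    \<le> integral {0..L} (\<lambda>x. (f x - f a)\<^sup>2) + (integral {0..L} f)\<^sup>2 / L"
    using integral_square_diff_const_ge[OF L contf, of 0 "f a"] by simp
  ultimately show ?thesis by simp
qed

section \<open>Pointwise bounds by the mean and the variation\<close>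

lemma le_mean_plus_oscillation:
  fixes g :: "real \<Rightarrow> real"
  assumes L: "L > 0" and cont: "continuous_on {0..L} g" and x: "x \<in> {0..L}"
    and osc: "\<And>y. y \<in> {0..L} \<Longrightarrow> g x - g y \<le> M"
  shows "g x \<le> (1 / L) * integral {0..L} g + M"
proof -
  \<comment> \<open>The inequality \<open>g x - M \<le> g y\<close> is averaged over
    \<open>y\<close>.\<close>
  have "integral {0..L} (\<lambda>y. g x - M) \<le> integral {0..L} g"
    by (rule integral_le) (use osc in \<open>auto intro!: integrable_continuous_real cont simp: algebra_simps\<close>)
  then have "L * (g x - M) \<le> integral {0..L} g" using L by simp
  then have "g x - M \<le> integral {0..L} g / L" using L by (simp add: field_simps)
  then show ?thesis by simp
qed

lemma abs_diff_le_integral_deriv: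
  fixes g g' :: "real \<Rightarrow> real"
  assumes der: "\<And>x. x \<in> {0..L} \<Longrightarrow> (g has_real_derivative g' x) (at x within {0..L})"
    and cont: "continuous_on {0..L} g'" and xy: "0 \<le> y" "y \<le> x" "x \<le> L"
  shows "\<bar>g x - g y\<bar> \<le> integral {y..x} (\<lambda>x. \<bar>g' x\<bar>)"
proof -
  have sub: "{y..x} \<subseteq> {0..L}" using xy by auto
  have "(g' has_integral g x - g y) {y..x}"
    using sub xy by (intro fundamental_theorem_of_calculus)
      (auto simp: has_real_derivative_iff_has_vector_derivative[symmetric]
        intro!: DERIV_subset[OF der])
  moreover have "norm (integral {y..x} g') \<le> integral {y..x} (\<lambda>x. \<bar>g' x\<bar>)"
    using continuous_on_subset[OF cont sub]
    by (intro integral_norm_bound_integral integrable_continuous_real continuous_intros) auto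
  ultimately show ?thesis by (simp add: integral_unique)
qed

lemma interval_sup_bound:
  fixes g g' :: "real \<Rightarrow> real"
  assumes L: "L > 0"
    and der: "\<And>x. x \<in> {0..L} \<Longrightarrow> (g has_real_derivative g' x) (at x within {0..L})"
    and cont: "continuous_on {0..L} g'" and x: "x \<in> {0..L}"
  shows "g x \<le> (1 / L) * integral {0..L} g + integral {0..L} (\<lambda>x. \<bar>g' x\<bar>)"
proof (rule le_mean_plus_oscillation[OF L DERIV_continuous_on[OF der] x])
  fix y assume y: "y \<in> {0..L}"
  have sub: "integral {c..d} (\<lambda>x. \<bar>g' x\<bar>) \<le> integral {0..L} (\<lambda>x. \<bar>g' x\<bar>)"
    if "0 \<le> c" "d \<le> L" for c d
    using that by (intro integral_subset_le integrable_continuous_real continuous_intros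
        continuous_on_subset[OF cont]) auto
  show "g x - g y \<le> integral {0..L} (\<lambda>x. \<bar>g' x\<bar>)"
  proof (cases "y \<le> x")
    case True
    then show ?thesis using abs_diff_le_integral_deriv[OF der cont, of y x] sub[of y x] x y by auto
  next
    case False
    then show ?thesis using abs_diff_le_integral_deriv[OF der cont, of x y] sub[of x y] x y by auto
  qed
qed

text \<open>On a circle two arcs join \<open>x\<close> to \<open>y\<close>, and the variation over
  one of them is at most half the total. This gain of a factor 2 over
  \<open>interval_sup_bound\<close> keeps the horizontal terms of the Sobolev estimate
  small.\<close>

lemma periodic_sup_bound:
  fixes g g' :: "real \<Rightarrow> real"
  assumes L: "L > 0"
    and der: "\<And>x. x \<in> {0..L} \<Longrightarrow> (g has_real_derivative g' x) (at x within {0..L})"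
    and cont: "continuous_on {0..L} g'" and x: "x \<in> {0..L}" and per: "g L = g 0"
  shows "g x \<le> (1 / L) * integral {0..L} g + 1 / 2 * integral {0..L} (\<lambda>x. \<bar>g' x\<bar>)"
proof (rule le_mean_plus_oscillation[OF L DERIV_continuous_on[OF der] x])
  define h where "h x = \<bar>g' x\<bar>" for x
  have bd: "\<bar>g d - g c\<bar> \<le> integral {c..d} h" if "0 \<le> c" "c \<le> d" "d \<le> L" for c d
    using abs_diff_le_integral_deriv[OF der cont that] by (simp add: h_def[abs_def])
  have key: "2 * \<bar>g d - g c\<bar> \<le> integral {0..L} h" if "0 \<le> c" "c \<le> d" "d \<le> L" for c d
  proof -
    have int: "h integrable_on {c..d}" if "0 \<le> c" "d \<le> L" for c d
      unfolding h_def using that by (intro integrable_continuous_real continuous_intros continuous_on_subset[OF cont]) auto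
    have "integral {0..c} h + integral {c..d} h = integral {0..d} h"
      "integral {0..d} h + integral {d..L} h = integral {0..L} h"
      using that int by (intro Henstock_Kurzweil_Integration.integral_combine; auto)+
    moreover have "\<bar>g c - g 0\<bar> \<le> integral {0..c} h" "\<bar>g d - g c\<bar> \<le> integral {c..d} h"
      "\<bar>g L - g d\<bar> \<le> integral {d..L} h"
      using that by (auto intro!: bd)
    \<comment> \<open>The second arc runs through the endpoints, which \<open>per\<close>
      identifies.\<close>
    moreover have "\<bar>g d - g c\<bar> \<le> \<bar>g c - g 0\<bar> + \<bar>g L - g d\<bar>" using per by simp
    moreover have "2 * p \<le> S" if "p1 + p2 = S1" "S1 + p3 = S" "q1 \<le> p1" "p \<le> p2" "q3 \<le> p3" "p \<le> q1 + q3"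
      for p q1 q3 p1 p2 p3 S1 S :: real
      using that by linarith
    ultimately show ?thesis by blast
  qed
  fix y assume "y \<in> {0..L}"
  then have "2 * \<bar>g x - g y\<bar> \<le> integral {0..L} h"
    using key[of x y] key[of y x] x by (cases "x \<le> y") (auto simp: abs_minus_commute)
  then have "\<bar>g x - g y\<bar> \<le> 1 / 2 * integral {0..L} h" by simp
  then have "g x - g y \<le> 1 / 2 * integral {0..L} h" by (rule abs_le_D1)
  then show "g x - g y \<le> 1 / 2 * integral {0..L} (\<lambda>x. \<bar>g' x\<bar>)"
    by (simp add: h_def[abs_def])
qed

section \<open>Calculus in the slab\<close>

lemma vector3_conv: "(vector [x, y, z] :: real^3) = x *\<^sub>R axis 1 1 + y *\<^sub>R axis 2 1 + z *\<^sub>R axis 3 1"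
  by (simp add: vec_eq_iff forall_3 axis_def)

lemma continuous_on_vector3 [continuous_intros]:
  fixes f g h :: "'a::topological_space \<Rightarrow> real"
  assumes "continuous_on S f" "continuous_on S g" "continuous_on S h"
  shows "continuous_on S (\<lambda>x. vector [f x, g x, h x] :: real^3)"
  unfolding vector3_conv by (intro continuous_intros assms)

lemma mem_cell: "x \<in> cell Lx Ly \<longleftrightarrow> 0 \<le> x$1 \<and> x$1 \<le> Lx \<and> 0 \<le> x$2 \<and> x$2 \<le> Ly \<and> 0 \<le> x$3 \<and> x$3 \<le> 1"
  by (auto simp: cell_def mem_box_cart forall_3)

lemma cell_subset_slab: "cell Lx Ly \<subseteq> slab"
  by (auto simp: mem_cell slab_def)

text \<open>Iterated integration is carried out on product types, so the integral is first moved
  there from \<open>real^3\<close>. The coordinate map takes boxes to boxes of the same content,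
  which is what a change of variables in the gauge integral requires.\<close>

lemma integral_cell_triple:
  fixes F :: "real^3 \<Rightarrow> real"
  assumes cont: "continuous_on (cell Lx Ly) F"
  shows "integral (cell Lx Ly) F =
    integral (cbox (0, 0, 0) (Lx, Ly, 1)) (\<lambda>p. F (vector [fst p, fst (snd p), snd (snd p)]))"
proof -
  define g :: "real \<times> real \<times> real \<Rightarrow> real^3" where "g p = vector [fst p, fst (snd p), snd (snd p)]" for p
  define h :: "real^3 \<Rightarrow> real \<times> real \<times> real" where "h x = (x$1, x$2, x$3)" for x
  have hg: "h (g p) = p" and gh: "g (h x) = x" for p x
    by (simp_all add: g_def h_def vec_eq_iff forall_3)
  have gim: "g ` cbox u v = cbox (g u) (g v)" for u v
  proof
    show "g ` cbox u v \<subseteq> cbox (g u) (g v)"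
      by (cases u; cases v) (auto simp: g_def mem_box_cart forall_3 cbox_Pair_eq)
    show "cbox (g u) (g v) \<subseteq> g ` cbox u v"
    proof
      fix x assume "x \<in> cbox (g u) (g v)"
      then have "h x \<in> cbox u v"
        by (cases u; cases v) (auto simp: g_def h_def mem_box_cart forall_3 cbox_Pair_eq)
      then show "x \<in> g ` cbox u v" by (metis gh imageI)
    qed
  qed
  have him: "h ` cbox u v = cbox (h u) (h v)" for u v
  proof -
    have "cbox u v = g ` cbox (h u) (h v)" by (simp add: gim gh)
    then show ?thesis by (simp add: image_image hg)
  qed
  have "(F has_integral integral (cell Lx Ly) F) (cbox 0 (vector [Lx, Ly, 1]))"
    using integrable_integral[OF integrable_continuous[OF cont[unfolded cell_def]]] by (simp add: cell_def)
  then have "((\<lambda>p. F (g p)) has_integral (1 / 1) *\<^sub>R integral (cell Lx Ly) F) (h ` cbox 0 (vector [Lx, Ly, 1]))"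
  proof (rule has_integral_twiddle[OF zero_less_one hg gh, rotated -1])
    show "isCont g x" for x
      unfolding g_def vector3_conv by (intro continuous_intros)
    show "measure lborel (g ` cbox u v) = 1 * measure lborel (cbox u v)" for u v
    proof (cases "cbox u v = {}")
      case False
      then have "cbox (g u) (g v) \<noteq> {}" by (simp flip: gim)
      then have "measure lborel (cbox (g u) (g v)) = prod (\<lambda>i. g v $ i - g u $ i) UNIV"
        by (rule content_cbox_cart)
      also have "\<dots> = measure lborel (cbox u v)"
      proof -
        obtain a b c a' b' c' where uv: "u = (a, b, c)" "v = (a', b', c')"
          by (metis prod_cases3)
        have "a \<le> a'" "b \<le> b'" "c \<le> c'"
          using False by (simp_all add: uv cbox_Pair_eq)
        then have "measure lborel (cbox u v) = (a' - a) * ((b' - b) * (c' - c))"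
          unfolding uv content_Pair by simp
        moreover have "prod (\<lambda>i. g v $ i - g u $ i) UNIV = (a' - a) * ((b' - b) * (c' - c))"
          unfolding UNIV_3 by (simp add: g_def uv)
        ultimately show ?thesis by simp
      qed
      finally show ?thesis by (simp add: gim)
    qed simp
  qed (use gim him in blast)+
  moreover have "h ` cbox 0 (vector [Lx, Ly, 1]) = cbox (0, 0, 0) (Lx, Ly, 1)"
    by (simp add: him) (simp add: h_def)
  ultimately show ?thesis
    by (simp add: g_def integral_unique)
qed

lemma continuous_on_cell_compose:
  fixes F :: "real^3 \<Rightarrow> 'b::topological_space"
  assumes "continuous_on (cell Lx Ly) F" "continuous_on S f" "continuous_on S g" "continuous_on S h"
    and "\<And>p. p \<in> S \<Longrightarrow> f p \<in> {0..Lx} \<and> g p \<in> {0..Ly} \<and> h p \<in> {0..1}"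
  shows "continuous_on S (\<lambda>p. F (vector [f p, g p, h p]))"
  by (rule continuous_on_compose2[OF assms(1)]) (use assms in \<open>auto intro!: continuous_intros simp: mem_cell\<close>)

lemma continuous_on_integral_param:
  fixes f :: "'a::topological_space \<Rightarrow> real \<Rightarrow> real"
  assumes "continuous_on (U \<times> {a..b}) (\<lambda>p. f (fst p) (snd p))"
  shows "continuous_on U (\<lambda>x. integral {a..b} (f x))"
  using integral_continuous_on_param[of U a b f] assms by (simp add: split_beta)

lemma integral_swap_real:
  fixes f :: "real \<Rightarrow> real \<Rightarrow> real"
  assumes "continuous_on ({a..b} \<times> {c..d}) (\<lambda>p. f (fst p) (snd p))"
  shows "integral {a..b} (\<lambda>x. integral {c..d} (f x)) = integral {c..d} (\<lambda>y. integral {a..b} (\<lambda>x. f x y))"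
  using integral_swap_continuous[of a c b d f] assms by (simp add: split_beta cbox_Pair_eq)

context
  fixes F :: "real^3 \<Rightarrow> real" and Lx Ly :: real
  assumes cont: "continuous_on (cell Lx Ly) F"
begin

text \<open>A one-dimensional argument in a given direction needs that variable innermost, and an
  argument on horizontal planes needs \<open>z\<close> outermost. These needs dictate the orders of
  integration proved here.\<close>

lemma integral_cell_xyz:
  "integral (cell Lx Ly) F = integral {0..Lx} (\<lambda>x. integral {0..Ly} (\<lambda>y. integral {0..1} (\<lambda>z. F (vector [x, y, z]))))"
proof -
  let ?f = "\<lambda>p. F (vector [fst p, fst (snd p), snd (snd p)])"
  have "continuous_on (cbox (0, 0, 0) (Lx, Ly, 1)) ?f"
    by (rule continuous_on_cell_compose[OF cont]) (auto intro!: continuous_intros simp: cbox_Pair_eq)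
  then have "integral (cbox (0, 0, 0) (Lx, Ly, 1)) ?f =
      integral {0..Lx} (\<lambda>x. integral (cbox (0, 0) (Ly, 1)) (\<lambda>q. F (vector [x, fst q, snd q])))"
    by (subst integral_prod_continuous) (simp_all)
  also have "\<dots> = integral {0..Lx} (\<lambda>x. integral {0..Ly} (\<lambda>y. integral {0..1} (\<lambda>z. F (vector [x, y, z]))))"
  proof (intro Henstock_Kurzweil_Integration.integral_cong)
    fix x assume "x \<in> {0..Lx}"
    then have "continuous_on (cbox (0, 0) (Ly, 1)) (\<lambda>q. F (vector [x, fst q, snd q]))"
      by (intro continuous_on_cell_compose[OF cont]) (auto intro!: continuous_intros simp: cbox_Pair_eq)
    then show "integral (cbox (0, 0) (Ly, 1)) (\<lambda>q. F (vector [x, fst q, snd q])) =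
        integral {0..Ly} (\<lambda>y. integral {0..1} (\<lambda>z. F (vector [x, y, z])))"
      by (subst integral_prod_continuous) (simp_all)
  qed
  finally show ?thesis by (simp add: integral_cell_triple[OF cont])
qed

lemma integral_cell_xzy:
  "integral (cell Lx Ly) F = integral {0..Lx} (\<lambda>x. integral {0..1} (\<lambda>z. integral {0..Ly} (\<lambda>y. F (vector [x, y, z]))))"
  unfolding integral_cell_xyz
  by (intro Henstock_Kurzweil_Integration.integral_cong integral_swap_real continuous_on_cell_compose[OF cont] continuous_intros) auto

lemma integral_cell_yxz:
  "integral (cell Lx Ly) F = integral {0..Ly} (\<lambda>y. integral {0..Lx} (\<lambda>x. integral {0..1} (\<lambda>z. F (vector [x, y, z]))))"
  unfolding integral_cell_xyz
  by (intro integral_swap_real continuous_on_integral_param continuous_on_cell_compose[OF cont] continuous_intros) auto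

lemma integral_cell_yzx:
  "integral (cell Lx Ly) F = integral {0..Ly} (\<lambda>y. integral {0..1} (\<lambda>z. integral {0..Lx} (\<lambda>x. F (vector [x, y, z]))))"
  unfolding integral_cell_yxz
  by (intro Henstock_Kurzweil_Integration.integral_cong integral_swap_real continuous_on_cell_compose[OF cont] continuous_intros) auto

lemma integral_cell_zyx:
  "integral (cell Lx Ly) F = integral {0..1} (\<lambda>z. integral {0..Ly} (\<lambda>y. integral {0..Lx} (\<lambda>x. F (vector [x, y, z]))))"
  unfolding integral_cell_yzx
  by (intro integral_swap_real continuous_on_integral_param continuous_on_cell_compose[OF cont] continuous_intros) auto

end

section \<open>Differentiation within the closed slab\<close>

lemma slab_direction:
  assumes "x \<in> slab" "e > 0"
  shows "\<exists>d. 0 < \<bar>d\<bar> \<and> \<bar>d\<bar> < e \<and> x + d *\<^sub>R axis i 1 \<in> slab"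
proof -
  \<comment> \<open>The step points away from the nearer wall and has length at most 1/2, so it
    stays in the slab. Such steps along every axis make the derivative within the slab unique, also
    on the walls.\<close>
  define d where "d = (if x $ 3 \<le> 1/2 then min (e/2) (1/2) else - min (e/2) (1/2))"
  have "0 < \<bar>d\<bar>" "\<bar>d\<bar> < e" "x + d *\<^sub>R axis i 1 \<in> slab"
    using assms by (auto simp: d_def slab_def axis_def min_def)
  then show ?thesis by blast
qed

lemma frechet_derivative_slab:
  fixes f :: "real^3 \<Rightarrow> 'b::real_normed_vector"
  assumes "(f has_derivative f') (at x within slab)" "x \<in> slab"
  shows "frechet_derivative f (at x within slab) = f'"
  by (rule frechet_derivative_unique_within[where x = x and S = slab and f = f])
    (use assms slab_direction in \<open>auto simp: frechet_derivative_works[symmetric] differentiable_def Basis_vec_def\<close>)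

lemma pd_eqI:
  assumes "(f has_derivative f') (at x within slab)" "x \<in> slab"
  shows "pd i f x = f' (axis i 1)"
  using frechet_derivative_slab[OF assms] by (simp add: pd_def)

text \<open>The class in which all integration by parts takes place. Products, components and
  differences need one rule each rather than an induction over all orders; fields that are
  differentiated twice enter through \<open>C1_slab (pd i f)\<close>.\<close>

definition C1_slab :: "(real^3 \<Rightarrow> 'b::real_normed_vector) \<Rightarrow> bool" where
  "C1_slab f \<longleftrightarrow> f differentiable_on slab \<and> (\<forall>i. continuous_on slab (pd i f))"

lemma C1_slab_has_derivative:
  assumes "C1_slab f" "x \<in> slab"
  shows "(f has_derivative frechet_derivative f (at x within slab)) (at x within slab)"
  using assms by (auto simp: C1_slab_def differentiable_on_def frechet_derivative_works)

lemma C1_slab_continuous: "C1_slab f \<Longrightarrow> continuous_on slab f"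
  by (simp add: C1_slab_def differentiable_imp_continuous_on)

lemma C1_slab_pd_continuous: "C1_slab f \<Longrightarrow> continuous_on slab (pd i f)"
  by (simp add: C1_slab_def)

lemma C1_slabI:
  assumes "\<And>x. x \<in> slab \<Longrightarrow> (f has_derivative D x) (at x within slab)"
    and "\<And>i. continuous_on slab (\<lambda>x. D x (axis i 1))"
  shows "C1_slab f"
proof -
  have "continuous_on slab (pd i f)" for i
    using assms(2)[of i] by (rule continuous_on_eq) (simp add: pd_eqI[OF assms(1)])
  then show ?thesis
    using assms(1) by (auto simp: C1_slab_def differentiable_on_def differentiable_def)
qed

text \<open>A single rule that serves scalar products, multiples of vectors, inner products and
  cross products.\<close>

lemma bounded_bilinear_C1_slab:
  assumes b: "bounded_bilinear B" and f: "C1_slab f" and g: "C1_slab g"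
  shows "C1_slab (\<lambda>x. B (f x) (g x))"
    and "x \<in> slab \<Longrightarrow> pd i (\<lambda>x. B (f x) (g x)) x = B (f x) (pd i g x) + B (pd i f x) (g x)"
proof -
  note * = bounded_bilinear.FDERIV[OF b C1_slab_has_derivative[OF f] C1_slab_has_derivative[OF g]]
  show "C1_slab (\<lambda>x. B (f x) (g x))"
    by (rule C1_slabI[OF *])
      (auto simp: pd_def[symmetric] intro!: continuous_on_add bounded_bilinear.continuous_on[OF b] C1_slab_continuous[OF f]
        C1_slab_continuous[OF g] C1_slab_pd_continuous[OF f] C1_slab_pd_continuous[OF g])
  show "x \<in> slab \<Longrightarrow> pd i (\<lambda>x. B (f x) (g x)) x = B (f x) (pd i g x) + B (pd i f x) (g x)"
    by (subst pd_eqI[OF *]) (auto simp: pd_def)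
qed

lemma C1_slab_diff:
  assumes f: "C1_slab f" and g: "C1_slab g"
  shows "C1_slab (\<lambda>x. f x - g x)"
    and "x \<in> slab \<Longrightarrow> pd i (\<lambda>x. f x - g x) x = pd i f x - pd i g x"
proof -
  note * = has_derivative_diff[OF C1_slab_has_derivative[OF f] C1_slab_has_derivative[OF g]]
  show "C1_slab (\<lambda>x. f x - g x)"
    by (rule C1_slabI[OF *]) (auto simp: pd_def[symmetric] intro!: continuous_intros f g C1_slab_pd_continuous)
  show "x \<in> slab \<Longrightarrow> pd i (\<lambda>x. f x - g x) x = pd i f x - pd i g x"
    by (subst pd_eqI[OF *]) (auto simp: pd_def)
qed

lemma C1_slab_nth:
  fixes f :: "real^3 \<Rightarrow> real^3"
  assumes f: "C1_slab f"
  shows "C1_slab (\<lambda>x. f x $ j)"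
    and "x \<in> slab \<Longrightarrow> pd i (\<lambda>x. f x $ j) x = pd i f x $ j"
proof -
  note * = bounded_linear.has_derivative[OF bounded_linear_vec_nth C1_slab_has_derivative[OF f]]
  show "C1_slab (\<lambda>x. f x $ j)"
    by (rule C1_slabI[OF *]) (auto simp: pd_def[symmetric] intro!: continuous_intros f C1_slab_pd_continuous)
  show "x \<in> slab \<Longrightarrow> pd i (\<lambda>x. f x $ j) x = pd i f x $ j"
    by (subst pd_eqI[OF *]) (auto simp: pd_def)
qed

text \<open>The rules for differences and products give derivatives as identities on the slab only;
  this allows such identities to be differentiated once more.\<close>

lemma pd_cong:
  assumes "\<And>x. x \<in> slab \<Longrightarrow> f x = g x" "x \<in> slab"
  shows "pd i f x = pd i g x"
proof -
  have "(f has_derivative D) (at x within slab) \<longleftrightarrow> (g has_derivative D) (at x within slab)" for D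
    using assms by (metis has_derivative_transform)
  then show ?thesis by (simp add: pd_def frechet_derivative_def)
qed

lemma C1_slab_cong:
  assumes "C1_slab f" "\<And>x. x \<in> slab \<Longrightarrow> f x = g x"
  shows "C1_slab g"
proof (rule C1_slabI)
  show "(g has_derivative frechet_derivative f (at x within slab)) (at x within slab)" if "x \<in> slab" for x
    using has_derivative_transform[OF that _ C1_slab_has_derivative[OF assms(1) that], of g] assms(2) by simp
  show "continuous_on slab (\<lambda>x. frechet_derivative f (at x within slab) (axis i 1))" for i
    using C1_slab_pd_continuous[OF assms(1), of i] by (simp add: pd_def[abs_def])
qed

text \<open>Turns \<open>pd\<close>, a derivative within a three-dimensional set, into derivatives
  along coordinate lines, to which the fundamental theorem of calculus applies. The curve must stay
  in the slab, hence the restriction of vertical segments to \<open>{0..1}\<close> below.\<close>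

lemma has_vector_derivative_slab_curve:
  assumes "C1_slab f" "\<gamma> ` T \<subseteq> slab" "s \<in> T" "(\<gamma> has_vector_derivative axis i 1) (at s within T)"
  shows "((\<lambda>s. f (\<gamma> s)) has_vector_derivative pd i f (\<gamma> s)) (at s within T)"
proof -
  have "(f has_derivative frechet_derivative f (at (\<gamma> s) within slab)) (at (\<gamma> s) within \<gamma> ` T)"
    using assms by (intro has_derivative_subset[OF C1_slab_has_derivative]) auto
  from vector_derivative_diff_chain_within[OF assms(4) this] show ?thesis
    by (simp add: pd_def o_def)
qed

lemma vector3_has_vector_derivative:
  "((\<lambda>s. vector [s, y, z] :: real^3) has_vector_derivative axis 1 1) (at s within T)"
  "((\<lambda>s. vector [x, s, z] :: real^3) has_vector_derivative axis 2 1) (at s within T)"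
  "((\<lambda>s. vector [x, y, s] :: real^3) has_vector_derivative axis 3 1) (at s within T)"
  unfolding vector3_conv by (auto intro!: derivative_eq_intros)

lemma pd_has_vector_derivative:
  assumes f: "C1_slab f"
  shows "z \<in> {0..1} \<Longrightarrow> ((\<lambda>s. f (vector [s, y, z])) has_vector_derivative pd 1 f (vector [s, y, z])) (at s within T)"
    and "z \<in> {0..1} \<Longrightarrow> ((\<lambda>s. f (vector [x, s, z])) has_vector_derivative pd 2 f (vector [x, s, z])) (at s within T)"
    and "T \<subseteq> {0..1} \<Longrightarrow> s \<in> T \<Longrightarrow> ((\<lambda>s. f (vector [x, y, s])) has_vector_derivative pd 3 f (vector [x, y, s])) (at s within T)"
proof -
  show "((\<lambda>s. f (vector [s, y, z])) has_vector_derivative pd 1 f (vector [s, y, z])) (at s within T)" if "z \<in> {0..1}"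
  proof (rule has_vector_derivative_within_subset)
    show "((\<lambda>s. f (vector [s, y, z])) has_vector_derivative pd 1 f (vector [s, y, z])) (at s within UNIV)"
      by (rule has_vector_derivative_slab_curve[OF f _ _ vector3_has_vector_derivative(1)])
        (use that in \<open>auto simp: slab_def\<close>)
  qed simp
  show "((\<lambda>s. f (vector [x, s, z])) has_vector_derivative pd 2 f (vector [x, s, z])) (at s within T)" if "z \<in> {0..1}"
  proof (rule has_vector_derivative_within_subset)
    show "((\<lambda>s. f (vector [x, s, z])) has_vector_derivative pd 2 f (vector [x, s, z])) (at s within UNIV)"
      by (rule has_vector_derivative_slab_curve[OF f _ _ vector3_has_vector_derivative(2)])
        (use that in \<open>auto simp: slab_def\<close>)
  qed simp
  show "((\<lambda>s. f (vector [x, y, s])) has_vector_derivative pd 3 f (vector [x, y, s])) (at s within T)"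
    if "T \<subseteq> {0..1}" "s \<in> T"
    by (rule has_vector_derivative_slab_curve[OF f _ _ vector3_has_vector_derivative(3)])
      (use that in \<open>auto simp: slab_def\<close>)
qed

section \<open>Periodicity and the divergence theorem\<close>

lemma periodic_xy_vector:
  assumes "periodic_xy Lx Ly f" "z \<in> {0..1}"
  shows "f (vector [x + Lx, y, z]) = f (vector [x, y, z])" "f (vector [x, y + Ly, z]) = f (vector [x, y, z])"
proof -
  have "vector [x + Lx, y, z] = (vector [x, y, z] :: real^3) + axis 1 Lx"
    "vector [x, y + Ly, z] = (vector [x, y, z] :: real^3) + axis 2 Ly"
    "(vector [x, y, z] :: real^3) \<in> slab"
    using assms(2) by (simp_all add: vec_eq_iff forall_3 axis_def slab_def)
  then show "f (vector [x + Lx, y, z]) = f (vector [x, y, z])" "f (vector [x, y + Ly, z]) = f (vector [x, y, z])"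
    using assms(1) by (auto simp: periodic_xy_def)
qed

lemma integral_zero_cong: "(\<And>x. x \<in> S \<Longrightarrow> f x = 0) \<Longrightarrow> integral S f = 0"
  by (metis Henstock_Kurzweil_Integration.integral_cong integral_0)

text \<open>Integrating first in the direction of the derivative leaves a difference of boundary
  values. These agree by periodicity in the horizontal directions and vanish on the walls in the
  vertical one.\<close>

lemma integral_pd_eq_0:
  fixes f :: "real^3 \<Rightarrow> real"
  assumes f: "C1_slab f" and L: "Lx > 0" "Ly > 0"
  shows "periodic_xy Lx Ly f \<Longrightarrow> integral (cell Lx Ly) (pd 1 f) = 0"
    and "periodic_xy Lx Ly f \<Longrightarrow> integral (cell Lx Ly) (pd 2 f) = 0"
    and "(\<And>x. x \<in> S_minus \<union> S_plus \<Longrightarrow> f x = 0) \<Longrightarrow> integral (cell Lx Ly) (pd 3 f) = 0"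
proof -
  have cont: "continuous_on (cell Lx Ly) (pd i f)" for i
    using continuous_on_subset[OF C1_slab_pd_continuous[OF f] cell_subset_slab] .
  have 1: "integral {0..Lx} (\<lambda>x. pd 1 f (vector [x, y, z])) = f (vector [Lx, y, z]) - f (vector [0, y, z])"
    if "z \<in> {0..1}" for y z
    using L by (intro integral_unique fundamental_theorem_of_calculus pd_has_vector_derivative f that) auto
  have 2: "integral {0..Ly} (\<lambda>y. pd 2 f (vector [x, y, z])) = f (vector [x, Ly, z]) - f (vector [x, 0, z])"
    if "z \<in> {0..1}" for x z
    using L by (intro integral_unique fundamental_theorem_of_calculus pd_has_vector_derivative f that) auto
  have 3: "integral {0..1} (\<lambda>z. pd 3 f (vector [x, y, z])) = f (vector [x, y, 1]) - f (vector [x, y, 0])" for x y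
    by (intro integral_unique fundamental_theorem_of_calculus pd_has_vector_derivative f) auto
  show "integral (cell Lx Ly) (pd 1 f) = 0" if "periodic_xy Lx Ly f"
    unfolding integral_cell_yzx[OF cont]
    by (rule integral_zero_cong, rule integral_zero_cong) (use periodic_xy_vector(1)[OF that, of _ 0] in \<open>simp add: 1\<close>)
  show "integral (cell Lx Ly) (pd 2 f) = 0" if "periodic_xy Lx Ly f"
    unfolding integral_cell_xzy[OF cont]
    by (rule integral_zero_cong, rule integral_zero_cong) (use periodic_xy_vector(2)[OF that, of _ _ 0] in \<open>simp add: 2\<close>)
  show "integral (cell Lx Ly) (pd 3 f) = 0" if "\<And>x. x \<in> S_minus \<union> S_plus \<Longrightarrow> f x = 0"
    unfolding integral_cell_xyz[OF cont]
    by (rule integral_zero_cong, rule integral_zero_cong) (simp add: 3 that S_minus_def S_plus_def)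
qed

text \<open>The divergence theorem for one period cell: the lateral faces cancel in pairs, and the
  walls see only the vertical component.\<close>

lemma integral_divg_eq_0:
  assumes v: "C1_slab v" and L: "Lx > 0" "Ly > 0" and per: "periodic_xy Lx Ly v"
    and bc: "\<And>x. x \<in> S_minus \<union> S_plus \<Longrightarrow> v x $ 3 = 0"
  shows "integral (cell Lx Ly) (divg v) = 0"
proof -
  have cont: "continuous_on (cell Lx Ly) (pd i (\<lambda>x. v x $ j))" for i j
    using continuous_on_subset[OF C1_slab_pd_continuous[OF C1_slab_nth(1)[OF v]] cell_subset_slab] .
  have per': "periodic_xy Lx Ly (\<lambda>x. v x $ j)" for j
    using per by (simp add: periodic_xy_def)
  have "integral (cell Lx Ly) (divg v) = integral (cell Lx Ly)
      (\<lambda>x. pd 1 (\<lambda>x. v x $ 1) x + pd 2 (\<lambda>x. v x $ 2) x + pd 3 (\<lambda>x. v x $ 3) x)"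
  proof (rule Henstock_Kurzweil_Integration.integral_cong)
    fix x assume "x \<in> cell Lx Ly"
    then have "x \<in> slab" using cell_subset_slab by blast
    then show "divg v x = pd 1 (\<lambda>x. v x $ 1) x + pd 2 (\<lambda>x. v x $ 2) x + pd 3 (\<lambda>x. v x $ 3) x"
      by (simp add: divg_def sum_3 C1_slab_nth(2)[OF v])
  qed
  also have "\<dots> = integral (cell Lx Ly) (pd 1 (\<lambda>x. v x $ 1)) + integral (cell Lx Ly) (pd 2 (\<lambda>x. v x $ 2))
      + integral (cell Lx Ly) (pd 3 (\<lambda>x. v x $ 3))"
    using cont by (simp add: cell_def integrable_continuous integrable_add Henstock_Kurzweil_Integration.integral_add)
  also have "\<dots> = 0"
    using integral_pd_eq_0[OF C1_slab_nth(1)[OF v] L] per' bc by simp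
  finally show ?thesis .
qed

section \<open>A Gagliardo-Nirenberg inequality in the layer\<close>

lemma integral_Cauchy_Schwarz:
  fixes f g :: "'a::euclidean_space \<Rightarrow> real"
  assumes "(\<lambda>x. (f x)\<^sup>2) integrable_on S" "(\<lambda>x. (g x)\<^sup>2) integrable_on S" "(\<lambda>x. f x * g x) integrable_on S"
  shows "integral S (\<lambda>x. f x * g x) \<le> sqrt (integral S (\<lambda>x. (f x)\<^sup>2)) * sqrt (integral S (\<lambda>x. (g x)\<^sup>2))"
proof -
  let ?A = "integral S (\<lambda>x. (f x)\<^sup>2)" and ?B = "integral S (\<lambda>x. (g x)\<^sup>2)" and ?C = "integral S (\<lambda>x. f x * g x)"
  have quad: "0 \<le> s\<^sup>2 * ?A - 2 * s * t * ?C + t\<^sup>2 * ?B" for s t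
  proof -
    have "((\<lambda>x. s\<^sup>2 * (f x)\<^sup>2 - 2 * s * t * (f x * g x) + t\<^sup>2 * (g x)\<^sup>2) has_integral
        s\<^sup>2 * ?A - 2 * s * t * ?C + t\<^sup>2 * ?B) S"
      using assms by (intro has_integral_add has_integral_diff has_integral_mult_right integrable_integral)
    moreover have "s\<^sup>2 * (f x)\<^sup>2 - 2 * s * t * (f x * g x) + t\<^sup>2 * (g x)\<^sup>2 = (s * f x - t * g x)\<^sup>2" for x
      by (simp add: power2_eq_square algebra_simps)
    ultimately have "((\<lambda>x. (s * f x - t * g x)\<^sup>2) has_integral
        s\<^sup>2 * ?A - 2 * s * t * ?C + t\<^sup>2 * ?B) S" by simp
    then show ?thesis by (rule has_integral_nonneg) simp
  qed
  have AB: "0 \<le> ?A" "0 \<le> ?B" using assms by (auto intro: integral_nonneg)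
  have "?C\<^sup>2 \<le> ?A * ?B"
  proof (cases "?B = 0")
    case True
    have "?C = 0"
    proof (rule ccontr)
      assume C: "?C \<noteq> 0"
      \<comment> \<open>With \<open>?B = 0\<close> the form is linear in \<open>t\<close>; this
        choice of \<open>t\<close> makes its value \<open>- 1\<close>.\<close>
      have "0 \<le> ?A - 2 * ((?A + 1) / (2 * ?C)) * ?C" using quad[of 1 "(?A + 1) / (2 * ?C)"] True by simp
      then show False using C by simp
    qed
    then show ?thesis using True by simp
  next
    case False
    then have "0 < ?B" using AB by simp
    \<comment> \<open>At \<open>s = ?B\<close> and \<open>t = ?C\<close> the form factors, and the
      discriminant appears.\<close>
    have "0 \<le> ?B * (?A * ?B - ?C\<^sup>2)"
      using quad[of ?B ?C] by (simp add: power2_eq_square algebra_simps)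
    then show ?thesis using \<open>0 < ?B\<close> by (simp add: zero_le_mult_iff)
  qed
  then have "\<bar>?C\<bar> \<le> sqrt (?A * ?B)" by (simp add: real_le_rsqrt flip: real_sqrt_abs)
  then show ?thesis by (simp add: real_sqrt_mult)
qed

lemma integral_sqrt_mult_le:
  fixes a b :: "real \<Rightarrow> real"
  assumes "continuous_on {u..v} a" "continuous_on {u..v} b"
    and "\<And>x. x \<in> {u..v} \<Longrightarrow> 0 \<le> a x" "\<And>x. x \<in> {u..v} \<Longrightarrow> 0 \<le> b x"
  shows "integral {u..v} (\<lambda>x. sqrt (a x) * sqrt (b x)) \<le> sqrt (integral {u..v} a) * sqrt (integral {u..v} b)"
proof -
  have "integral {u..v} (\<lambda>x. (sqrt (a x))\<^sup>2) = integral {u..v} a"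
    "integral {u..v} (\<lambda>x. (sqrt (b x))\<^sup>2) = integral {u..v} b"
    using assms by (auto intro!: Henstock_Kurzweil_Integration.integral_cong)
  moreover have "integral {u..v} (\<lambda>x. sqrt (a x) * sqrt (b x)) \<le>
      sqrt (integral {u..v} (\<lambda>x. (sqrt (a x))\<^sup>2)) * sqrt (integral {u..v} (\<lambda>x. (sqrt (b x))\<^sup>2))"
    using assms by (intro integral_Cauchy_Schwarz integrable_continuous_real continuous_intros)
  ultimately show ?thesis by simp
qed

lemma continuous_on_curry:
  assumes "continuous_on (A \<times> B) (\<lambda>p. f (fst p) (snd p))"
  shows "x \<in> A \<Longrightarrow> continuous_on B (f x)" "y \<in> B \<Longrightarrow> continuous_on A (\<lambda>x. f x y)"
  by (rule continuous_on_compose2[OF assms, of _ "\<lambda>y. (x, y)", simplified]; auto intro!: continuous_intros)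
    (rule continuous_on_compose2[OF assms, of _ "\<lambda>x. (x, y)", simplified]; auto intro!: continuous_intros)

text \<open>Each variable is missing from exactly one of the three factors. Integrating in
  \<open>z\<close>, \<open>y\<close> and \<open>x\<close> in turn, the factor without the variable
  is constant and Cauchy-Schwarz separates the other two.\<close>

lemma loomis_whitney:
  fixes f :: "real^3 \<Rightarrow> real" and F G H :: "real \<Rightarrow> real \<Rightarrow> real"
  assumes f: "continuous_on (cell Lx Ly) f"
    and F: "continuous_on ({0..Ly} \<times> {0..1}) (\<lambda>p. F (fst p) (snd p))"
    and G: "continuous_on ({0..Lx} \<times> {0..1}) (\<lambda>p. G (fst p) (snd p))"
    and H: "continuous_on ({0..Lx} \<times> {0..Ly}) (\<lambda>p. H (fst p) (snd p))"
    and F0: "\<And>y z. y \<in> {0..Ly} \<Longrightarrow> z \<in> {0..1} \<Longrightarrow> 0 \<le> F y z"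
    and G0: "\<And>x z. x \<in> {0..Lx} \<Longrightarrow> z \<in> {0..1} \<Longrightarrow> 0 \<le> G x z"
    and H0: "\<And>x y. x \<in> {0..Lx} \<Longrightarrow> y \<in> {0..Ly} \<Longrightarrow> 0 \<le> H x y"
    and le: "\<And>x y z. x \<in> {0..Lx} \<Longrightarrow> y \<in> {0..Ly} \<Longrightarrow> z \<in> {0..1} \<Longrightarrow>
      f (vector [x, y, z]) \<le> sqrt (F y z) * sqrt (G x z) * sqrt (H x y)"
  shows "integral (cell Lx Ly) f \<le> sqrt (integral {0..Ly} (\<lambda>y. integral {0..1} (F y)))
    * sqrt (integral {0..Lx} (\<lambda>x. integral {0..1} (G x))) * sqrt (integral {0..Lx} (\<lambda>x. integral {0..Ly} (H x)))"
proof -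
  define Fz where "Fz y = integral {0..1} (F y)" for y
  define Gz where "Gz x = integral {0..1} (G x)" for x
  define Hy where "Hy x = integral {0..Ly} (H x)" for x
  have cFz: "continuous_on {0..Ly} Fz" and cGz: "continuous_on {0..Lx} Gz" and cHy: "continuous_on {0..Lx} Hy"
    unfolding Fz_def Gz_def Hy_def by (intro continuous_on_integral_param F G H)+
  have Fz0: "0 \<le> Fz y" if "y \<in> {0..Ly}" for y
    unfolding Fz_def using that F0 by (intro integral_nonneg integrable_continuous_real continuous_on_curry[OF F]) auto
  have Gz0: "0 \<le> Gz x" if "x \<in> {0..Lx}" for x
    unfolding Gz_def using that G0 by (intro integral_nonneg integrable_continuous_real continuous_on_curry[OF G]) auto
  have Hy0: "0 \<le> Hy x" if "x \<in> {0..Lx}" for x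
    unfolding Hy_def using that H0 by (intro integral_nonneg integrable_continuous_real continuous_on_curry[OF H]) auto
  have z: "integral {0..1} (\<lambda>z. f (vector [x, y, z])) \<le> sqrt (Gz x) * (sqrt (Fz y) * sqrt (H x y))"
    if x: "x \<in> {0..Lx}" and y: "y \<in> {0..Ly}" for x y
  proof -
    have cF: "continuous_on {0..1} (F y)" and cG: "continuous_on {0..1} (G x)"
      using x y by (auto intro: continuous_on_curry[OF F] continuous_on_curry[OF G])
    have "integral {0..1} (\<lambda>z. f (vector [x, y, z])) \<le> integral {0..1} (\<lambda>z. sqrt (H x y) * (sqrt (F y z) * sqrt (G x z)))"
      using x y le[OF x y]
      by (intro integral_le integrable_continuous_real continuous_on_cell_compose[OF f] continuous_intros cF cG)
        (auto simp: mult_ac)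
    also have "\<dots> = sqrt (H x y) * integral {0..1} (\<lambda>z. sqrt (F y z) * sqrt (G x z))" by simp
    also have "\<dots> \<le> sqrt (H x y) * (sqrt (Fz y) * sqrt (Gz x))"
      unfolding Fz_def Gz_def using F0[OF y] G0[OF x] H0[OF x y] cF cG
      by (intro mult_left_mono integral_sqrt_mult_le) auto
    finally show ?thesis by (simp add: mult_ac)
  qed
  have yz: "integral {0..Ly} (\<lambda>y. integral {0..1} (\<lambda>z. f (vector [x, y, z])))
      \<le> sqrt (integral {0..Ly} Fz) * (sqrt (Gz x) * sqrt (Hy x))"
    if x: "x \<in> {0..Lx}" for x
  proof -
    have cH: "continuous_on {0..Ly} (H x)" using x by (intro continuous_on_curry[OF H])
    have "integral {0..Ly} (\<lambda>y. integral {0..1} (\<lambda>z. f (vector [x, y, z])))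
        \<le> integral {0..Ly} (\<lambda>y. sqrt (Gz x) * (sqrt (Fz y) * sqrt (H x y)))"
      using x by (intro integral_le integrable_continuous_real continuous_on_integral_param
          continuous_on_cell_compose[OF f] continuous_intros cFz cH z) auto
    also have "\<dots> = sqrt (Gz x) * integral {0..Ly} (\<lambda>y. sqrt (Fz y) * sqrt (H x y))" by simp
    also have "\<dots> \<le> sqrt (Gz x) * (sqrt (integral {0..Ly} Fz) * sqrt (Hy x))"
      unfolding Hy_def using Fz0 H0[OF x] Gz0[OF x] cFz cH
      by (intro mult_left_mono integral_sqrt_mult_le) auto
    finally show ?thesis by (simp add: mult_ac)
  qed
  have "integral (cell Lx Ly) f \<le> integral {0..Lx} (\<lambda>x. sqrt (integral {0..Ly} Fz) * (sqrt (Gz x) * sqrt (Hy x)))"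
    unfolding integral_cell_xyz[OF f]
    by (intro integral_le integrable_continuous_real continuous_on_integral_param
          continuous_on_cell_compose[OF f] continuous_intros cGz cHy yz) auto
  also have "\<dots> = sqrt (integral {0..Ly} Fz) * integral {0..Lx} (\<lambda>x. sqrt (Gz x) * sqrt (Hy x))" by simp
  also have "\<dots> \<le> sqrt (integral {0..Ly} Fz) * (sqrt (integral {0..Lx} Gz) * sqrt (integral {0..Lx} Hy))"
    using Gz0 Hy0 cGz cHy integral_nonneg[OF integrable_continuous_real[OF cFz] Fz0]
    by (intro mult_left_mono integral_sqrt_mult_le) auto
  finally show ?thesis by (simp add: mult_ac Fz_def[abs_def] Gz_def[abs_def] Hy_def[abs_def])
qed

text \<open>Loomis-Whitney applied to \<open>norm B ^ 4\<close>, whose suprema along the three axes are bounded by its mean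
  and its variation. The doubled coefficient of \<open>d 3\<close> is the price for the missing periodicity in the
  vertical direction.\<close>

lemma gagliardo_nirenberg_cell:
  fixes B :: "real^3 \<Rightarrow> real^3"
  assumes L: "Lx > 0" "Ly > 0" and B: "C1_slab B" and per: "periodic_xy Lx Ly B"
  defines "\<beta> \<equiv> sqrt (integral (cell Lx Ly) (\<lambda>x. (norm (B x))\<^sup>2))"
    and "d \<equiv> \<lambda>i. sqrt (integral (cell Lx Ly) (\<lambda>x. (norm (pd i B x))\<^sup>2))"
  shows "sqrt (integral (cell Lx Ly) (\<lambda>x. norm (B x) ^ 6))
    \<le> (\<beta> / Lx + 2 * d 1) * (\<beta> / Ly + 2 * d 2) * (\<beta> + 4 * d 3)"
proof -
  define V where "V = cell Lx Ly"
  \<comment> \<open>\<open>norm B ^ 4\<close> is built from inner products because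
    \<open>norm\<close> is not differentiable where its argument vanishes.\<close>
  define e where "e x = B x \<bullet> B x" for x
  define g where "g x = e x * e x" for x
  have C1e: "C1_slab e" unfolding e_def
    by (rule bounded_bilinear_C1_slab(1)[OF bounded_bilinear_inner B B])
  have C1g: "C1_slab g" unfolding g_def
    by (rule bounded_bilinear_C1_slab(1)[OF bounded_bilinear_mult C1e C1e])
  have en: "e x = (norm (B x))\<^sup>2" for x by (simp add: e_def power2_norm_eq_inner)
  have gn: "g x = norm (B x) ^ 4" for x by (simp add: g_def en flip: power_add)
  have pdg: "pd i g x = 4 * (e x * (B x \<bullet> pd i B x))" if "x \<in> slab" for i x
    unfolding g_def bounded_bilinear_C1_slab(2)[OF bounded_bilinear_mult C1e C1e that]
    unfolding e_def bounded_bilinear_C1_slab(2)[OF bounded_bilinear_inner B B that]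
    by (simp add: inner_commute algebra_simps)
  note on_V = continuous_on_subset[OF _ cell_subset_slab[of Lx Ly, folded V_def]]
  have cB: "continuous_on V B" and cpB: "continuous_on V (pd i B)" and cg: "continuous_on V g"
    and cpg: "continuous_on V (pd i g)" for i
    by (intro on_V C1_slab_continuous C1_slab_pd_continuous B C1g)+
  have int: "h integrable_on V" if "continuous_on V h" for h :: "real^3 \<Rightarrow> real"
    using that by (simp add: V_def cell_def integrable_continuous)
  \<comment> \<open>\<open>b\<close> is the unknown. The bounds for the mean and the variation of
    \<open>g\<close> are both linear in it, since \<open>norm B ^ 4\<close> and its gradient carry a
    factor \<open>norm B ^ 3\<close>. The three square roots of Loomis-Whitney then produce the
    power 3/2 of \<open>b\<close>, against \<open>b ^ 2\<close> on the left.\<close>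
  define b where "b = sqrt (integral V (\<lambda>x. norm (B x) ^ 6))"
  have pow: "(norm (B x) ^ 3)\<^sup>2 = norm (B x) ^ 6" for x by (simp flip: power_mult)
  have b0: "0 \<le> b" unfolding b_def by (intro real_sqrt_ge_zero integral_nonneg int continuous_intros cB) auto
  have \<beta>0: "0 \<le> \<beta>" unfolding \<beta>_def V_def[symmetric]
    by (intro real_sqrt_ge_zero integral_nonneg int continuous_intros cB) auto
  have d0: "0 \<le> d i" for i unfolding d_def V_def[symmetric]
    by (intro real_sqrt_ge_zero integral_nonneg int continuous_intros cpB) auto
  have Ig: "integral V g \<le> b * \<beta>"
  proof -
    have "integral V (\<lambda>x. norm (B x) ^ 3 * norm (B x)) \<le> b * \<beta>"
      unfolding b_def \<beta>_def V_def[symmetric] pow[symmetric]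
      by (intro integral_Cauchy_Schwarz int continuous_intros cB)
    then show ?thesis by (simp add: gn[abs_def] eval_nat_numeral mult_ac)
  qed
  have Ipg: "integral V (\<lambda>x. \<bar>pd i g x\<bar>) \<le> 4 * (b * d i)" for i
  proof -
    have "integral V (\<lambda>x. \<bar>pd i g x\<bar>) \<le> integral V (\<lambda>x. 4 * (norm (B x) ^ 3 * norm (pd i B x)))"
    proof (intro integral_le int continuous_intros cpg cB cpB)
      fix x assume "x \<in> V"
      then have "x \<in> slab" using cell_subset_slab V_def by blast
      then have "\<bar>pd i g x\<bar> = 4 * ((norm (B x))\<^sup>2 * \<bar>B x \<bullet> pd i B x\<bar>)"
        by (simp add: pdg en abs_mult)
      also have "\<dots> \<le> 4 * ((norm (B x))\<^sup>2 * (norm (B x) * norm (pd i B x)))"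
        by (intro mult_left_mono Cauchy_Schwarz_ineq2) auto
      finally show "\<bar>pd i g x\<bar> \<le> 4 * (norm (B x) ^ 3 * norm (pd i B x))"
        by (simp add: eval_nat_numeral mult_ac)
    qed
    also have "\<dots> = 4 * integral V (\<lambda>x. norm (B x) ^ 3 * norm (pd i B x))" by simp
    also have "\<dots> \<le> 4 * (b * d i)"
      unfolding b_def d_def V_def[symmetric] pow[symmetric]
      by (intro mult_left_mono integral_Cauchy_Schwarz int continuous_intros cB cpB) auto
    finally show ?thesis .
  qed
  \<comment> \<open>\<open>F\<close>, \<open>G\<close> and \<open>H\<close> bound the supremum of
    \<open>g\<close> along a line in their missing direction. The factor \<open>1 / 1\<close> in
    \<open>H\<close> is the form that \<open>interval_sup_bound\<close> takes at
    \<open>L = 1\<close>.\<close>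
  define F where "F y z = (1 / Lx) * integral {0..Lx} (\<lambda>x. g (vector [x, y, z]))
      + 1 / 2 * integral {0..Lx} (\<lambda>x. \<bar>pd 1 g (vector [x, y, z])\<bar>)" for y z
  define G where "G x z = (1 / Ly) * integral {0..Ly} (\<lambda>y. g (vector [x, y, z]))
      + 1 / 2 * integral {0..Ly} (\<lambda>y. \<bar>pd 2 g (vector [x, y, z])\<bar>)" for x z
  define H where "H x y = (1 / 1) * integral {0..1} (\<lambda>z. g (vector [x, y, z]))
      + integral {0..1} (\<lambda>z. \<bar>pd 3 g (vector [x, y, z])\<bar>)" for x y
  have cg': "continuous_on (cell Lx Ly) g" and capg': "continuous_on (cell Lx Ly) (\<lambda>x. \<bar>pd i g x\<bar>)"
    and cpg': "continuous_on (cell Lx Ly) (pd i g)" for i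
    using cg cpg by (auto simp: V_def intro!: continuous_intros)
  note cc = continuous_on_cell_compose[OF cg'] continuous_on_cell_compose[OF capg'] continuous_on_cell_compose[OF cpg']
  have gF: "g (vector [x, y, z]) \<le> F y z" if "x \<in> {0..Lx}" "y \<in> {0..Ly}" "z \<in> {0..1}" for x y z
    unfolding F_def
  proof (rule periodic_sup_bound)
    show "((\<lambda>x. g (vector [x, y, z])) has_real_derivative pd 1 g (vector [x, y, z])) (at x within {0..Lx})" for x
      using pd_has_vector_derivative(1)[OF C1g] that
      by (simp add: has_real_derivative_iff_has_vector_derivative)
    show "g (vector [Lx, y, z]) = g (vector [0, y, z])"
      using periodic_xy_vector(1)[OF per, of z 0 y] that by (simp add: gn)
  qed (use that L in \<open>auto intro!: cc continuous_intros\<close>)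
  have gG: "g (vector [x, y, z]) \<le> G x z" if "x \<in> {0..Lx}" "y \<in> {0..Ly}" "z \<in> {0..1}" for x y z
    unfolding G_def
  proof (rule periodic_sup_bound[where g = "\<lambda>y. g (vector [x, y, z])"])
    show "((\<lambda>y. g (vector [x, y, z])) has_real_derivative pd 2 g (vector [x, y, z])) (at y within {0..Ly})" for y
      using pd_has_vector_derivative(2)[OF C1g] that
      by (simp add: has_real_derivative_iff_has_vector_derivative)
    show "g (vector [x, Ly, z]) = g (vector [x, 0, z])"
      using periodic_xy_vector(2)[OF per, of z x 0] that by (simp add: gn)
  qed (use that L in \<open>auto intro!: cc continuous_intros\<close>)
  have gH: "g (vector [x, y, z]) \<le> H x y" if "x \<in> {0..Lx}" "y \<in> {0..Ly}" "z \<in> {0..1}" for x y z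
    unfolding H_def
  proof (rule interval_sup_bound[where g = "\<lambda>z. g (vector [x, y, z])"])
    show "((\<lambda>z. g (vector [x, y, z])) has_real_derivative pd 3 g (vector [x, y, z])) (at z within {0..1})"
      if "z \<in> {0..1}" for z
      using pd_has_vector_derivative(3)[OF C1g, of "{0..1}"] that
      by (simp add: has_real_derivative_iff_has_vector_derivative)
  qed (use that L in \<open>auto intro!: cc continuous_intros\<close>)
  have g0: "0 \<le> g x" for x by (simp add: gn)
  have contF: "continuous_on ({0..Ly} \<times> {0..1}) (\<lambda>p. F (fst p) (snd p))"
    unfolding F_def by (intro continuous_intros continuous_on_integral_param cc) auto
  have contG: "continuous_on ({0..Lx} \<times> {0..1}) (\<lambda>p. G (fst p) (snd p))"
    unfolding G_def by (intro continuous_intros continuous_on_integral_param cc) auto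
  have contH: "continuous_on ({0..Lx} \<times> {0..Ly}) (\<lambda>p. H (fst p) (snd p))"
    unfolding H_def by (intro continuous_intros continuous_on_integral_param cc) auto
  have F0: "0 \<le> F y z" if "y \<in> {0..Ly}" "z \<in> {0..1}" for y z
    using gF[of 0 y z] g0[of "vector [0, y, z]"] that L by auto
  have G0: "0 \<le> G x z" if "x \<in> {0..Lx}" "z \<in> {0..1}" for x z
    using gG[of x 0 z] g0[of "vector [x, 0, z]"] that L by auto
  have H0: "0 \<le> H x y" if "x \<in> {0..Lx}" "y \<in> {0..Ly}" for x y
    using gH[of x y 0] g0[of "vector [x, y, 0]"] that L by auto
  have IG: "0 \<le> integral {0..Lx} (\<lambda>x. integral {0..1} (G x))"
    using G0 by (intro integral_nonneg integrable_continuous_real continuous_on_integral_param contG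
        continuous_on_curry[OF contG]) auto
  have IH: "0 \<le> integral {0..Lx} (\<lambda>x. integral {0..Ly} (H x))"
    using H0 by (intro integral_nonneg integrable_continuous_real continuous_on_integral_param contH
        continuous_on_curry[OF contH]) auto
  have "integral V (\<lambda>x. norm (B x) ^ 6) \<le> sqrt (integral {0..Ly} (\<lambda>y. integral {0..1} (F y)))
    * sqrt (integral {0..Lx} (\<lambda>x. integral {0..1} (G x))) * sqrt (integral {0..Lx} (\<lambda>x. integral {0..Ly} (H x)))"
    unfolding V_def
  proof (rule loomis_whitney[OF _ contF contG contH F0 G0 H0])
    show "continuous_on (cell Lx Ly) (\<lambda>x. norm (B x) ^ 6)"
      using cB by (auto simp: V_def intro!: continuous_intros)
    fix x y z assume *: "x \<in> {0..Lx}" "y \<in> {0..Ly}" "z \<in> {0..(1::real)}"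
    let ?v = "vector [x, y, z]"
    have "norm (B ?v) ^ 6 = sqrt (g ?v) * sqrt (g ?v) * sqrt (g ?v)"
    proof -
      have "sqrt (g ?v) = (norm (B ?v))\<^sup>2" by (rule real_sqrt_unique) (auto simp: gn simp flip: power_mult)
      then show ?thesis by (simp flip: power_add)
    qed
    also have "\<dots> \<le> sqrt (F y z) * sqrt (G x z) * sqrt (H x y)"
      using gF[OF *] gG[OF *] gH[OF *] g0[of ?v] by (intro mult_mono real_sqrt_le_mono) auto
    finally show "norm (B ?v) ^ 6 \<le> sqrt (F y z) * sqrt (G x z) * sqrt (H x y)" .
  qed
  also have "\<dots> \<le> sqrt (b * (\<beta> / Lx + 2 * d 1)) * sqrt (b * (\<beta> / Ly + 2 * d 2)) * sqrt (b * (\<beta> + 4 * d 3))"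
  proof (intro mult_mono real_sqrt_le_mono)
    have "integral {0..Ly} (\<lambda>y. integral {0..1} (F y)) =
        (1 / Lx) * integral V g + 1 / 2 * integral V (\<lambda>x. \<bar>pd 1 g x\<bar>)"
    proof -
      have "integral {0..1} (F y) = (1 / Lx) * integral {0..1} (\<lambda>z. integral {0..Lx} (\<lambda>x. g (vector [x, y, z])))
          + 1 / 2 * integral {0..1} (\<lambda>z. integral {0..Lx} (\<lambda>x. \<bar>pd 1 g (vector [x, y, z])\<bar>))"
        if "y \<in> {0..Ly}" for y
        unfolding F_def using that L
        by (subst Henstock_Kurzweil_Integration.integral_add)
          (auto intro!: integrable_continuous_real continuous_on_integral_param continuous_intros cc)
      then have "integral {0..Ly} (\<lambda>y. integral {0..1} (F y)) = integral {0..Ly} (\<lambda>y.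
          (1 / Lx) * integral {0..1} (\<lambda>z. integral {0..Lx} (\<lambda>x. g (vector [x, y, z])))
          + 1 / 2 * integral {0..1} (\<lambda>z. integral {0..Lx} (\<lambda>x. \<bar>pd 1 g (vector [x, y, z])\<bar>)))"
        by (intro Henstock_Kurzweil_Integration.integral_cong) auto
      also have "\<dots> = (1 / Lx) * integral V g + 1 / 2 * integral V (\<lambda>x. \<bar>pd 1 g x\<bar>)"
        unfolding V_def integral_cell_yzx[OF cg'] integral_cell_yzx[OF capg'] using L
        by (subst Henstock_Kurzweil_Integration.integral_add)
          (auto intro!: integrable_continuous_real continuous_on_integral_param continuous_intros cc)
      finally show ?thesis .
    qed
    also have "\<dots> \<le> (1 / Lx) * (b * \<beta>) + 1 / 2 * (4 * (b * d 1))"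
      using L by (intro add_mono mult_left_mono Ig Ipg) auto
    finally show "integral {0..Ly} (\<lambda>y. integral {0..1} (F y)) \<le> b * (\<beta> / Lx + 2 * d 1)"
      by (simp add: algebra_simps)
    have "integral {0..Lx} (\<lambda>x. integral {0..1} (G x)) =
        (1 / Ly) * integral V g + 1 / 2 * integral V (\<lambda>x. \<bar>pd 2 g x\<bar>)"
    proof -
      have "integral {0..1} (G x) = (1 / Ly) * integral {0..1} (\<lambda>z. integral {0..Ly} (\<lambda>y. g (vector [x, y, z])))
          + 1 / 2 * integral {0..1} (\<lambda>z. integral {0..Ly} (\<lambda>y. \<bar>pd 2 g (vector [x, y, z])\<bar>))"
        if "x \<in> {0..Lx}" for x
        unfolding G_def using that L
        by (subst Henstock_Kurzweil_Integration.integral_add)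
          (auto intro!: integrable_continuous_real continuous_on_integral_param continuous_intros cc)
      then have "integral {0..Lx} (\<lambda>x. integral {0..1} (G x)) = integral {0..Lx} (\<lambda>x.
          (1 / Ly) * integral {0..1} (\<lambda>z. integral {0..Ly} (\<lambda>y. g (vector [x, y, z])))
          + 1 / 2 * integral {0..1} (\<lambda>z. integral {0..Ly} (\<lambda>y. \<bar>pd 2 g (vector [x, y, z])\<bar>)))"
        by (intro Henstock_Kurzweil_Integration.integral_cong) auto
      also have "\<dots> = (1 / Ly) * integral V g + 1 / 2 * integral V (\<lambda>x. \<bar>pd 2 g x\<bar>)"
        unfolding V_def integral_cell_xzy[OF cg'] integral_cell_xzy[OF capg'] using L
        by (subst Henstock_Kurzweil_Integration.integral_add)
          (auto intro!: integrable_continuous_real continuous_on_integral_param continuous_intros cc)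
      finally show ?thesis .
    qed
    also have "\<dots> \<le> (1 / Ly) * (b * \<beta>) + 1 / 2 * (4 * (b * d 2))"
      using L by (intro add_mono mult_left_mono Ig Ipg) auto
    finally show "integral {0..Lx} (\<lambda>x. integral {0..1} (G x)) \<le> b * (\<beta> / Ly + 2 * d 2)"
      by (simp add: algebra_simps)
    have "integral {0..Lx} (\<lambda>x. integral {0..Ly} (H x)) = integral V g + integral V (\<lambda>x. \<bar>pd 3 g x\<bar>)"
    proof -
      have "integral {0..Ly} (H x) = integral {0..Ly} (\<lambda>y. integral {0..1} (\<lambda>z. g (vector [x, y, z])))
          + integral {0..Ly} (\<lambda>y. integral {0..1} (\<lambda>z. \<bar>pd 3 g (vector [x, y, z])\<bar>))"
        if "x \<in> {0..Lx}" for x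
        unfolding H_def using that L
        by (subst Henstock_Kurzweil_Integration.integral_add)
          (auto intro!: integrable_continuous_real continuous_on_integral_param continuous_intros cc)
      then have "integral {0..Lx} (\<lambda>x. integral {0..Ly} (H x)) = integral {0..Lx} (\<lambda>x.
          integral {0..Ly} (\<lambda>y. integral {0..1} (\<lambda>z. g (vector [x, y, z])))
          + integral {0..Ly} (\<lambda>y. integral {0..1} (\<lambda>z. \<bar>pd 3 g (vector [x, y, z])\<bar>)))"
        by (intro Henstock_Kurzweil_Integration.integral_cong) auto
      also have "\<dots> = integral V g + integral V (\<lambda>x. \<bar>pd 3 g x\<bar>)"
        unfolding V_def integral_cell_xyz[OF cg'] integral_cell_xyz[OF capg'] using L
        by (subst Henstock_Kurzweil_Integration.integral_add)
          (auto intro!: integrable_continuous_real continuous_on_integral_param continuous_intros cc)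
      finally show ?thesis .
    qed
    also have "\<dots> \<le> b * \<beta> + 4 * (b * d 3)"
      by (intro add_mono Ig Ipg)
    finally show "integral {0..Lx} (\<lambda>x. integral {0..Ly} (H x)) \<le> b * (\<beta> + 4 * d 3)"
      by (simp add: algebra_simps)
  qed (use IG IH b0 \<beta>0 d0 L in auto)
  also have "\<dots> = sqrt (b ^ 3 * ((\<beta> / Lx + 2 * d 1) * (\<beta> / Ly + 2 * d 2) * (\<beta> + 4 * d 3)))"
    by (simp add: eval_nat_numeral mult_ac flip: real_sqrt_mult)
  finally have "integral V (\<lambda>x. norm (B x) ^ 6) \<le> sqrt (b ^ 3 * ((\<beta> / Lx + 2 * d 1) * (\<beta> / Ly + 2 * d 2) * (\<beta> + 4 * d 3)))"
    (is "_ \<le> sqrt (b ^ 3 * ?a)") .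
  moreover have "integral V (\<lambda>x. norm (B x) ^ 6) = b\<^sup>2"
    unfolding b_def by (intro real_sqrt_pow2[symmetric] integral_nonneg int continuous_intros cB) auto
  ultimately have "b\<^sup>2 \<le> sqrt (b ^ 3 * ?a)" by simp
  moreover have a0: "0 \<le> ?a" using \<beta>0 d0 L by simp
  ultimately have "(b\<^sup>2)\<^sup>2 \<le> b ^ 3 * ?a" using b0 by (metis mult_nonneg_nonneg power_mono real_sqrt_pow2 zero_le_power zero_le_power2)
  then have "b ^ 3 * b \<le> b ^ 3 * ?a" by (simp add: eval_nat_numeral mult_ac)
  \<comment> \<open>Cancelling \<open>b ^ 3\<close> leaves the claim; for \<open>b = 0\<close> it is
    immediate.\<close>
  then have "b \<le> ?a" using b0 a0 by (cases "b = 0") (auto simp: mult_le_cancel_left_pos)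
  then show ?thesis by (simp add: b_def V_def)
qed

section \<open>The Sobolev and Poincare inequalities\<close>

lemma mult3_le_mean_cube:
  fixes a b c :: real
  assumes "0 \<le> a" "0 \<le> b" "0 \<le> c"
  shows "a * b * c \<le> ((a + b + c) / 3) ^ 3"
proof -
  \<comment> \<open>An explicit certificate: the first summand equals
    \<open>a ^ 3 + b ^ 3 + c ^ 3 - 3 * a * b * c\<close>, and the second supplies the mixed terms of
    the cube.\<close>
  have "0 \<le> (a + b + c) * ((a - b)\<^sup>2 + (b - c)\<^sup>2 + (c - a)\<^sup>2) / 2
      + 3 * (a * (b - c)\<^sup>2 + b * (c - a)\<^sup>2 + c * (a - b)\<^sup>2)"
    using assms by (intro add_nonneg_nonneg mult_nonneg_nonneg divide_nonneg_nonneg) auto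
  also have "\<dots> = (a + b + c) ^ 3 - 27 * (a * b * c)"
    by (simp add: eval_nat_numeral field_simps)
  finally show ?thesis by (simp add: power_divide)
qed

text \<open>Applied to the three directional factors, this trades their product for a Euclidean
  norm, in which the partial derivatives combine into the full gradient.\<close>

lemma mult3_le_norm_cube:
  fixes a b c :: real
  assumes "0 \<le> a" "0 \<le> b" "0 \<le> c"
  shows "a * b * c \<le> (sqrt (a\<^sup>2 + b\<^sup>2 + c\<^sup>2) / sqrt 3) ^ 3"
proof (rule power2_le_imp_le)
  have "(a * b * c)\<^sup>2 = a\<^sup>2 * b\<^sup>2 * c\<^sup>2" by (simp add: power_mult_distrib)
  also have "\<dots> \<le> ((a\<^sup>2 + b\<^sup>2 + c\<^sup>2) / 3) ^ 3" by (rule mult3_le_mean_cube) auto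
  also have "\<dots> = ((sqrt (a\<^sup>2 + b\<^sup>2 + c\<^sup>2) / sqrt 3)\<^sup>2) ^ 3" by (simp add: power_divide)
  finally show "(a * b * c)\<^sup>2 \<le> ((sqrt (a\<^sup>2 + b\<^sup>2 + c\<^sup>2) / sqrt 3) ^ 3)\<^sup>2"
    by (simp flip: power_mult)
qed simp

section \<open>The Sobolev constant\<close>

lemma lambda1_bounds:
  assumes "Lx > 0" "Ly > 0"
  shows "0 < lambda1 Lx Ly" "lambda1 Lx Ly \<le> pi" "lambda1 Lx Ly \<le> 2 * pi / Lx" "lambda1 Lx Ly \<le> 2 * pi / Ly"
  using assms by (auto simp: lambda1_def)

text \<open>The left-hand side is what the Gagliardo-Nirenberg argument yields. Its coefficient of the gradient is
  larger than the one in \<open>C_S\<close>; the surplus in the lower order term makes up for it because \<open>lambda1 \<le> pi\<close>.\<close>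

lemma C_S_ge:
  assumes L: "Lx > 0" "Ly > 0"
  shows "2 powr (1 / 3) / sqrt 3 * (2 + sqrt (1 / 4 + 1 / Lx\<^sup>2 + 1 / Ly\<^sup>2) / lambda1 Lx Ly) \<le> C_S Lx Ly"
proof -
  define a where "a = 1 / Lx\<^sup>2 + 1 / Ly\<^sup>2"
  define l where "l = lambda1 Lx Ly"
  \<comment> \<open>\<open>m\<close> is what remains of the prefactor of \<open>C_S\<close> after
    \<open>2 powr (1 / 3) / sqrt 3\<close> is split off; it is about 1.66.\<close>
  define m :: real where "m = 2 * sqrt 2 * 2 powr (1 / 3) / pi powr (2 / 3)"
  have a0: "0 \<le> a" by (simp add: a_def)
  have l: "0 < l" "l \<le> 3.15" using lambda1_bounds[OF L] pi_approx by (auto simp: l_def)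
  \<comment> \<open>The sixth power removes the square root and the cube roots.\<close>
  have "1.65 \<le> m"
  proof (rule power_le_imp_le_base)
    have "m ^ 6 = 2 ^ 6 * (sqrt 2) ^ 6 * (2 powr (1 / 3)) ^ 6 / (pi powr (2 / 3)) ^ 6"
      by (simp add: m_def power_mult_distrib power_divide)
    also have "(sqrt 2) ^ 6 = ((sqrt 2)\<^sup>2) ^ 3" unfolding power_mult[symmetric] by simp
    also have "(2 powr (1 / 3)) ^ 6 = (2::real) powr 2" by (simp add: powr_power)
    also have "(pi powr (2 / 3)) ^ 6 = pi powr 4" by (simp add: powr_power)
    finally have "m ^ 6 = 2048 / pi ^ 4" by simp
    moreover have "pi ^ 4 \<le> 3.15 ^ 4" using pi_approx by (intro power_mono) auto
    then have "1.65 ^ 6 * pi ^ 4 \<le> 2048" by (simp add: power_divide)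
    then have "1.65 ^ 6 \<le> 2048 / pi ^ 4" by (simp add: pos_le_divide_eq)
    ultimately show "1.65 ^ Suc 5 \<le> m ^ Suc 5" by simp
    show "0 \<le> m" by (simp add: m_def)
  qed
  define s where "s = sqrt (1 + a)"
  define y where "y = sqrt (1 / 4 + a)"
  have y0: "0 \<le> y" and y2: "y\<^sup>2 = 1 / 4 + a" using a0 by (auto simp: y_def)
  have s0: "0 \<le> s" and s2: "s\<^sup>2 = 1 + a" using a0 by (auto simp: s_def)
  \<comment> \<open>The number 1.11 exceeds \<open>0.35 * 3.15\<close>, a bound for
    \<open>(2 - 1.65) * l\<close>. Squaring leaves a quadratic inequality in \<open>y\<close> with
    leading coefficient \<open>1.65 ^ 2 - 1 = 1.7225\<close> and negative discriminant, proved by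
    completing the square.\<close>
  have "y + 1.11 \<le> 1.65 * s"
  proof (rule power2_le_imp_le)
    have "0 \<le> (1.7225 * y - 1.11)\<^sup>2" by simp
    then have "0 \<le> 1.7225\<^sup>2 * y\<^sup>2 - 2 * 1.7225 * 1.11 * y + 1.11\<^sup>2"
      by (simp add: power2_eq_square algebra_simps)
    then have "(y + 1.11)\<^sup>2 \<le> 1.65\<^sup>2 * (y\<^sup>2 + 3/4)"
      by (simp add: power2_sum power_divide)
    also have "\<dots> = (1.65 * s)\<^sup>2" by (simp add: power_mult_distrib power_divide s2 y2)
    finally show "(y + 1.11)\<^sup>2 \<le> (1.65 * s)\<^sup>2" .
  qed (use s0 in simp)
  then have "2 * l + y \<le> 1.65 * (l + s)" using l by (simp add: field_simps)
  also have "\<dots> \<le> m * (l + s)" using \<open>1.65 \<le> m\<close> l s0 by (intro mult_right_mono) auto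
  finally have "(2 * l + y) / l \<le> m * (l + s) / l" using l by (intro divide_right_mono) auto
  then have *: "2 + y / l \<le> m * (1 + s / l)" using l by (simp add: add_divide_distrib distrib_left)
  have "2 powr (1 / 3) / sqrt 3 * (2 + y / l) \<le> 2 powr (1 / 3) / sqrt 3 * (m * (1 + s / l))"
    by (intro mult_left_mono *) auto
  also have "\<dots> = 2 * sqrt 2 * (2 powr (1/3) * 2 powr (1/3) / (pi powr (2/3) * sqrt 3)) * (1 + s / l)"
    by (simp add: m_def mult_ac)
  also have "\<dots> = C_S Lx Ly"
    by (simp add: C_S_def C_3_def s_def l_def a_def add.assoc flip: powr_add)
  finally show ?thesis by (simp add: y_def l_def a_def add.assoc)
qed

definition dirichlet_energy :: "real \<Rightarrow> real \<Rightarrow> (real^3 \<Rightarrow> real^3) \<Rightarrow> real" where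
  "dirichlet_energy Lx Ly v = integral (cell Lx Ly) (\<lambda>x. \<Sum>i\<in>UNIV. (norm (pd i v x))\<^sup>2)"

lemma integrable_cell: "continuous_on (cell Lx Ly) f \<Longrightarrow> f integrable_on cell Lx Ly"
  for f :: "real^3 \<Rightarrow> real"
  by (simp add: cell_def integrable_continuous)

lemma C1_slab_continuous_cell:
  assumes "C1_slab f"
  shows "continuous_on (cell Lx Ly) f" "continuous_on (cell Lx Ly) (pd i f)"
  using assms continuous_on_subset[OF _ cell_subset_slab] C1_slab_continuous C1_slab_pd_continuous by blast+

lemma dirichlet_energy_eq:
  assumes v: "C1_slab v"
  shows "dirichlet_energy Lx Ly v = (\<Sum>i\<in>UNIV. integral (cell Lx Ly) (\<lambda>x. (norm (pd i v x))\<^sup>2))"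
  unfolding dirichlet_energy_def
  by (intro Henstock_Kurzweil_Integration.integral_sum integrable_cell continuous_intros C1_slab_continuous_cell v) auto

lemma dirichlet_energy_nonneg:
  assumes v: "C1_slab v"
  shows "0 \<le> dirichlet_energy Lx Ly v"
  unfolding dirichlet_energy_def
  by (intro integral_nonneg integrable_cell continuous_intros C1_slab_continuous_cell v) (auto intro: sum_nonneg)

text \<open>The Gagliardo-Nirenberg bound is a product with one factor per direction. The
  arithmetic-geometric mean inequality makes it the cube of a Euclidean norm, the triangle
  inequality splits this norm into a lower order part and the gradient, and the Poincare inequality
  absorbs the lower order part.\<close>

lemma sobolev_cell:
  assumes L: "Lx > 0" "Ly > 0" and B: "C1_slab B" and per: "periodic_xy Lx Ly B"
    and poincare: "integral (cell Lx Ly) (\<lambda>x. (norm (B x))\<^sup>2) \<le> (C_P Lx Ly)\<^sup>2 * dirichlet_energy Lx Ly B"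
  shows "integral (cell Lx Ly) (\<lambda>x. norm (B x) ^ 6) \<le> (C_S Lx Ly * sqrt (dirichlet_energy Lx Ly B)) ^ 6"
proof -
  define \<beta> where "\<beta> = sqrt (integral (cell Lx Ly) (\<lambda>x. (norm (B x))\<^sup>2))"
  define d where "d i = sqrt (integral (cell Lx Ly) (\<lambda>x. (norm (pd i B x))\<^sup>2))" for i
  define D where "D = sqrt (dirichlet_energy Lx Ly B)"
  \<comment> \<open>The 1/4 is the square of the coefficient of \<open>\<beta>\<close> in
    \<open>c\<close> below.\<close>
  define y where "y = sqrt (1 / 4 + 1 / Lx\<^sup>2 + 1 / Ly\<^sup>2)"
  note cont = continuous_intros C1_slab_continuous_cell B
  have l: "0 < lambda1 Lx Ly" by (rule lambda1_bounds[OF L])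
  have \<beta>0: "0 \<le> \<beta>" unfolding \<beta>_def by (intro real_sqrt_ge_zero integral_nonneg integrable_cell cont) auto
  have d2: "(d i)\<^sup>2 = integral (cell Lx Ly) (\<lambda>x. (norm (pd i B x))\<^sup>2)" for i
    unfolding d_def by (intro real_sqrt_pow2 integral_nonneg integrable_cell cont) auto
  have d0: "0 \<le> d i" for i unfolding d_def by (intro real_sqrt_ge_zero integral_nonneg integrable_cell cont) auto
  have D0: "0 \<le> D" unfolding D_def by (intro real_sqrt_ge_zero dirichlet_energy_nonneg B)
  have Dd: "D = sqrt ((d 1)\<^sup>2 + (d 2)\<^sup>2 + (d 3)\<^sup>2)"
    by (simp add: D_def dirichlet_energy_eq[OF B] sum_3 d2)
  have "\<beta> \<le> sqrt ((C_P Lx Ly)\<^sup>2 * dirichlet_energy Lx Ly B)"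
    unfolding \<beta>_def by (intro real_sqrt_le_mono poincare)
  then have \<beta>: "\<beta> \<le> D / lambda1 Lx Ly"
    using l by (simp add: real_sqrt_mult C_P_def D_def)
  \<comment> \<open>Halving the last factor balances the three factors before the arithmetic-geometric mean inequality.\<close>
  define a b c where "a = \<beta> / Lx + 2 * d 1" and "b = \<beta> / Ly + 2 * d 2" and "c = \<beta> / 2 + 2 * d 3"
  have abc0: "0 \<le> a" "0 \<le> b" "0 \<le> c" using \<beta>0 d0 L by (auto simp: a_def b_def c_def)
  have nv: "norm (vector [p, q, r] :: real^3) = sqrt (p\<^sup>2 + q\<^sup>2 + r\<^sup>2)" for p q r
    by (simp add: norm_eq_sqrt_inner inner_vec_def sum_3 power2_eq_square)
  have "sqrt (a\<^sup>2 + b\<^sup>2 + c\<^sup>2) = norm (\<beta> *\<^sub>R vector [1 / Lx, 1 / Ly, 1 / 2] + 2 *\<^sub>R vector [d 1, d 2, d 3] :: real^3)"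
    unfolding nv[symmetric] a_def b_def c_def by (intro arg_cong[of _ _ norm]) (simp add: vec_eq_iff forall_3)
  also have "\<dots> \<le> \<beta> * y + 2 * D"
    by (rule norm_triangle_le) (simp add: nv \<beta>0 y_def Dd power_divide add_ac)
  also have "\<dots> \<le> (D / lambda1 Lx Ly) * y + 2 * D"
    using \<beta> by (intro add_right_mono mult_right_mono) (auto simp: y_def)
  also have "\<dots> = (2 + y / lambda1 Lx Ly) * D" by (simp add: algebra_simps)
  finally have N: "sqrt (a\<^sup>2 + b\<^sup>2 + c\<^sup>2) \<le> (2 + y / lambda1 Lx Ly) * D" .
  have "sqrt (integral (cell Lx Ly) (\<lambda>x. norm (B x) ^ 6)) \<le> (\<beta> / Lx + 2 * d 1) * (\<beta> / Ly + 2 * d 2) * (\<beta> + 4 * d 3)"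
    unfolding \<beta>_def d_def by (rule gagliardo_nirenberg_cell[OF L B per])
  also have "\<beta> + 4 * d 3 = 2 * c" by (simp add: c_def)
  also have "(\<beta> / Lx + 2 * d 1) * (\<beta> / Ly + 2 * d 2) * (2 * c) = 2 * (a * b * c)" by (simp add: a_def b_def)
  also have "\<dots> \<le> 2 * (sqrt (a\<^sup>2 + b\<^sup>2 + c\<^sup>2) / sqrt 3) ^ 3"
    by (intro mult_left_mono mult3_le_norm_cube abc0) auto
  also have "\<dots> = (2 powr (1 / 3)) ^ 3 * (sqrt (a\<^sup>2 + b\<^sup>2 + c\<^sup>2) / sqrt 3) ^ 3"
    by (simp add: powr_power)
  also have "\<dots> = (2 powr (1 / 3) / sqrt 3 * sqrt (a\<^sup>2 + b\<^sup>2 + c\<^sup>2)) ^ 3"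
    by (simp add: power_mult_distrib power_divide)
  also have "\<dots> \<le> (2 powr (1 / 3) / sqrt 3 * ((2 + y / lambda1 Lx Ly) * D)) ^ 3"
    by (intro power_mono mult_left_mono N) auto
  also have "\<dots> = ((2 powr (1 / 3) / sqrt 3 * (2 + y / lambda1 Lx Ly)) * D) ^ 3" by (simp add: mult.assoc)
  also have "\<dots> \<le> (C_S Lx Ly * D) ^ 3"
    using C_S_ge[OF L] D0 l by (intro power_mono mult_right_mono) (auto simp: y_def)
  finally have "(sqrt (integral (cell Lx Ly) (\<lambda>x. norm (B x) ^ 6)))\<^sup>2 \<le> ((C_S Lx Ly * D) ^ 3)\<^sup>2"
    by (intro power_mono real_sqrt_ge_zero integral_nonneg integrable_cell cont) auto
  moreover have "(sqrt (integral (cell Lx Ly) (\<lambda>x. norm (B x) ^ 6)))\<^sup>2 = integral (cell Lx Ly) (\<lambda>x. norm (B x) ^ 6)"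
    by (intro real_sqrt_pow2 integral_nonneg integrable_cell cont) auto
  ultimately show ?thesis by (simp add: D_def flip: power_mult)
qed

section \<open>The Poincare inequality in the layer\<close>

lemma dirichlet_wirtinger_cell:
  fixes f :: "real^3 \<Rightarrow> real"
  assumes f: "C1_slab f" and zero: "\<And>x. x \<in> S_minus \<union> S_plus \<Longrightarrow> f x = 0"
  shows "integral (cell Lx Ly) (\<lambda>x. (f x)\<^sup>2) \<le> (1 / pi)\<^sup>2 * integral (cell Lx Ly) (\<lambda>x. (pd 3 f x)\<^sup>2)"
proof -
  have c1: "continuous_on (cell Lx Ly) (\<lambda>x. (f x)\<^sup>2)"
    and c2: "continuous_on (cell Lx Ly) (\<lambda>x. (1 / pi)\<^sup>2 * (pd 3 f x)\<^sup>2)"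
    by (intro continuous_intros C1_slab_continuous_cell f)+
  have c3: "continuous_on {0..1} (\<lambda>z. pd 3 f (vector [x, y, z]))" for x y
    by (rule continuous_on_compose2[OF C1_slab_pd_continuous[OF f]]) (auto intro!: continuous_intros simp: slab_def)
  have z: "integral {0..1} (\<lambda>z. (f (vector [x, y, z]))\<^sup>2)
        \<le> integral {0..1} (\<lambda>z. (1 / pi)\<^sup>2 * (pd 3 f (vector [x, y, z]))\<^sup>2)" for x y
  proof -
    have "((\<lambda>z. f (vector [x, y, z])) has_real_derivative pd 3 f (vector [x, y, z])) (at z within {0..1})"
      if "z \<in> {0..1}" for z
      using pd_has_vector_derivative(3)[OF f, of "{0..1}"] that
      by (simp add: has_real_derivative_iff_has_vector_derivative)
    then have "integral {0..1} (\<lambda>z. (f (vector [x, y, z]))\<^sup>2)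
        \<le> ((1 - 0) / pi)\<^sup>2 * integral {0..1} (\<lambda>z. (pd 3 f (vector [x, y, z]))\<^sup>2)"
      using zero by (intro dirichlet_wirtinger c3) (auto simp: S_minus_def S_plus_def)
    then show ?thesis by simp
  qed
  note int = integrable_continuous_real continuous_on_integral_param
    continuous_on_cell_compose[OF c1] continuous_on_cell_compose[OF c2]
  have "integral (cell Lx Ly) (\<lambda>x. (f x)\<^sup>2) \<le> integral (cell Lx Ly) (\<lambda>x. (1 / pi)\<^sup>2 * (pd 3 f x)\<^sup>2)"
    unfolding integral_cell_xyz[OF c1] integral_cell_xyz[OF c2]
  proof (rule integral_le)
    fix x assume "x \<in> {0..Lx}"
    then show "integral {0..Ly} (\<lambda>y. integral {0..1} (\<lambda>z. (f (vector [x, y, z]))\<^sup>2))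
        \<le> integral {0..Ly} (\<lambda>y. integral {0..1} (\<lambda>z. (1 / pi)\<^sup>2 * (pd 3 f (vector [x, y, z]))\<^sup>2))"
      by (intro integral_le z) (intro int; auto intro!: continuous_intros)+
  qed (intro int; auto intro!: continuous_intros)+
  then show ?thesis by simp
qed

text \<open>The inequality in \<open>x\<close> leaves the squared \<open>x\<close>-integral of
  \<open>h\<close>, a periodic function of \<open>y\<close> alone, to which the inequality in
  \<open>y\<close> applies. Cauchy-Schwarz returns its derivative to \<open>hy\<close> with a factor
  \<open>Lx\<close> that cancels the \<open>1 / Lx\<close>, so each direction keeps its own
  constant.\<close>

lemma periodic_wirtinger_2d:
  fixes h hx hy :: "real \<Rightarrow> real \<Rightarrow> real"
  assumes L: "Lx > 0" "Ly > 0"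
    and per: "\<And>x y. h (x + Lx) y = h x y" "\<And>x y. h x (y + Ly) = h x y"
    and dx: "\<And>x y. ((\<lambda>x. h x y) has_real_derivative hx x y) (at x)"
    and dy: "\<And>x y. (h x has_real_derivative hy x y) (at y)"
    and ch: "continuous_on UNIV (\<lambda>p. h (fst p) (snd p))"
    and chx: "continuous_on UNIV (\<lambda>p. hx (fst p) (snd p))"
    and chy: "continuous_on UNIV (\<lambda>p. hy (fst p) (snd p))"
  shows "integral {0..Ly} (\<lambda>y. integral {0..Lx} (\<lambda>x. (h x y)\<^sup>2))
    \<le> (Lx / (2 * pi))\<^sup>2 * integral {0..Ly} (\<lambda>y. integral {0..Lx} (\<lambda>x. (hx x y)\<^sup>2))
      + (Ly / (2 * pi))\<^sup>2 * integral {0..Ly} (\<lambda>y. integral {0..Lx} (\<lambda>x. (hy x y)\<^sup>2))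
      + (integral {0..Ly} (\<lambda>y. integral {0..Lx} (\<lambda>x. h x y)))\<^sup>2 / (Lx * Ly)"
proof -
  have cc: "continuous_on S (\<lambda>p. k (f p) (g p))"
    if "continuous_on UNIV (\<lambda>p. k (fst p) (snd p))" "continuous_on S f" "continuous_on S g"
    for S :: "'s::topological_space set" and k :: "real \<Rightarrow> real \<Rightarrow> real" and f g
    using continuous_on_compose2[OF that(1), of S "\<lambda>p. (f p, g p)"] that(2,3) by (auto intro!: continuous_intros)
  note cont = integrable_continuous_real continuous_on_integral_param continuous_intros cc[OF ch] cc[OF chx] cc[OF chy]
  define F where "F y = integral {0..Lx} (\<lambda>x. h x y)" for y
  define F' where "F' y = integral {0..Lx} (\<lambda>x. hy x y)" for y
  have cF: "continuous_on S F" for S unfolding F_def by (intro cont)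
  have cF': "continuous_on S F'" for S unfolding F'_def by (intro cont)
  have dF: "(F has_real_derivative F' y) (at y)" for y
  proof -
    have "((\<lambda>y. integral (cbox 0 Lx) (\<lambda>x. h x y)) has_real_derivative integral (cbox 0 Lx) (\<lambda>x. hy x y)) (at y within UNIV)"
    proof (rule leibniz_rule_field_derivative)
      show "continuous_on (UNIV \<times> cbox 0 Lx) (\<lambda>(y, x). hy x y)"
        unfolding split_beta by (intro cont)
    qed (auto intro!: cont dy)
    then show ?thesis by (simp add: F_def[abs_def] F'_def)
  qed
  have "integral {0..Ly} (\<lambda>y. integral {0..Lx} (\<lambda>x. (h x y)\<^sup>2))
    \<le> integral {0..Ly} (\<lambda>y. (Lx / (2 * pi))\<^sup>2 * integral {0..Lx} (\<lambda>x. (hx x y)\<^sup>2) + (F y)\<^sup>2 / Lx)"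
    unfolding F_def using L
    by (intro integral_le cont periodic_wirtinger) (auto intro!: dx per cont)
  also have "\<dots> = (Lx / (2 * pi))\<^sup>2 * integral {0..Ly} (\<lambda>y. integral {0..Lx} (\<lambda>x. (hx x y)\<^sup>2))
      + integral {0..Ly} (\<lambda>y. (F y)\<^sup>2) / Lx"
    using L by (subst Henstock_Kurzweil_Integration.integral_add) (auto intro!: cont cF)
  also have "integral {0..Ly} (\<lambda>y. (F y)\<^sup>2) \<le> (Ly / (2 * pi))\<^sup>2 * integral {0..Ly} (\<lambda>y. (F' y)\<^sup>2)
      + (integral {0..Ly} F)\<^sup>2 / Ly"
    using L by (intro periodic_wirtinger dF cF') (simp_all add: F_def per)
  also have "integral {0..Ly} (\<lambda>y. (F' y)\<^sup>2) \<le> integral {0..Ly} (\<lambda>y. Lx * integral {0..Lx} (\<lambda>x. (hy x y)\<^sup>2))"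
  proof (intro integral_le cont cF')
    fix y
    have "\<bar>F' y\<bar>\<^sup>2 \<le> (sqrt (Lx * integral {0..Lx} (\<lambda>x. (hy x y)\<^sup>2)))\<^sup>2"
    proof (rule power_mono)
      have 1: "integral {0..Lx} (\<lambda>x. 1 * hy x y) \<le> sqrt (integral {0..Lx} (\<lambda>x. 1\<^sup>2)) * sqrt (integral {0..Lx} (\<lambda>x. (hy x y)\<^sup>2))"
        by (intro integral_Cauchy_Schwarz cont)
      \<comment> \<open>The instance with \<open>-1\<close> gives the other sign of the absolute
        value.\<close>
      have 2: "integral {0..Lx} (\<lambda>x. (-1) * hy x y) \<le> sqrt (integral {0..Lx} (\<lambda>x. (-1)\<^sup>2)) * sqrt (integral {0..Lx} (\<lambda>x. (hy x y)\<^sup>2))"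
        by (intro integral_Cauchy_Schwarz cont)
      show "\<bar>F' y\<bar> \<le> sqrt (Lx * integral {0..Lx} (\<lambda>x. (hy x y)\<^sup>2))"
        using 1 2 L by (simp add: F'_def real_sqrt_mult abs_le_iff)
    qed simp
    moreover have "0 \<le> integral {0..Lx} (\<lambda>x. (hy x y)\<^sup>2)" by (intro integral_nonneg cont) auto
    ultimately show "(F' y)\<^sup>2 \<le> Lx * integral {0..Lx} (\<lambda>x. (hy x y)\<^sup>2)" using L by simp
  qed
  also have "\<dots> = Lx * integral {0..Ly} (\<lambda>y. integral {0..Lx} (\<lambda>x. (hy x y)\<^sup>2))" by simp
  finally show ?thesis using L by (simp add: add_divide_distrib divide_right_mono mult_left_mono F_def[abs_def] mult_ac)
qed

lemma continuous_on_slab_vector: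
  assumes "continuous_on slab F" "continuous_on S f" "continuous_on S g" "continuous_on S h"
    and "\<And>p. p \<in> S \<Longrightarrow> h p \<in> {0..1}"
  shows "continuous_on S (\<lambda>p. F (vector [f p, g p, h p]))"
  by (rule continuous_on_compose2[OF assms(1)]) (use assms in \<open>auto intro!: continuous_intros simp: slab_def\<close>)

lemma integral_rectangle:
  fixes f :: "real \<Rightarrow> real \<Rightarrow> real"
  assumes f: "continuous_on ({0..Lx} \<times> {0..Ly}) (\<lambda>p. f (fst p) (snd p))"
  shows "integral (cbox (0, 0) (Lx, Ly)) (\<lambda>p. f (fst p) (snd p)) = integral {0..Lx} (\<lambda>x. integral {0..Ly} (\<lambda>y. f x y))"
    and "integral (cbox (0, 0) (Lx, Ly)) (\<lambda>p. f (fst p) (snd p)) = integral {0..Ly} (\<lambda>y. integral {0..Lx} (\<lambda>x. f x y))"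
proof -
  show "integral (cbox (0, 0) (Lx, Ly)) (\<lambda>p. f (fst p) (snd p)) = integral {0..Lx} (\<lambda>x. integral {0..Ly} (\<lambda>y. f x y))"
    by (subst integral_prod_continuous) (use f in \<open>auto simp: cbox_Pair_eq\<close>)
  then show "integral (cbox (0, 0) (Lx, Ly)) (\<lambda>p. f (fst p) (snd p)) = integral {0..Ly} (\<lambda>y. integral {0..Lx} (\<lambda>x. f x y))"
    using integral_swap_real[OF f] by simp
qed

text \<open>The bound is obtained on each horizontal plane without a vertical derivative, so the
  mean has to vanish at every height and not merely over the cell.\<close>

lemma horizontal_wirtinger_cell:
  fixes f :: "real^3 \<Rightarrow> real"
  assumes L: "Lx > 0" "Ly > 0" and f: "C1_slab f" and per: "periodic_xy Lx Ly f"
    and mean: "\<And>z. z \<in> {0..1} \<Longrightarrow> integral {0..Ly} (\<lambda>y. integral {0..Lx} (\<lambda>x. f (vector [x, y, z]))) = 0"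
  shows "integral (cell Lx Ly) (\<lambda>x. (f x)\<^sup>2) \<le> (Lx / (2 * pi))\<^sup>2 * integral (cell Lx Ly) (\<lambda>x. (pd 1 f x)\<^sup>2)
    + (Ly / (2 * pi))\<^sup>2 * integral (cell Lx Ly) (\<lambda>x. (pd 2 f x)\<^sup>2)"
proof -
  have c0: "continuous_on (cell Lx Ly) (\<lambda>x. (f x)\<^sup>2)"
    and c: "continuous_on (cell Lx Ly) (\<lambda>x. (pd i f x)\<^sup>2)" for i
    by (intro continuous_intros C1_slab_continuous_cell f)+
  note cs = continuous_on_slab_vector[OF C1_slab_continuous[OF f]] continuous_on_slab_vector[OF C1_slab_pd_continuous[OF f]]
  note int = integrable_continuous_real continuous_on_integral_param
    continuous_on_cell_compose[OF c0] continuous_on_cell_compose[OF c]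
  have "integral (cell Lx Ly) (\<lambda>x. (f x)\<^sup>2) \<le> integral {0..1} (\<lambda>z.
      (Lx / (2 * pi))\<^sup>2 * integral {0..Ly} (\<lambda>y. integral {0..Lx} (\<lambda>x. (pd 1 f (vector [x, y, z]))\<^sup>2))
      + (Ly / (2 * pi))\<^sup>2 * integral {0..Ly} (\<lambda>y. integral {0..Lx} (\<lambda>x. (pd 2 f (vector [x, y, z]))\<^sup>2)))"
    unfolding integral_cell_zyx[OF c0]
  proof (rule integral_le)
    fix z :: real assume z: "z \<in> {0..1}"
    have "integral {0..Ly} (\<lambda>y. integral {0..Lx} (\<lambda>x. (f (vector [x, y, z]))\<^sup>2))
      \<le> (Lx / (2 * pi))\<^sup>2 * integral {0..Ly} (\<lambda>y. integral {0..Lx} (\<lambda>x. (pd 1 f (vector [x, y, z]))\<^sup>2))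
      + (Ly / (2 * pi))\<^sup>2 * integral {0..Ly} (\<lambda>y. integral {0..Lx} (\<lambda>x. (pd 2 f (vector [x, y, z]))\<^sup>2))
      + (integral {0..Ly} (\<lambda>y. integral {0..Lx} (\<lambda>x. f (vector [x, y, z]))))\<^sup>2 / (Lx * Ly)"
    proof (rule periodic_wirtinger_2d[OF L])
      show "f (vector [x + Lx, y, z]) = f (vector [x, y, z])" "f (vector [x, y + Ly, z]) = f (vector [x, y, z])" for x y
        using periodic_xy_vector[OF per z] by auto
      show "((\<lambda>x. f (vector [x, y, z])) has_real_derivative pd 1 f (vector [x, y, z])) (at x)"
        "((\<lambda>y. f (vector [x, y, z])) has_real_derivative pd 2 f (vector [x, y, z])) (at y)" for x y
        using pd_has_vector_derivative(1,2)[OF f z, where T = UNIV]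
        by (simp_all add: has_real_derivative_iff_has_vector_derivative)
    qed (intro cs continuous_intros z)+
    then show "integral {0..Ly} (\<lambda>y. integral {0..Lx} (\<lambda>x. (f (vector [x, y, z]))\<^sup>2))
      \<le> (Lx / (2 * pi))\<^sup>2 * integral {0..Ly} (\<lambda>y. integral {0..Lx} (\<lambda>x. (pd 1 f (vector [x, y, z]))\<^sup>2))
      + (Ly / (2 * pi))\<^sup>2 * integral {0..Ly} (\<lambda>y. integral {0..Lx} (\<lambda>x. (pd 2 f (vector [x, y, z]))\<^sup>2))"
      by (simp add: mean[OF z])
  qed (intro int continuous_on_add continuous_on_mult_left; auto intro!: continuous_intros)+
  also have "\<dots> = (Lx / (2 * pi))\<^sup>2 * integral (cell Lx Ly) (\<lambda>x. (pd 1 f x)\<^sup>2)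
    + (Ly / (2 * pi))\<^sup>2 * integral (cell Lx Ly) (\<lambda>x. (pd 2 f x)\<^sup>2)"
    unfolding integral_cell_zyx[OF c]
    by (subst Henstock_Kurzweil_Integration.integral_add)
      (simp_all, (intro int continuous_on_mult_left integrable_on_mult_right; auto intro!: continuous_intros)+)
  finally show ?thesis .
qed

text \<open>The horizontal mean of the vertical component does not depend on the height, so that the flux
  through the bottom determines it.\<close>

lemma solenoidal_horizontal_mean_zero:
  assumes L: "Lx > 0" "Ly > 0" and B: "C1_slab B" and per: "periodic_xy Lx Ly B"
    and div: "\<And>x. x \<in> slab \<Longrightarrow> divg B x = 0"
    and flux: "integral (cbox (0, 0) (Lx, Ly)) (\<lambda>p. B (vector [fst p, snd p, 0]) $ 3) = 0"
    and z: "z \<in> {0..1}"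
  shows "integral {0..Ly} (\<lambda>y. integral {0..Lx} (\<lambda>x. B (vector [x, y, z]) $ 3)) = 0"
proof -
  let ?R = "cbox (0, 0) (Lx, Ly) :: (real \<times> real) set"
  note Bj = C1_slab_nth(1)[OF B]
  note cs = continuous_on_slab_vector[OF C1_slab_continuous[OF Bj]] continuous_on_slab_vector[OF C1_slab_pd_continuous[OF Bj]]
  define m where "m z = integral ?R (\<lambda>p. B (vector [fst p, snd p, z]) $ 3)" for z
  have per': "periodic_xy Lx Ly (\<lambda>x. B x $ j)" for j
    using per by (simp add: periodic_xy_def)
  \<comment> \<open>Solenoidality trades the vertical derivative for horizontal ones, whose
    integrals vanish by periodicity.\<close>
  have pdm: "integral ?R (\<lambda>p. pd 3 (\<lambda>x. B x $ 3) (vector [fst p, snd p, z])) = 0" if z: "z \<in> {0..1}" for z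
  proof -
    have i1: "integral {0..Lx} (\<lambda>x. pd 1 (\<lambda>x. B x $ 1) (vector [x, y, z])) = 0" for y
    proof -
      have "((\<lambda>x. pd 1 (\<lambda>x. B x $ 1) (vector [x, y, z])) has_integral B (vector [Lx, y, z]) $ 1 - B (vector [0, y, z]) $ 1) {0..Lx}"
        using L by (intro fundamental_theorem_of_calculus pd_has_vector_derivative(1)[OF Bj z]) auto
      then show ?thesis using periodic_xy_vector(1)[OF per z, of 0 y] by (simp add: integral_unique)
    qed
    have i2: "integral {0..Ly} (\<lambda>y. pd 2 (\<lambda>x. B x $ 2) (vector [x, y, z])) = 0" for x
    proof -
      have "((\<lambda>y. pd 2 (\<lambda>x. B x $ 2) (vector [x, y, z])) has_integral B (vector [x, Ly, z]) $ 2 - B (vector [x, 0, z]) $ 2) {0..Ly}"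
        using L by (intro fundamental_theorem_of_calculus pd_has_vector_derivative(2)[OF Bj z]) auto
      then show ?thesis using periodic_xy_vector(2)[OF per z, of x 0] by (simp add: integral_unique)
    qed
    have "integral ?R (\<lambda>p. pd 1 (\<lambda>x. B x $ 1) (vector [fst p, snd p, z])) = 0"
      by (subst integral_rectangle(2)) (auto simp: i1 intro!: cs continuous_intros z[simplified])
    moreover have "integral ?R (\<lambda>p. pd 2 (\<lambda>x. B x $ 2) (vector [fst p, snd p, z])) = 0"
      by (subst integral_rectangle(1)) (auto simp: i2 intro!: cs continuous_intros z[simplified])
    moreover have "integral ?R (\<lambda>p. pd 3 (\<lambda>x. B x $ 3) (vector [fst p, snd p, z])) =
        integral ?R (\<lambda>p. - pd 1 (\<lambda>x. B x $ 1) (vector [fst p, snd p, z]) - pd 2 (\<lambda>x. B x $ 2) (vector [fst p, snd p, z]))"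
    proof (intro Henstock_Kurzweil_Integration.integral_cong)
      fix p :: "real \<times> real"
      have "vector [fst p, snd p, z] \<in> slab" using z by (simp add: slab_def)
      from div[OF this] show "pd 3 (\<lambda>x. B x $ 3) (vector [fst p, snd p, z]) =
          - pd 1 (\<lambda>x. B x $ 1) (vector [fst p, snd p, z]) - pd 2 (\<lambda>x. B x $ 2) (vector [fst p, snd p, z])"
        using \<open>vector [fst p, snd p, z] \<in> slab\<close> by (simp add: divg_def sum_3 C1_slab_nth(2)[OF B])
    qed
    moreover have "(\<lambda>p. pd i (\<lambda>x. B x $ j) (vector [fst p, snd p, z])) integrable_on ?R" for i j
      by (intro integrable_continuous cs continuous_intros z)
    ultimately show ?thesis
      by (simp add: Henstock_Kurzweil_Integration.integral_diff integrable_neg)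
  qed
  have "(m has_real_derivative 0) (at z within {0..1})" if z: "z \<in> {0..1}" for z
  proof -
    have "(m has_real_derivative integral ?R (\<lambda>p. pd 3 (\<lambda>x. B x $ 3) (vector [fst p, snd p, z]))) (at z within {0..1})"
      unfolding m_def
    proof (rule leibniz_rule_field_derivative[OF _ _ _ z])
      show "((\<lambda>z. B (vector [fst p, snd p, z]) $ 3) has_real_derivative pd 3 (\<lambda>x. B x $ 3) (vector [fst p, snd p, z])) (at z within {0..1})"
        if "z \<in> {0..1}" for z and p :: "real \<times> real"
        using pd_has_vector_derivative(3)[OF Bj[of 3], of "{0..1}"] that
        by (simp add: has_real_derivative_iff_has_vector_derivative)
      show "(\<lambda>p. B (vector [fst p, snd p, z]) $ 3) integrable_on ?R" if "z \<in> {0..1}" for z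
        using that by (intro integrable_continuous cs continuous_intros)
      show "continuous_on ({0..1} \<times> ?R) (\<lambda>(z, p). pd 3 (\<lambda>x. B x $ 3) (vector [fst p, snd p, z]))"
        unfolding split_beta by (intro cs continuous_intros) auto
    qed simp
    then show ?thesis by (simp add: pdm[OF z])
  qed
  then obtain k where "\<And>z. z \<in> {0..1} \<Longrightarrow> m z = k"
    using has_field_derivative_zero_constant[of "{0..1}" m] by auto
  then have "m z = m 0" using z by auto
  also have "m 0 = 0" using flux by (simp add: m_def)
  finally show ?thesis
    unfolding m_def by (subst (asm) integral_rectangle(2)) (use z in \<open>auto intro!: continuous_on_slab_vector[OF C1_slab_continuous[OF B]] continuous_intros\<close>)
qed

text \<open>The components are treated separately. The horizontal ones vanish on the walls and cost
  \<open>1 / pi\<close>; the vertical one has mean zero on each plane and costs the larger of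
  \<open>Lx / (2 * pi)\<close> and \<open>Ly / (2 * pi)\<close>. The maximum of the three constants
  is \<open>C_P\<close>.\<close>

lemma poincare_cell:
  assumes L: "Lx > 0" "Ly > 0" and B: "C1_slab B" and per: "periodic_xy Lx Ly B"
    and div: "\<And>x. x \<in> slab \<Longrightarrow> divg B x = 0"
    and flux: "integral (cbox (0, 0) (Lx, Ly)) (\<lambda>p. B (vector [fst p, snd p, 0]) $ 3) = 0"
    and bc: "\<And>x. x \<in> S_minus \<union> S_plus \<Longrightarrow> B x $ 1 = 0 \<and> B x $ 2 = 0"
  shows "integral (cell Lx Ly) (\<lambda>x. (norm (B x))\<^sup>2) \<le> (C_P Lx Ly)\<^sup>2 * dirichlet_energy Lx Ly B"
proof -
  let ?V = "cell Lx Ly"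
  note Bj = C1_slab_nth(1)[OF B]
  have cont: "continuous_on ?V (\<lambda>x. B x $ j)" "continuous_on ?V (\<lambda>x. pd i B x $ j)" for i j
    by (intro continuous_intros C1_slab_continuous_cell B)+
  define q where "q i j = integral ?V (\<lambda>x. (pd i B x $ j)\<^sup>2)" for i j
  have q0: "0 \<le> q i j" for i j
    unfolding q_def by (intro integral_nonneg integrable_cell continuous_intros cont) auto
  have qpd: "integral ?V (\<lambda>x. (pd i (\<lambda>x. B x $ j) x)\<^sup>2) = q i j" for i j
    unfolding q_def
  proof (intro Henstock_Kurzweil_Integration.integral_cong)
    fix x assume "x \<in> ?V"
    then have "x \<in> slab" using cell_subset_slab by blast
    then show "(pd i (\<lambda>x. B x $ j) x)\<^sup>2 = (pd i B x $ j)\<^sup>2" by (simp add: C1_slab_nth(2)[OF B])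
  qed
  have n2: "(norm v)\<^sup>2 = (\<Sum>j\<in>UNIV. (v $ j)\<^sup>2)" for v :: "real^3"
    unfolding power2_norm_eq_inner by (simp add: inner_vec_def power2_eq_square)
  have E: "dirichlet_energy Lx Ly B = (\<Sum>i\<in>UNIV. \<Sum>j\<in>UNIV. q i j)"
    unfolding dirichlet_energy_eq[OF B] n2 q_def
    by (intro sum.cong refl Henstock_Kurzweil_Integration.integral_sum integrable_cell continuous_intros cont) auto
  have N: "integral ?V (\<lambda>x. (norm (B x))\<^sup>2) = (\<Sum>j\<in>UNIV. integral ?V (\<lambda>x. (B x $ j)\<^sup>2))"
    unfolding n2
    by (intro Henstock_Kurzweil_Integration.integral_sum integrable_cell continuous_intros cont) auto
  have l: "0 < lambda1 Lx Ly" "1 / pi \<le> C_P Lx Ly" "Lx / (2 * pi) \<le> C_P Lx Ly" "Ly / (2 * pi) \<le> C_P Lx Ly"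
    using lambda1_bounds[OF L] L by (simp_all add: C_P_def field_simps)
  have vert: "integral ?V (\<lambda>x. (B x $ j)\<^sup>2) \<le> (C_P Lx Ly)\<^sup>2 * (\<Sum>i\<in>UNIV. q i j)" if "j \<in> {1, 2}" for j
  proof -
    have "integral ?V (\<lambda>x. (B x $ j)\<^sup>2) \<le> (1 / pi)\<^sup>2 * integral ?V (\<lambda>x. (pd 3 (\<lambda>x. B x $ j) x)\<^sup>2)"
      by (rule dirichlet_wirtinger_cell[OF Bj]) (use bc that in auto)
    also have "\<dots> = (1 / pi)\<^sup>2 * q 3 j" by (simp add: qpd)
    also have "\<dots> \<le> (C_P Lx Ly)\<^sup>2 * (\<Sum>i\<in>UNIV. q i j)"
      using l(2) q0 by (intro mult_mono power_mono) (auto simp: sum_3)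
    finally show ?thesis .
  qed
  have "integral ?V (\<lambda>x. (B x $ 3)\<^sup>2) \<le> (Lx / (2 * pi))\<^sup>2 * integral ?V (\<lambda>x. (pd 1 (\<lambda>x. B x $ 3) x)\<^sup>2)
      + (Ly / (2 * pi))\<^sup>2 * integral ?V (\<lambda>x. (pd 2 (\<lambda>x. B x $ 3) x)\<^sup>2)"
    using per by (intro horizontal_wirtinger_cell[OF L Bj] solenoidal_horizontal_mean_zero[OF L B per div flux])
      (simp_all add: periodic_xy_def)
  also have "\<dots> = (Lx / (2 * pi))\<^sup>2 * q 1 3 + (Ly / (2 * pi))\<^sup>2 * q 2 3" by (simp add: qpd)
  also have "\<dots> \<le> (C_P Lx Ly)\<^sup>2 * q 1 3 + (C_P Lx Ly)\<^sup>2 * q 2 3"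
    using l q0 L by (intro add_mono mult_right_mono power_mono) auto
  also have "\<dots> \<le> (C_P Lx Ly)\<^sup>2 * (\<Sum>i\<in>UNIV. q i 3)"
    using q0 by (simp add: sum_3 distrib_left)
  finally have "integral ?V (\<lambda>x. (B x $ 3)\<^sup>2) \<le> (C_P Lx Ly)\<^sup>2 * (\<Sum>i\<in>UNIV. q i 3)" .
  with vert[of 1] vert[of 2] have "integral ?V (\<lambda>x. (norm (B x))\<^sup>2) \<le> (C_P Lx Ly)\<^sup>2 * (\<Sum>j\<in>UNIV. \<Sum>i\<in>UNIV. q i j)"
    unfolding N by (simp add: sum_3 distrib_left)
  also have "(\<Sum>j\<in>UNIV. \<Sum>i\<in>UNIV. q i j) = dirichlet_energy Lx Ly B"
    unfolding E by (rule sum.swap)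
  finally show ?thesis .
qed

section \<open>Smooth fields and integration by parts\<close>

text \<open>The class iterates \<open>frechet_derivative\<close>, so a derivative known by a formula
  on \<open>S\<close> must be exchangeable for that formula.\<close>

lemma C_k_on_cong:
  assumes "\<And>x. x \<in> S \<Longrightarrow> f x = g x" "C_k_on k S f"
  shows "C_k_on k S g"
  using assms
proof (induction k arbitrary: f g)
  case 0
  then show ?case by (metis C_k_on.simps(1) continuous_on_cong)
next
  case (Suc k)
  have D: "(f has_derivative D) (at x within S) \<longleftrightarrow> (g has_derivative D) (at x within S)" if "x \<in> S" for D x
    using Suc.prems(1) that by (metis has_derivative_transform)
  have "frechet_derivative f (at x within S) = frechet_derivative g (at x within S)" if "x \<in> S" for x
    using D[OF that] by (simp add: frechet_derivative_def)
  moreover have "g differentiable_on S"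
    using Suc.prems(2) D by (auto simp: differentiable_on_def differentiable_def)
  moreover have "C_k_on k S (\<lambda>x. frechet_derivative g (at x within S) b)" if "b \<in> Basis" for b
    by (rule Suc.IH[of "\<lambda>x. frechet_derivative f (at x within S) b"]) (use that calculation Suc.prems(2) in auto)
  ultimately show ?case by simp
qed

lemma has_derivative_space_slice:
  fixes F :: "real \<times> (real^3) \<Rightarrow> 'b::real_normed_vector"
  assumes "t \<in> I" "F differentiable_on (I \<times> slab)" "x \<in> slab"
  shows "((\<lambda>x. F (t, x)) has_derivative (\<lambda>h. frechet_derivative F (at (t, x) within I \<times> slab) (0, h))) (at x within slab)"
proof -
  have "(F has_derivative frechet_derivative F (at (t, x) within I \<times> slab)) (at (t, x) within I \<times> slab)"
    using assms by (auto simp: differentiable_on_def frechet_derivative_works)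
  then have "(F has_derivative frechet_derivative F (at (t, x) within I \<times> slab)) (at (t, x) within (\<lambda>x. (t, x)) ` slab)"
    by (rule has_derivative_subset) (use assms in auto)
  moreover have "((\<lambda>x. (t, x)) has_derivative (\<lambda>h. (0, h))) (at x within slab)"
    by (auto intro!: derivative_eq_intros)
  ultimately show ?thesis
    using has_derivative_in_compose[of "\<lambda>x. (t, x)" "\<lambda>h. (0, h)" x slab F] by blast
qed

lemma has_vector_derivative_time_slice:
  fixes F :: "real \<times> (real^3) \<Rightarrow> 'b::real_normed_vector"
  assumes "t \<in> I" "F differentiable_on (I \<times> slab)" "x \<in> slab"
  shows "((\<lambda>s. F (s, x)) has_vector_derivative frechet_derivative F (at (t, x) within I \<times> slab) (1, 0)) (at t within I)"
proof -
  have "(F has_derivative frechet_derivative F (at (t, x) within I \<times> slab)) (at (t, x) within I \<times> slab)"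
    using assms by (auto simp: differentiable_on_def frechet_derivative_works)
  then have "(F has_derivative frechet_derivative F (at (t, x) within I \<times> slab)) (at (t, x) within (\<lambda>s. (s, x)) ` I)"
    by (rule has_derivative_subset) (use assms in auto)
  moreover have "((\<lambda>s. (s, x)) has_vector_derivative (1, 0)) (at t within I)"
    unfolding has_vector_derivative_def by (auto intro!: derivative_eq_intros)
  ultimately show ?thesis
    using vector_derivative_diff_chain_within[of "\<lambda>s. (s, x)" "(1, 0)" t I F] by (simp add: o_def)
qed

text \<open>The derivative of the slice in direction \<open>b\<close> is the joint derivative in
  direction \<open>(0, b)\<close>; uniqueness of derivatives within the slab identifies the two at
  every order.\<close>

lemma C_k_on_space_slice:
  fixes F :: "real \<times> (real^3) \<Rightarrow> 'b::real_normed_vector"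
  assumes "t \<in> I" "C_k_on k (I \<times> slab) F"
  shows "C_k_on k slab (\<lambda>x. F (t, x))"
  using assms(2)
proof (induction k arbitrary: F)
  case 0
  have "continuous_on (I \<times> slab) F" using 0 by simp
  then have "continuous_on slab (\<lambda>x. F (t, x))"
    by (rule continuous_on_compose2) (use assms(1) in \<open>auto intro!: continuous_intros\<close>)
  then show ?case by simp
next
  case (Suc k)
  have diff: "F differentiable_on (I \<times> slab)" using Suc.prems by simp
  note hd = has_derivative_space_slice[OF assms(1) diff]
  have "C_k_on k slab (\<lambda>x. frechet_derivative (\<lambda>x. F (t, x)) (at x within slab) b)" if "b \<in> Basis" for b
  proof (rule C_k_on_cong)
    have "(0, b) \<in> Basis" using that by (simp add: Basis_prod_def)
    with Suc.prems have "C_k_on k (I \<times> slab) (\<lambda>p. frechet_derivative F (at p within I \<times> slab) (0, b))" by auto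
    then show "C_k_on k slab (\<lambda>x. frechet_derivative F (at (t, x) within I \<times> slab) (0, b))" by (rule Suc.IH)
    show "frechet_derivative F (at (t, x) within I \<times> slab) (0, b) = frechet_derivative (\<lambda>x. F (t, x)) (at x within slab) b"
      if "x \<in> slab" for x
      using frechet_derivative_slab[OF hd[OF that] that] by simp
  qed
  moreover have "(\<lambda>x. F (t, x)) differentiable_on slab"
    using hd by (auto simp: differentiable_on_def differentiable_def)
  ultimately show ?case by simp
qed

text \<open>Spatial smoothness is spent here: two orders, as the Laplacian demands.\<close>

lemma C_k_on_imp_C1_slab:
  assumes "C_k_on (Suc (Suc k)) slab f"
  shows "C1_slab f" "C1_slab (pd i f)"
proof -
  have *: "C_k_on (Suc k) slab (pd i f)" for i
    using assms by (simp add: pd_def[abs_def])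
  have **: "C1_slab g" if "g differentiable_on slab" "\<And>i. C_k_on n slab (pd i g)" for n and g :: "real^3 \<Rightarrow> 'a"
    using that by (cases n) (auto simp: C1_slab_def differentiable_imp_continuous_on)
  show "C1_slab f" using ** assms * by (metis C_k_on.simps(2))
  have "C_k_on k slab (pd j (pd i f))" for j
    using *[of i] by (simp add: pd_def[abs_def])
  then show "C1_slab (pd i f)" using ** *[of i] by (metis C_k_on.simps(2))
qed

lemma smooth_on_slab_C1: "smooth_on slab f \<Longrightarrow> C1_slab f" "smooth_on slab f \<Longrightarrow> C1_slab (pd i f)"
  using C_k_on_imp_C1_slab[of 0 f] by (simp_all add: smooth_on_def)

lemma smooth_periodic_evolution_slice:
  assumes "smooth_periodic_evolution Lx Ly I f" "t \<in> I"
  shows "smooth_on slab (f t)" "periodic_xy Lx Ly (f t)"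
  using assms C_k_on_space_slice[of t I _ "\<lambda>(t, x). f t x"]
  by (auto simp: smooth_periodic_evolution_def smooth_on_def)

section \<open>Periodicity and boundary values of derivatives\<close>

lemma slab_shift: "x \<in> slab \<Longrightarrow> x + axis 1 a \<in> slab" "x \<in> slab \<Longrightarrow> x + axis 2 a \<in> slab"
  by (simp_all add: slab_def axis_def)

lemma periodic_xy_pd:
  assumes f: "C1_slab f" and per: "periodic_xy Lx Ly f"
  shows "periodic_xy Lx Ly (pd i f)"
proof -
  have "pd i f (x + a) = pd i f x"
    if a: "\<And>x. x \<in> slab \<Longrightarrow> x + a \<in> slab" "\<And>x. x \<in> slab \<Longrightarrow> f (x + a) = f x" and x: "x \<in> slab" for a x
  proof -
    have "((\<lambda>x. x + a) has_derivative (\<lambda>h. h)) (at x within slab)"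
      by (auto intro!: derivative_eq_intros)
    moreover have "(f has_derivative frechet_derivative f (at (x + a) within slab)) (at (x + a) within (\<lambda>x. x + a) ` slab)"
      by (rule has_derivative_subset[OF C1_slab_has_derivative[OF f]]) (use a x in auto)
    ultimately have "((\<lambda>x. f (x + a)) has_derivative frechet_derivative f (at (x + a) within slab)) (at x within slab)"
      by (rule has_derivative_in_compose)
    then have "(f has_derivative frechet_derivative f (at (x + a) within slab)) (at x within slab)"
      by (rule has_derivative_transform[OF x, rotated]) (simp add: a(2))
    from pd_eqI[OF this x] show ?thesis by (simp add: pd_def)
  qed
  then show ?thesis using per slab_shift unfolding periodic_xy_def by blast
qed

text \<open>Horizontal lines through a wall point stay in the wall, where \<open>f\<close> is zero.
  This is how boundary conditions on a field pass to its derivatives.\<close>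

lemma pd_tangential_eq_0:
  fixes f :: "real^3 \<Rightarrow> real"
  assumes f: "C1_slab f" and zero: "\<And>x. x \<in> S_minus \<union> S_plus \<Longrightarrow> f x = 0"
    and x: "x \<in> S_minus \<union> S_plus"
  shows "pd 1 f x = 0" "pd 2 f x = 0"
proof -
  obtain z where z: "x = vector [x $ 1, x $ 2, z]" "z \<in> {0, 1}"
    using x by (intro that[of "x $ 3"]) (auto simp: S_minus_def S_plus_def vec_eq_iff forall_3)
  have 0: "f (vector [a, b, z]) = 0" for a b
    using z(2) by (intro zero) (auto simp: S_minus_def S_plus_def)
  have z': "z \<in> {0..1}" using z(2) by auto
  have "((\<lambda>s. 0) has_vector_derivative pd 1 f (vector [x $ 1, x $ 2, z])) (at (x $ 1))"
    using pd_has_vector_derivative(1)[OF f z', where T = UNIV] by (simp add: 0)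
  then show "pd 1 f x = 0" using vector_derivative_unique_at[OF _ has_vector_derivative_const] z(1) by metis
  have "((\<lambda>s. 0) has_vector_derivative pd 2 f (vector [x $ 1, x $ 2, z])) (at (x $ 2))"
    using pd_has_vector_derivative(2)[OF f z', where T = UNIV] by (simp add: 0)
  then show "pd 2 f x = 0" using vector_derivative_unique_at[OF _ has_vector_derivative_const] z(1) by metis
qed

text \<open>For solenoidal \<open>w\<close> the integrand is the divergence of the product of
  \<open>q\<close> and \<open>w\<close>. Hence pressures, mechanical or magnetic, do no
  work.\<close>

lemma integral_inner_grad_eq_0:
  assumes L: "Lx > 0" "Ly > 0" and q: "C1_slab q" "periodic_xy Lx Ly q" and w: "C1_slab w" "periodic_xy Lx Ly w"
    and div: "\<And>x. x \<in> slab \<Longrightarrow> divg w x = 0" and bc: "\<And>x. x \<in> S_minus \<union> S_plus \<Longrightarrow> w x $ 3 = 0"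
  shows "integral (cell Lx Ly) (\<lambda>x. w x \<bullet> grad q x) = 0"
proof -
  note v = bounded_bilinear_C1_slab[OF bounded_bilinear_scaleR q(1) w(1)]
  have "integral (cell Lx Ly) (divg (\<lambda>x. q x *\<^sub>R w x)) = 0"
    using q(2) w(2) by (intro integral_divg_eq_0 v(1) L) (auto simp: periodic_xy_def bc)
  moreover have "divg (\<lambda>x. q x *\<^sub>R w x) x = w x \<bullet> grad q x" if "x \<in> cell Lx Ly" for x
  proof -
    have x: "x \<in> slab" using that cell_subset_slab by blast
    have "divg (\<lambda>x. q x *\<^sub>R w x) x = q x * divg w x + w x \<bullet> grad q x"
      by (simp add: divg_def v(2)[OF x] grad_def inner_vec_def sum_3 algebra_simps)
    then show ?thesis by (simp add: div[OF x])
  qed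
  ultimately show ?thesis
    by (metis (no_types, lifting) Henstock_Kurzweil_Integration.integral_cong)
qed

lemma continuous_on_curl_cell: "C1_slab v \<Longrightarrow> continuous_on (cell Lx Ly) (curl v)"
  unfolding curl_def[abs_def] by (intro continuous_intros C1_slab_continuous_cell)

lemma continuous_on_lap_cell:
  "(\<And>i. C1_slab (pd i f)) \<Longrightarrow> continuous_on (cell Lx Ly) (lap f)"
  unfolding lap_def[abs_def] by (intro continuous_intros C1_slab_continuous_cell)

text \<open>The boundary hypothesis is weak enough for both uses. For the velocity difference the
  vertical component and the vertical derivatives of the horizontal ones vanish on the walls; for
  \<open>B\<close> the roles are exchanged.\<close>

lemma integral_inner_lap:
  fixes w :: "real^3 \<Rightarrow> real^3"
  assumes L: "Lx > 0" "Ly > 0" and w: "C1_slab w" "\<And>i. C1_slab (pd i w)" "periodic_xy Lx Ly w"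
    and bc: "\<And>x. x \<in> S_minus \<union> S_plus \<Longrightarrow> w x \<bullet> pd 3 w x = 0"
  shows "integral (cell Lx Ly) (\<lambda>x. w x \<bullet> lap w x) = - dirichlet_energy Lx Ly w"
proof -
  note f = bounded_bilinear_C1_slab[OF bounded_bilinear_inner w(1) w(2)]
  have per: "periodic_xy Lx Ly (\<lambda>x. w x \<bullet> pd i w x)" for i
    using w(3) periodic_xy_pd[OF w(1,3), of i] by (simp add: periodic_xy_def)
  have z: "integral (cell Lx Ly) (pd i (\<lambda>x. w x \<bullet> pd i w x)) = 0" for i :: 3
    using integral_pd_eq_0[OF f(1) L] per bc by (cases i rule: exhaust_3[THEN disjE]) auto
  note cont = continuous_intros C1_slab_continuous_cell w
  have "0 = (\<Sum>i\<in>UNIV. integral (cell Lx Ly) (pd i (\<lambda>x. w x \<bullet> pd i w x)))" by (simp add: z)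
  also have "\<dots> = integral (cell Lx Ly) (\<lambda>x. \<Sum>i\<in>UNIV. pd i (\<lambda>x. w x \<bullet> pd i w x) x)"
    by (intro Henstock_Kurzweil_Integration.integral_sum[symmetric] integrable_cell C1_slab_continuous_cell(2)[OF f(1)]) auto
  also have "\<dots> = integral (cell Lx Ly) (\<lambda>x. w x \<bullet> lap w x + (\<Sum>i\<in>UNIV. (norm (pd i w x))\<^sup>2))"
  proof (intro Henstock_Kurzweil_Integration.integral_cong)
    fix x assume "x \<in> cell Lx Ly"
    then have x: "x \<in> slab" using cell_subset_slab by blast
    show "(\<Sum>i\<in>UNIV. pd i (\<lambda>x. w x \<bullet> pd i w x) x) = w x \<bullet> lap w x + (\<Sum>i\<in>UNIV. (norm (pd i w x))\<^sup>2)"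
      by (simp add: f(2)[OF x] lap_def inner_sum_right sum.distrib power2_norm_eq_inner)
  qed
  also have "\<dots> = integral (cell Lx Ly) (\<lambda>x. w x \<bullet> lap w x) + dirichlet_energy Lx Ly w"
    unfolding dirichlet_energy_def
    by (intro Henstock_Kurzweil_Integration.integral_add integrable_cell cont continuous_on_lap_cell)
  finally show ?thesis by simp
qed

lemma bounded_bilinear_cross3: "bounded_bilinear cross3"
  using bilinear_cross bilinear_conv_bounded_bilinear by blast

text \<open>The divergence of \<open>cross3 (E x) (B x)\<close> is the difference of the two
  integrands.\<close>

lemma integral_inner_curl:
  assumes L: "Lx > 0" "Ly > 0" and E: "C1_slab E" "periodic_xy Lx Ly E" and B: "C1_slab B" "periodic_xy Lx Ly B"
    and bc: "\<And>x. x \<in> S_minus \<union> S_plus \<Longrightarrow> cross3 (E x) (B x) $ 3 = 0"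
  shows "integral (cell Lx Ly) (\<lambda>x. B x \<bullet> curl E x) = integral (cell Lx Ly) (\<lambda>x. E x \<bullet> curl B x)"
proof -
  note v = bounded_bilinear_C1_slab[OF bounded_bilinear_cross3 E(1) B(1)]
  have "integral (cell Lx Ly) (divg (\<lambda>x. cross3 (E x) (B x))) = 0"
    using E(2) B(2) by (intro integral_divg_eq_0 v(1) L) (auto simp: periodic_xy_def bc)
  moreover have "divg (\<lambda>x. cross3 (E x) (B x)) x = B x \<bullet> curl E x - E x \<bullet> curl B x" if "x \<in> cell Lx Ly" for x
  proof -
    have x: "x \<in> slab" using that cell_subset_slab by blast
    show ?thesis
      unfolding divg_def v(2)[OF x] by (simp add: curl_def cross3_def inner_vec_def sum_3 algebra_simps)
  qed
  ultimately have "integral (cell Lx Ly) (\<lambda>x. B x \<bullet> curl E x - E x \<bullet> curl B x) = 0"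
    by (metis (no_types, lifting) Henstock_Kurzweil_Integration.integral_cong)
  moreover have "(\<lambda>x. B x \<bullet> curl E x) integrable_on cell Lx Ly" "(\<lambda>x. E x \<bullet> curl B x) integrable_on cell Lx Ly"
    by (intro integrable_cell continuous_on_inner C1_slab_continuous_cell(1) continuous_on_curl_cell E B)+
  ultimately show ?thesis
    by (simp add: Henstock_Kurzweil_Integration.integral_diff)
qed

section \<open>Energy balances\<close>

text \<open>Links the Lebesgue integrals of the definitions to the gauge integrals of the
  proofs.\<close>

lemma lebesgue_integral_cell:
  fixes f :: "real^3 \<Rightarrow> real"
  assumes "continuous_on (cell Lx Ly) f"
  shows "(LINT x|lebesgue_on (cell Lx Ly). f x) = integral (cell Lx Ly) f"
  using assms unfolding cell_def
  by (intro lebesgue_integral_eq_integral continuous_imp_integrable) auto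

lemma magnetic_energy_has_derivative:
  fixes B :: "real \<Rightarrow> real^3 \<Rightarrow> real^3"
  assumes I: "convex I" "t \<in> I" "at t within I \<noteq> bot" and B: "C_k_on (Suc 0) (I \<times> slab) (\<lambda>(s, x). B s x)"
  shows "((\<lambda>s. magnetic_energy Lx Ly (B s)) has_real_derivative
    integral (cell Lx Ly) (\<lambda>x. B t x \<bullet> vector_derivative (\<lambda>s. B s x) (at t within I))) (at t within I)"
proof -
  let ?F = "\<lambda>(s, x). B s x"
  define Bt where "Bt s x = frechet_derivative ?F (at (s, x) within I \<times> slab) (1, 0)" for s x
  have diff: "?F differentiable_on (I \<times> slab)" using B by simp
  then have cF: "continuous_on (I \<times> slab) ?F" by (rule differentiable_imp_continuous_on)
  have "(1, 0) \<in> (Basis :: (real \<times> (real^3)) set)" by (simp add: Basis_prod_def)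
  then have cBt: "continuous_on (I \<times> slab) (\<lambda>p. Bt (fst p) (snd p))"
    using B by (auto simp: Bt_def)
  have dB: "((\<lambda>s. B s x) has_vector_derivative Bt s x) (at s within I)" if "s \<in> I" "x \<in> slab" for s x
    using has_vector_derivative_time_slice[OF that(1) diff that(2)] by (simp add: Bt_def)
  have sub: "cbox 0 (vector [Lx, Ly, 1]) \<subseteq> slab" using cell_subset_slab by (simp add: cell_def)
  have cB: "continuous_on (cell Lx Ly) (B s)" if "s \<in> I" for s
  proof -
    have "continuous_on (cell Lx Ly) (\<lambda>x. ?F (s, x))"
      by (rule continuous_on_compose2[OF cF]) (use that cell_subset_slab in \<open>auto intro!: continuous_intros\<close>)
    then show ?thesis by simp
  qed
  have "((\<lambda>s. integral (cbox 0 (vector [Lx, Ly, 1])) (\<lambda>x. B s x \<bullet> B s x)) has_real_derivative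
      integral (cbox 0 (vector [Lx, Ly, 1])) (\<lambda>x. 2 * (B t x \<bullet> Bt t x))) (at t within I)"
  proof (rule leibniz_rule_field_derivative[OF _ _ _ I(2,1)])
    show "((\<lambda>s. B s x \<bullet> B s x) has_real_derivative 2 * (B s x \<bullet> Bt s x)) (at s within I)"
      if "s \<in> I" "x \<in> cbox 0 (vector [Lx, Ly, 1])" for s x
    proof -
      have "x \<in> slab" using that(2) sub by blast
      note d = dB[OF that(1) this]
      show ?thesis
        using bounded_bilinear.has_vector_derivative[OF bounded_bilinear_inner d d]
        by (simp add: has_real_derivative_iff_has_vector_derivative inner_commute)
    qed
    show "(\<lambda>x. B s x \<bullet> B s x) integrable_on cbox 0 (vector [Lx, Ly, 1])" if "s \<in> I" for s
      using cB[OF that] by (intro integrable_continuous continuous_intros) (auto simp: cell_def)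
    have "continuous_on (I \<times> cbox 0 (vector [Lx, Ly, 1])) (\<lambda>p. B (fst p) (snd p))"
      using continuous_on_subset[OF cF, of "I \<times> cbox 0 (vector [Lx, Ly, 1])"] sub by (auto simp: split_beta)
    moreover have "continuous_on (I \<times> cbox 0 (vector [Lx, Ly, 1])) (\<lambda>p. Bt (fst p) (snd p))"
      using continuous_on_subset[OF cBt, of "I \<times> cbox 0 (vector [Lx, Ly, 1])"] sub by auto
    ultimately show "continuous_on (I \<times> cbox 0 (vector [Lx, Ly, 1])) (\<lambda>(s, x). 2 * (B s x \<bullet> Bt s x))"
      unfolding split_beta by (intro continuous_intros)
  qed
  then have dE: "((\<lambda>s. 1 / 2 * integral (cell Lx Ly) (\<lambda>x. B s x \<bullet> B s x)) has_real_derivative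
      1 / 2 * integral (cell Lx Ly) (\<lambda>x. 2 * (B t x \<bullet> Bt t x))) (at t within I)"
    unfolding cell_def by (rule DERIV_cmult)
  \<comment> \<open>This formula relies on the continuity of \<open>B s\<close>, known for times in
    \<open>I\<close>; the derivative within \<open>I\<close> sees no other times.\<close>
  have en: "magnetic_energy Lx Ly (B s) = 1 / 2 * integral (cell Lx Ly) (\<lambda>x. B s x \<bullet> B s x)" if "s \<in> I" for s
    unfolding magnetic_energy_def power2_norm_eq_inner
    by (subst lebesgue_integral_cell) (auto intro!: continuous_intros cB that)
  have "((\<lambda>s. magnetic_energy Lx Ly (B s)) has_real_derivative
      1 / 2 * integral (cell Lx Ly) (\<lambda>x. 2 * (B t x \<bullet> Bt t x))) (at t within I)"
    by (rule has_field_derivative_transform_within[OF dE zero_less_one I(2)]) (simp add: en)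
  moreover have "integral (cell Lx Ly) (\<lambda>x. B t x \<bullet> Bt t x) =
      integral (cell Lx Ly) (\<lambda>x. B t x \<bullet> vector_derivative (\<lambda>s. B s x) (at t within I))"
  proof (intro Henstock_Kurzweil_Integration.integral_cong)
    fix x assume "x \<in> cell Lx Ly"
    then have "x \<in> slab" using cell_subset_slab by blast
    then show "B t x \<bullet> Bt t x = B t x \<bullet> vector_derivative (\<lambda>s. B s x) (at t within I)"
      using vector_derivative_within[OF I(3) dB[OF I(2)]] by simp
  qed
  ultimately show ?thesis by simp
qed

text \<open>The vertical component vanishes along the wall, hence so do its horizontal derivatives,
  and the horizontal vorticity reduces to the vertical shear.\<close>

lemma stress_free_boundary:
  assumes w: "C1_slab w" "no_penetration w" "stress_free w" and x: "x \<in> S_minus \<union> S_plus"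
  shows "w x $ 3 = 0" "pd 3 w x $ 1 = 0" "pd 3 w x $ 2 = 0"
proof -
  have w3: "w x $ 3 = 0" if "x \<in> S_minus \<union> S_plus" for x
    using w(2) that by (auto simp: no_penetration_def n_minus_def n_plus_def e_z_def inner_axis)
  then show "w x $ 3 = 0" using x .
  have xs: "x \<in> slab" using x by (auto simp: S_minus_def S_plus_def slab_def)
  have "pd 1 w x $ 3 = 0" "pd 2 w x $ 3 = 0"
    using pd_tangential_eq_0[OF C1_slab_nth(1)[OF w(1)] w3 x] by (simp_all add: C1_slab_nth(2)[OF w(1) xs])
  moreover have "curl w x $ 1 = 0 \<and> curl w x $ 2 = 0"
    using w(3) x
    by (auto simp: stress_free_def n_minus_def n_plus_def e_z_def cross3_def axis_def vec_eq_iff forall_3)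
  ultimately show "pd 3 w x $ 1 = 0" "pd 3 w x $ 2 = 0" by (auto simp: curl_def)
qed

text \<open>The horizontal components vanish along the wall, hence so do their horizontal
  derivatives, and solenoidality leaves only the vertical derivative of the vertical
  component.\<close>

lemma ferromagnetic_boundary:
  assumes B: "C1_slab B" "ferromagnetic B" and div: "\<And>x. x \<in> slab \<Longrightarrow> divg B x = 0" and x: "x \<in> S_minus \<union> S_plus"
  shows "B x $ 1 = 0" "B x $ 2 = 0" "pd 3 B x $ 3 = 0"
proof -
  have B12: "B x $ 1 = 0 \<and> B x $ 2 = 0" if "x \<in> S_minus \<union> S_plus" for x
    using B(2) that
    by (auto simp: ferromagnetic_def n_minus_def n_plus_def e_z_def cross3_def axis_def vec_eq_iff forall_3)
  then show "B x $ 1 = 0" "B x $ 2 = 0" using x by auto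
  have xs: "x \<in> slab" using x by (auto simp: S_minus_def S_plus_def slab_def)
  have "pd 1 B x $ 1 = 0" "pd 2 B x $ 2 = 0"
    using pd_tangential_eq_0[OF C1_slab_nth(1)[OF B(1)], of 1 x] pd_tangential_eq_0[OF C1_slab_nth(1)[OF B(1)], of 2 x] B12 x
    by (auto simp: C1_slab_nth(2)[OF B(1) xs])
  then show "pd 3 B x $ 3 = 0" using div[OF xs] by (simp add: divg_def sum_3)
qed

text \<open>The difference between the velocity and the Archimedean velocity is driven by the Lorentz force
  alone, so that the work of that force on it balances its viscous dissipation.\<close>

lemma lorentz_work_nonneg:
  fixes u uA B :: "real^3 \<Rightarrow> real^3"
  assumes L: "Lx > 0" "Ly > 0" and pos: "\<Lambda> > 0" "Ek > 0"
    and u: "C1_slab u" "\<And>i. C1_slab (pd i u)" "periodic_xy Lx Ly u" "no_penetration u" "stress_free u"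
    and uA: "C1_slab uA" "\<And>i. C1_slab (pd i uA)" "periodic_xy Lx Ly uA" "no_penetration uA" "stress_free uA"
    and P: "C1_slab P" "periodic_xy Lx Ly P" and PA: "C1_slab PA" "periodic_xy Lx Ly PA"
    and div: "\<And>x. x \<in> slab \<Longrightarrow> divg u x = 0" "\<And>x. x \<in> slab \<Longrightarrow> divg uA x = 0"
    and eq: "\<And>x. x \<in> slab \<Longrightarrow> cross3 e_z (u x) + grad P x - Ek *\<^sub>R lap (u) x = \<Lambda> *\<^sub>R J x + b x"
    and eqA: "\<And>x. x \<in> slab \<Longrightarrow> - (Ek *\<^sub>R lap uA x) + cross3 e_z (uA x) + grad PA x = b x"
  shows "0 \<le> integral (cell Lx Ly) (\<lambda>x. (u x - uA x) \<bullet> J x)"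
proof -
  define w where "w x = u x - uA x" for x
  define q where "q x = P x - PA x" for x
  note wdd = C1_slab_diff[OF u(2) uA(2)]
  have w: "C1_slab w" unfolding w_def by (rule C1_slab_diff(1)[OF u(1) uA(1)])
  have pw: "pd i w x = pd i u x - pd i uA x" if "x \<in> slab" for i x
    unfolding w_def using C1_slab_diff(2)[OF u(1) uA(1) that] by simp
  have w': "C1_slab (pd i w)" for i
    by (rule C1_slab_cong[OF wdd(1)]) (simp add: pw)
  have q: "C1_slab q" unfolding q_def by (rule C1_slab_diff(1)[OF P(1) PA(1)])
  have pq: "pd i q x = pd i P x - pd i PA x" if "x \<in> slab" for i x
    unfolding q_def using C1_slab_diff(2)[OF P(1) PA(1) that] by simp
  have per: "periodic_xy Lx Ly w" "periodic_xy Lx Ly q"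
    using u(3) uA(3) P(2) PA(2) by (auto simp: periodic_xy_def w_def q_def)
  have wdiv: "divg w x = 0" if "x \<in> slab" for x
    using div[OF that] by (simp add: divg_def pw[OF that] sum_subtractf)
  have w3: "w x $ 3 = 0" if "x \<in> S_minus \<union> S_plus" for x
    using stress_free_boundary(1)[OF u(1,4,5) that] stress_free_boundary(1)[OF uA(1,4,5) that] by (simp add: w_def)
  have wb: "w x \<bullet> pd 3 w x = 0" if "x \<in> S_minus \<union> S_plus" for x
  proof -
    have "x \<in> slab" using that by (auto simp: S_minus_def S_plus_def slab_def)
    then show ?thesis
      using stress_free_boundary[OF u(1,4,5) that] stress_free_boundary[OF uA(1,4,5) that] w3[OF that]
      by (simp add: inner_vec_def sum_3 pw)
  qed
  have lw: "lap w x = lap u x - lap uA x" if x: "x \<in> slab" for x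
  proof -
    have "pd i (pd i w) x = pd i (pd i u) x - pd i (pd i uA) x" for i
      using pd_cong[of "pd i w" "\<lambda>x. pd i u x - pd i uA x" x i] pw x wdd(2)[OF x] by simp
    then show ?thesis by (simp add: lap_def sum_subtractf)
  qed
  \<comment> \<open>The buoyancy \<open>b\<close> is common to both problems and cancels; the
    Coriolis term is orthogonal to \<open>w\<close>.\<close>
  have force: "\<Lambda> * (w x \<bullet> J x) = w x \<bullet> grad q x - Ek * (w x \<bullet> lap w x)" if x: "x \<in> slab" for x
  proof -
    have gq: "grad q x = grad P x - grad PA x" by (simp add: grad_def vec_eq_iff pq[OF x])
    have cw: "cross3 e_z (w x) = cross3 e_z (u x) - cross3 e_z (uA x)"
      by (simp add: w_def cross3_def vec_eq_iff forall_3 algebra_simps)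
    have "\<Lambda> *\<^sub>R J x = cross3 e_z (w x) + grad q x - Ek *\<^sub>R lap w x"
    proof -
      have "\<Lambda> *\<^sub>R J x = cross3 e_z (u x) + grad P x - Ek *\<^sub>R lap u x - b x"
        using eq[OF x] by (simp add: algebra_simps)
      then show ?thesis
        by (simp add: cw gq lw[OF x] scaleR_diff_right flip: eqA[OF x])
    qed
    then have "w x \<bullet> (\<Lambda> *\<^sub>R J x) = w x \<bullet> (cross3 e_z (w x) + grad q x - Ek *\<^sub>R lap w x)" by simp
    then show ?thesis by (simp add: inner_add_right inner_diff_right dot_cross_self)
  qed
  have ci: "continuous_on (cell Lx Ly) (grad q)"
    unfolding grad_def[abs_def] by (intro continuous_intros C1_slab_continuous_cell q)
  have "\<Lambda> * integral (cell Lx Ly) (\<lambda>x. w x \<bullet> J x) = integral (cell Lx Ly) (\<lambda>x. \<Lambda> * (w x \<bullet> J x))" by simp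
  also have "\<dots> = integral (cell Lx Ly) (\<lambda>x. w x \<bullet> grad q x - Ek * (w x \<bullet> lap w x))"
    using cell_subset_slab by (intro Henstock_Kurzweil_Integration.integral_cong force) auto
  also have "\<dots> = integral (cell Lx Ly) (\<lambda>x. w x \<bullet> grad q x) - integral (cell Lx Ly) (\<lambda>x. Ek * (w x \<bullet> lap w x))"
    by (intro Henstock_Kurzweil_Integration.integral_diff integrable_cell continuous_on_mult_left continuous_on_inner
        C1_slab_continuous_cell(1)[OF w] continuous_on_lap_cell ci w')
  also have "\<dots> = Ek * dirichlet_energy Lx Ly w"
  proof -
    have "integral (cell Lx Ly) (\<lambda>x. w x \<bullet> grad q x) = 0"
      by (rule integral_inner_grad_eq_0[OF L q per(2) w per(1)]) (simp_all add: wdiv w3)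
    moreover have "integral (cell Lx Ly) (\<lambda>x. w x \<bullet> lap w x) = - dirichlet_energy Lx Ly w"
      by (rule integral_inner_lap[OF L w w' per(1)]) (simp add: wb)
    ultimately show ?thesis by simp
  qed
  finally have "\<Lambda> * integral (cell Lx Ly) (\<lambda>x. w x \<bullet> J x) = Ek * dirichlet_energy Lx Ly w" .
  then have "0 \<le> \<Lambda> * integral (cell Lx Ly) (\<lambda>x. w x \<bullet> J x)"
    using dirichlet_energy_nonneg[OF w] pos by simp
  then show ?thesis using pos by (simp add: w_def zero_le_mult_iff)
qed

text \<open>By the identity \<open>curl B \<times> B = (B \<bullet> \<nabla>) B - \<nabla> (norm B)\<^sup>2 / 2\<close> the gradient part of the Lorentz force
  does no work, which replaces \<open>curl B\<close> by the full gradient of \<open>B\<close>.\<close>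

lemma lorentz_work_le:
  fixes v B :: "real^3 \<Rightarrow> real^3"
  assumes L: "Lx > 0" "Ly > 0" and v: "C1_slab v" "periodic_xy Lx Ly v" and B: "C1_slab B" "periodic_xy Lx Ly B"
    and div: "\<And>x. x \<in> slab \<Longrightarrow> divg v x = 0" and bc: "\<And>x. x \<in> S_minus \<union> S_plus \<Longrightarrow> v x $ 3 = 0"
  shows "- integral (cell Lx Ly) (\<lambda>x. v x \<bullet> cross3 (curl B x) (B x))
    \<le> integral (cell Lx Ly) (\<lambda>x. norm (v x) * norm (B x) * sqrt (\<Sum>i\<in>UNIV. (norm (pd i B x))\<^sup>2))"
proof -
  note e = bounded_bilinear_C1_slab[OF bounded_bilinear_inner B(1) B(1)]
  define A where "A x = (\<Sum>i\<in>UNIV. B x $ i *\<^sub>R pd i B x)" for x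
  have per: "periodic_xy Lx Ly (\<lambda>x. B x \<bullet> B x)" using B(2) by (simp add: periodic_xy_def)
  note cont = continuous_intros C1_slab_continuous_cell v(1) B(1)
  have cA: "continuous_on (cell Lx Ly) A" unfolding A_def by (intro cont)
  have cg: "continuous_on (cell Lx Ly) (grad (\<lambda>x. B x \<bullet> B x))"
    unfolding grad_def[abs_def] by (intro continuous_on_vec_lambda C1_slab_continuous_cell e(1))
  have id: "v x \<bullet> cross3 (curl B x) (B x) = v x \<bullet> A x - 1 / 2 * (v x \<bullet> grad (\<lambda>x. B x \<bullet> B x) x)" if x: "x \<in> slab" for x
  proof -
    have "grad (\<lambda>x. B x \<bullet> B x) x = 2 *\<^sub>R (\<chi> i. B x \<bullet> pd i B x)"
      by (simp add: grad_def vec_eq_iff e(2)[OF x] inner_commute)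
    then show ?thesis
      by (simp add: A_def cross3_def curl_def inner_vec_def sum_3 algebra_simps)
  qed
  have bound: "\<bar>v x \<bullet> A x\<bar> \<le> norm (v x) * norm (B x) * sqrt (\<Sum>i\<in>UNIV. (norm (pd i B x))\<^sup>2)" for x
  proof -
    \<comment> \<open>Cauchy-Schwarz over \<open>i\<close> bounds the convective form with constant
      one, whereas a pointwise bound of \<open>curl B\<close> by the gradient would cost a factor
      \<open>sqrt 2\<close>.\<close>
    have "norm (A x) \<le> (\<Sum>i\<in>UNIV. \<bar>B x $ i\<bar> * norm (pd i B x))"
      unfolding A_def using norm_sum[of "\<lambda>i. B x $ i *\<^sub>R pd i B x" UNIV] by simp
    also have "\<dots> \<le> L2_set (\<lambda>i. B x $ i) UNIV * L2_set (\<lambda>i. norm (pd i B x)) UNIV"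
      using L2_set_mult_ineq[of "\<lambda>i. B x $ i" "\<lambda>i. norm (pd i B x)" UNIV] by simp
    also have "\<dots> = norm (B x) * sqrt (\<Sum>i\<in>UNIV. (norm (pd i B x))\<^sup>2)"
      by (simp add: norm_vec_def L2_set_def)
    finally have "norm (v x) * norm (A x) \<le> norm (v x) * (norm (B x) * sqrt (\<Sum>i\<in>UNIV. (norm (pd i B x))\<^sup>2))"
      by (intro mult_left_mono) auto
    then show ?thesis using Cauchy_Schwarz_ineq2[of "v x" "A x"] by (simp add: mult.assoc)
  qed
  have "integral (cell Lx Ly) (\<lambda>x. v x \<bullet> cross3 (curl B x) (B x)) =
      integral (cell Lx Ly) (\<lambda>x. v x \<bullet> A x - 1 / 2 * (v x \<bullet> grad (\<lambda>x. B x \<bullet> B x) x))"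
    using cell_subset_slab by (intro Henstock_Kurzweil_Integration.integral_cong id) auto
  also have "\<dots> = integral (cell Lx Ly) (\<lambda>x. v x \<bullet> A x) - integral (cell Lx Ly) (\<lambda>x. 1 / 2 * (v x \<bullet> grad (\<lambda>x. B x \<bullet> B x) x))"
    by (intro Henstock_Kurzweil_Integration.integral_diff integrable_cell continuous_on_mult_left continuous_on_inner
        C1_slab_continuous_cell(1)[OF v(1)] cA cg)
  also have "\<dots> = integral (cell Lx Ly) (\<lambda>x. v x \<bullet> A x)"
  proof -
    have "integral (cell Lx Ly) (\<lambda>x. v x \<bullet> grad (\<lambda>x. B x \<bullet> B x) x) = 0"
      by (rule integral_inner_grad_eq_0[OF L e(1) per v]) (simp_all add: div bc)
    then show ?thesis by simp
  qed
  finally have "- integral (cell Lx Ly) (\<lambda>x. v x \<bullet> cross3 (curl B x) (B x)) = integral (cell Lx Ly) (\<lambda>x. - (v x \<bullet> A x))"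
    by simp
  also have "\<dots> \<le> integral (cell Lx Ly) (\<lambda>x. norm (v x) * norm (B x) * sqrt (\<Sum>i\<in>UNIV. (norm (pd i B x))\<^sup>2))"
  proof (rule integral_le)
    show "(\<lambda>x. - (v x \<bullet> A x)) integrable_on cell Lx Ly"
      by (intro integrable_cell continuous_intros cA C1_slab_continuous_cell(1)[OF v(1)])
    show "(\<lambda>x. norm (v x) * norm (B x) * sqrt (\<Sum>i\<in>UNIV. (norm (pd i B x))\<^sup>2)) integrable_on cell Lx Ly"
      by (intro integrable_cell cont)
  qed (use bound in \<open>simp add: abs_le_iff\<close>)
  finally show ?thesis .
qed

text \<open>Neither boundary term survives. Every term of the electromagnetic flux through a wall
  contains a horizontal component of \<open>B\<close>, and in the diffusive flux
  \<open>B x \<bullet> pd 3 B x\<close> one factor of each product vanishes.\<close>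

lemma induction_energy_balance:
  fixes u B Bt :: "real^3 \<Rightarrow> real^3"
  assumes L: "Lx > 0" "Ly > 0" and u: "C1_slab u" "periodic_xy Lx Ly u"
    and B: "C1_slab B" "\<And>i. C1_slab (pd i B)" "periodic_xy Lx Ly B" "ferromagnetic B"
    and div: "\<And>x. x \<in> slab \<Longrightarrow> divg B x = 0"
    and eq: "\<And>x. x \<in> slab \<Longrightarrow> Bt x - curl (\<lambda>y. cross3 (u y) (B y)) x = \<eta> *\<^sub>R lap B x"
  shows "integral (cell Lx Ly) (\<lambda>x. B x \<bullet> Bt x) =
    - integral (cell Lx Ly) (\<lambda>x. u x \<bullet> cross3 (curl B x) (B x)) - \<eta> * dirichlet_energy Lx Ly B"
proof -
  note E = bounded_bilinear_C1_slab(1)[OF bounded_bilinear_cross3 u(1) B(1)]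
  have per: "periodic_xy Lx Ly (\<lambda>x. cross3 (u x) (B x))" using u(2) B(3) by (simp add: periodic_xy_def)
  note bd = ferromagnetic_boundary[OF B(1,4) div]
  have "integral (cell Lx Ly) (\<lambda>x. B x \<bullet> Bt x) =
      integral (cell Lx Ly) (\<lambda>x. B x \<bullet> curl (\<lambda>y. cross3 (u y) (B y)) x + \<eta> * (B x \<bullet> lap B x))"
  proof (intro Henstock_Kurzweil_Integration.integral_cong)
    fix x assume "x \<in> cell Lx Ly"
    then have "x \<in> slab" using cell_subset_slab by blast
    then have "Bt x = curl (\<lambda>y. cross3 (u y) (B y)) x + \<eta> *\<^sub>R lap B x" using eq by (simp add: algebra_simps)
    then show "B x \<bullet> Bt x = B x \<bullet> curl (\<lambda>y. cross3 (u y) (B y)) x + \<eta> * (B x \<bullet> lap B x)"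
      by (simp add: inner_add_right)
  qed
  also have "\<dots> = integral (cell Lx Ly) (\<lambda>x. B x \<bullet> curl (\<lambda>y. cross3 (u y) (B y)) x)
      + integral (cell Lx Ly) (\<lambda>x. \<eta> * (B x \<bullet> lap B x))"
    by (intro Henstock_Kurzweil_Integration.integral_add integrable_cell continuous_on_mult_left continuous_on_inner
        C1_slab_continuous_cell(1)[OF B(1)] continuous_on_curl_cell E continuous_on_lap_cell B(2))
  also have "integral (cell Lx Ly) (\<lambda>x. B x \<bullet> curl (\<lambda>y. cross3 (u y) (B y)) x) =
      integral (cell Lx Ly) (\<lambda>x. cross3 (u x) (B x) \<bullet> curl B x)"
    by (rule integral_inner_curl[OF L E per B(1,3)]) (use bd in \<open>simp add: cross3_def\<close>)
  also have "\<dots> = - integral (cell Lx Ly) (\<lambda>x. u x \<bullet> cross3 (curl B x) (B x))"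
  proof -
    have "cross3 a b \<bullet> c = - (a \<bullet> cross3 c b)" for a b c
      by (simp add: cross3_def inner_vec_def sum_3 algebra_simps)
    then show ?thesis by simp
  qed
  also have "integral (cell Lx Ly) (\<lambda>x. \<eta> * (B x \<bullet> lap B x)) = - \<eta> * dirichlet_energy Lx Ly B"
    using integral_inner_lap[OF L B(1-3)] bd by (simp add: inner_vec_def sum_3)
  finally show ?thesis by simp
qed

section \<open>The Hoelder inequality\<close>

text \<open>The logarithm lies below its tangent at the weighted mean \<open>S\<close>; averaging
  with the weights makes the linear part cancel.\<close>

lemma weighted_am_gm:
  fixes x w :: "'k \<Rightarrow> real"
  assumes K: "finite K" and w: "\<And>k. k \<in> K \<Longrightarrow> 0 \<le> w k" "(\<Sum>k\<in>K. w k) = 1" and x: "\<And>k. k \<in> K \<Longrightarrow> 0 \<le> x k"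
  shows "(\<Prod>k\<in>K. x k powr w k) \<le> (\<Sum>k\<in>K. w k * x k)"
proof (cases "\<exists>k\<in>K. x k = 0")
  case True
  \<comment> \<open>\<open>0 powr w\<close> is \<open>0\<close> for every \<open>w\<close>,
    including \<open>w = 0\<close>.\<close>
  then have "(\<Prod>k\<in>K. x k powr w k) = 0" using K by (auto intro: prod_zero)
  then show ?thesis using w x by (auto intro!: sum_nonneg)
next
  case False
  then have pos: "0 < x k" if "k \<in> K" for k using x[OF that] that by fastforce
  define S where "S = (\<Sum>k\<in>K. w k * x k)"
  have "\<exists>k\<in>K. w k \<noteq> 0" using w(2) by (metis sum.neutral zero_neq_one)
  then obtain k where k: "k \<in> K" "0 < w k" using w(1) by fastforce
  have S: "0 < S" unfolding S_def
    by (rule sum_pos2[OF K k(1)]) (use k pos w(1) x in auto)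
  have "(\<Sum>k\<in>K. w k * ln (x k)) \<le> (\<Sum>k\<in>K. w k * (x k / S - 1 + ln S))"
  proof (intro sum_mono mult_left_mono w)
    fix k assume "k \<in> K"
    then show "ln (x k) \<le> x k / S - 1 + ln S"
      using ln_le_minus_one[of "x k / S"] pos[of k] S by (simp add: ln_div)
  qed
  also have "\<dots> = (\<Sum>k\<in>K. w k * x k) / S - (\<Sum>k\<in>K. w k) + (\<Sum>k\<in>K. w k) * ln S"
    by (simp add: distrib_left right_diff_distrib sum.distrib sum_subtractf sum_divide_distrib sum_distrib_right)
  also have "\<dots> = ln S" using S w(2) by (simp add: S_def[symmetric])
  finally have "exp (\<Sum>k\<in>K. w k * ln (x k)) \<le> S" using S by (simp add: ln_ge_iff)
  moreover have "exp (\<Sum>k\<in>K. w k * ln (x k)) = (\<Prod>k\<in>K. x k powr w k)"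
    unfolding exp_sum[OF K] using pos by (intro prod.cong refl) (simp add: powr_def less_imp_neq[symmetric])
  ultimately show ?thesis by (simp add: S_def)
qed

text \<open>The integrand is only bounded by the product of powers: for a vanishing exponent that product
  is discontinuous, because \<open>0 powr 0 = 0\<close>.\<close>

lemma integral_weighted_holder:
  fixes f :: "'k \<Rightarrow> 'a::euclidean_space \<Rightarrow> real" and h :: "'a \<Rightarrow> real"
  assumes K: "finite K" and w: "\<And>k. k \<in> K \<Longrightarrow> 0 \<le> w k" "(\<Sum>k\<in>K. w k) = 1"
    and box: "box a b \<noteq> {}" and h: "continuous_on (cbox a b) h"
    and f: "\<And>k. k \<in> K \<Longrightarrow> continuous_on (cbox a b) (f k)"
    and f0: "\<And>k x. k \<in> K \<Longrightarrow> x \<in> cbox a b \<Longrightarrow> 0 \<le> f k x"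
    and le: "\<And>x. x \<in> cbox a b \<Longrightarrow> h x \<le> (\<Prod>k\<in>K. f k x powr w k)"
  shows "integral (cbox a b) h \<le> (\<Prod>k\<in>K. integral (cbox a b) (f k) powr w k)"
proof -
  define c where "c k = integral (cbox a b) (f k)" for k
  have c0: "0 \<le> c k" if "k \<in> K" for k
    unfolding c_def using that f f0 by (intro integral_nonneg integrable_continuous)
  show ?thesis
  proof (cases "\<exists>k\<in>K. c k = 0")
    \<comment> \<open>A vanishing integral forces its nonnegative continuous integrand to vanish,
      and then \<open>h\<close> is at most zero, even if the weight is zero.\<close>
    case True
    then obtain k where k: "k \<in> K" "c k = 0" by blast
    have "f k x = 0" if "x \<in> cbox a b" for x
      using integral_cbox_eq_0_iff[OF f[OF k(1)] box f0[OF k(1)]] k(2) that by (simp add: c_def)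
    then have "(\<Prod>k\<in>K. f k x powr w k) = 0" if "x \<in> cbox a b" for x
      using that K k(1) by (intro prod_zero) auto
    then have "integral (cbox a b) h \<le> integral (cbox a b) (\<lambda>x. 0)"
      using le by (intro integral_le integrable_continuous h) auto
    also have "\<dots> \<le> (\<Prod>k\<in>K. integral (cbox a b) (f k) powr w k)" by (simp add: prod_nonneg)
    finally show ?thesis .
  next
    case False
    then have c: "0 < c k" if "k \<in> K" for k using c0[OF that] that by fastforce
    define M where "M = (\<Prod>k\<in>K. c k powr w k)"
    have M: "0 \<le> M" by (simp add: M_def prod_nonneg)
    \<comment> \<open>Each function is normalised by its integral; after the weighted mean
      inequality every term integrates to its weight.\<close>
    have "integral (cbox a b) h \<le> integral (cbox a b) (\<lambda>x. M * (\<Sum>k\<in>K. w k * (f k x / c k)))"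
    proof (intro integral_le integrable_continuous h)
      fix x assume x: "x \<in> cbox a b"
      have "(\<Prod>k\<in>K. f k x powr w k) = (\<Prod>k\<in>K. c k powr w k * (f k x / c k) powr w k)"
      proof (intro prod.cong refl)
        fix k assume "k \<in> K"
        then show "f k x powr w k = c k powr w k * (f k x / c k) powr w k"
          using c f0[OF _ x] by (subst powr_mult[symmetric]) (auto simp: less_imp_le less_imp_neq[symmetric])
      qed
      also have "\<dots> = M * (\<Prod>k\<in>K. (f k x / c k) powr w k)" by (simp add: M_def prod.distrib)
      also have "\<dots> \<le> M * (\<Sum>k\<in>K. w k * (f k x / c k))"
        using c f0[OF _ x] by (intro mult_left_mono weighted_am_gm K w M) (auto simp: less_imp_le)
      finally show "h x \<le> M * (\<Sum>k\<in>K. w k * (f k x / c k))" using le[OF x] by linarith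
    qed (use c in \<open>auto intro!: continuous_intros f simp: less_imp_neq[symmetric]\<close>)
    also have "\<dots> = M * integral (cbox a b) (\<lambda>x. \<Sum>k\<in>K. w k * (f k x / c k))" by simp
    also have "integral (cbox a b) (\<lambda>x. \<Sum>k\<in>K. w k * (f k x / c k)) = (\<Sum>k\<in>K. integral (cbox a b) (\<lambda>x. w k * (f k x / c k)))"
      using c by (intro Henstock_Kurzweil_Integration.integral_sum K integrable_continuous continuous_intros f)
        (auto simp: less_imp_neq[symmetric])
    also have "\<dots> = (\<Sum>k\<in>K. w k)"
      using c by (intro sum.cong refl) (simp add: c_def[symmetric] less_imp_neq[symmetric])
    finally show ?thesis by (simp add: w(2) M_def c_def)
  qed
qed

section \<open>The advection integral on the cell\<close>

lemma box_cell_nonempty: "Lx > 0 \<Longrightarrow> Ly > 0 \<Longrightarrow> box 0 (vector [Lx, Ly, 1] :: real^3) \<noteq> {}"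
proof -
  assume "Lx > 0" "Ly > 0"
  then have "vector [Lx / 2, Ly / 2, 1 / 2] \<in> box 0 (vector [Lx, Ly, 1] :: real^3)"
    by (simp add: mem_box_cart forall_3)
  then show ?thesis by blast
qed

text \<open>\<open>Lp_norm\<close> reads off a real number by \<open>real_of_ereal\<close>, which
  sends infinite values to zero. The essential supremum therefore has to be confined: from below by
  zero, because the cell has positive measure, and from above by a finite bound, because the cell is
  compact.\<close>

lemma Lp_norm_infinity_bound:
  assumes L: "Lx > 0" "Ly > 0" and v: "continuous_on (cell Lx Ly) v"
    and f: "continuous_on (cell Lx Ly) f" "\<And>x. 0 \<le> f x"
  shows "integral (cell Lx Ly) (\<lambda>x. norm (v x) * f x) \<le> Lp_norm \<infinity> (cell Lx Ly) v * integral (cell Lx Ly) f"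
proof -
  let ?M = "lebesgue_on (cell Lx Ly)"
  let ?e = "esssup ?M (\<lambda>x. ereal (norm (v x)))"
  have int: "integrable ?M g" if "continuous_on (cell Lx Ly) g" for g :: "real^3 \<Rightarrow> real"
    using that unfolding cell_def by (rule continuous_imp_integrable)
  have meas: "(\<lambda>x. ereal (norm (v x))) \<in> borel_measurable ?M"
    using int[of "\<lambda>x. norm (v x)"] v by (intro borel_measurable_ereal borel_measurable_integrable) (auto intro!: continuous_intros)
  have "compact (cell Lx Ly)" by (simp add: cell_def)
  then have "bounded (v ` cell Lx Ly)" using v by (intro compact_imp_bounded compact_continuous_image)
  then obtain b where b: "\<And>x. x \<in> cell Lx Ly \<Longrightarrow> norm (v x) \<le> b" by (auto simp: bounded_iff)
  have "?e \<le> ereal b" by (rule esssup_I[OF meas]) (auto simp: b)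
  moreover have "0 \<le> ?e"
  proof -
    have "emeasure ?M (space ?M) = ennreal (measure lborel (cbox 0 (vector [Lx, Ly, 1] :: real^3)))"
      unfolding cell_def by (simp add: emeasure_restrict_space emeasure_eq_measure2[OF fmeasurable_cbox])
    also have "\<dots> \<noteq> 0"
      using content_pos_lt_eq[of 0 "vector [Lx, Ly, 1] :: real^3"] box_cell_nonempty[OF L]
      by (simp add: box_ne_empty(2))
    finally have "esssup ?M (\<lambda>x. 0 :: ereal) = 0" by (rule esssup_const)
    then show ?thesis using esssup_mono[of "\<lambda>x. 0 :: ereal" ?M "\<lambda>x. ereal (norm (v x))"] by simp
  qed
  ultimately have e: "ereal (real_of_ereal ?e) = ?e" by (intro ereal_real') auto
  have "AE x in ?M. ereal (norm (v x)) \<le> ?e" by (rule esssup_AE)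
  then have "AE x in ?M. norm (v x) * f x \<le> real_of_ereal ?e * f x"
    by eventually_elim (use e f(2) in \<open>metis ereal_less_eq(3) mult_right_mono\<close>)
  then have "(LINT x|?M. norm (v x) * f x) \<le> (LINT x|?M. real_of_ereal ?e * f x)"
    by (intro integral_mono_AE int continuous_intros v f)
  then show ?thesis
    by (subst (asm) (1 2) lebesgue_integral_cell) (auto intro!: continuous_intros v f simp: Lp_norm_def)
qed

lemma C_P_pos: "Lx > 0 \<Longrightarrow> Ly > 0 \<Longrightarrow> 0 < C_P Lx Ly"
  using lambda1_bounds(1) by (simp add: C_P_def)

lemma C_S_nonneg: "Lx > 0 \<Longrightarrow> Ly > 0 \<Longrightarrow> 0 \<le> C_S Lx Ly"
  using lambda1_bounds(1)[of Lx Ly] by (simp add: C_S_def C_3_def)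

lemma power_powr_real:
  fixes x :: real
  assumes "0 \<le> x" "0 < n"
  shows "(x ^ n) powr s = x powr (real n * s)"
  using assms by (cases "x = 0") (simp_all add: powr_powr flip: powr_realpow)

text \<open>The interpolation of \<open>B\<close> between \<open>L2\<close> and \<open>L6\<close> is
  built into one application of the Hoelder inequality to four functions.\<close>

lemma integral_advection_bound_finite:
  fixes v B :: "real^3 \<Rightarrow> real^3" and r :: real
  assumes L: "Lx > 0" "Ly > 0" and v: "C1_slab v" and B: "C1_slab B" and r: "3 \<le> r"
    and poincare: "integral (cell Lx Ly) (\<lambda>x. (norm (B x))\<^sup>2) \<le> (C_P Lx Ly)\<^sup>2 * dirichlet_energy Lx Ly B"
    and sobolev: "integral (cell Lx Ly) (\<lambda>x. norm (B x) ^ 6) \<le> (C_S Lx Ly * sqrt (dirichlet_energy Lx Ly B)) ^ 6"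
  shows "integral (cell Lx Ly) (\<lambda>x. norm (v x) * norm (B x) * sqrt (\<Sum>i\<in>UNIV. (norm (pd i B x))\<^sup>2))
    \<le> A_p Lx Ly (ereal r) * Lp_norm (ereal r) (cell Lx Ly) v * dirichlet_energy Lx Ly B"
proof -
  let ?V = "cell Lx Ly" and ?G = "dirichlet_energy Lx Ly B"
  let ?e = "\<lambda>x. \<Sum>i\<in>UNIV. (norm (pd i B x))\<^sup>2"
  define f where "f = (\<lambda>k::nat. [\<lambda>x. norm (v x) powr r, \<lambda>x. (norm (B x))\<^sup>2, \<lambda>x. norm (B x) ^ 6, ?e] ! k)"
  \<comment> \<open>The weights are forced: \<open>1 / r\<close> and \<open>1 / 2\<close> by the
    norms of \<open>v\<close> and of the gradient, the other two because they must sum to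
    \<open>1 / 2 - 1 / r\<close> and satisfy \<open>2 * w 1 + 6 * w 2 = 1\<close> to reproduce
    \<open>norm (B x)\<close>. At \<open>r = 3\<close> the weight \<open>w 1\<close> is
    zero.\<close>
  define w where "w = (\<lambda>k::nat. [1 / r, (r - 3) / (2 * r), 1 / (2 * r), 1 / 2] ! k)"
  have K: "{..<4::nat} = {0, 1, 2, 3}" by auto
  have f4: "f 0 = (\<lambda>x. norm (v x) powr r)" "f 1 = (\<lambda>x. (norm (B x))\<^sup>2)" "f 2 = (\<lambda>x. norm (B x) ^ 6)" "f 3 = ?e"
    by (simp_all add: f_def eval_nat_numeral)
  have w4: "w 0 = 1 / r" "w 1 = (r - 3) / (2 * r)" "w 2 = 1 / (2 * r)" "w 3 = 1 / 2"
    by (simp_all add: w_def eval_nat_numeral)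
  note cont = continuous_intros C1_slab_continuous_cell v B
  have c: "continuous_on ?V (f k)" if "k \<in> {..<4}" for k
  proof -
    have "continuous_on ?V (\<lambda>x. norm (v x) powr r)"
      using r by (intro continuous_on_powr' cont) auto
    moreover have "continuous_on ?V (\<lambda>x. (norm (B x))\<^sup>2)" "continuous_on ?V (\<lambda>x. norm (B x) ^ 6)" "continuous_on ?V ?e"
      by (intro cont)+
    ultimately show ?thesis using that unfolding K by (elim insertE) (simp_all add: f4 del: One_nat_def)
  qed
  have f0: "0 \<le> f k x" if "k \<in> {..<4}" for k x
    using that unfolding K by (elim insertE) (auto simp: f4 sum_nonneg simp del: One_nat_def)
  have w0: "0 \<le> w k" if "k \<in> {..<4}" for k
    using that r unfolding K by (elim insertE) (auto simp: w4 simp del: One_nat_def)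
  have w1: "(\<Sum>k\<in>{..<4}. w k) = 1"
    using r unfolding K by (simp add: w4 del: One_nat_def) (simp add: field_simps)
  have G0: "0 \<le> ?G" by (rule dirichlet_energy_nonneg[OF B])
  have le: "norm (v x) * norm (B x) * sqrt (?e x) \<le> (\<Prod>k\<in>{..<4}. f k x powr w k)" for x
  proof (cases "B x = 0")
    case False
    then have b: "0 < norm (B x)" by simp
    have 1: "(norm (v x) powr r) powr (1 / r) = norm (v x)" using r by (simp add: powr_powr)
    have 2: "((norm (B x))\<^sup>2) powr ((r - 3) / (2 * r)) * (norm (B x) ^ 6) powr (1 / (2 * r)) = norm (B x)"
    proof -
      have "2 * ((r - 3) / (2 * r)) + 6 * (1 / (2 * r)) = 1" using r by (simp add: field_simps)
      then have "norm (B x) powr (2 * ((r - 3) / (2 * r))) * norm (B x) powr (6 * (1 / (2 * r))) = norm (B x)"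
        using b by (simp only: powr_add[symmetric]) simp
      moreover have "(norm (B x))\<^sup>2 = norm (B x) powr 2" "norm (B x) ^ 6 = norm (B x) powr 6" using b by simp_all
      ultimately show ?thesis by (simp only: powr_powr)
    qed
    have 3: "?e x powr (1 / 2) = sqrt (?e x)" by (simp add: powr_half_sqrt sum_nonneg)
    have "(\<Prod>k\<in>{..<4}. f k x powr w k) = (norm (v x) powr r) powr (1 / r)
        * (((norm (B x))\<^sup>2) powr ((r - 3) / (2 * r)) * (norm (B x) ^ 6) powr (1 / (2 * r))) * ?e x powr (1 / 2)"
      unfolding K by (simp add: f4 w4 mult.assoc del: One_nat_def)
    also have "\<dots> = norm (v x) * norm (B x) * sqrt (?e x)" by (simp only: 1 2 3)
    finally show ?thesis by simp
  qed (simp add: prod_nonneg)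
  have "integral ?V (\<lambda>x. norm (v x) * norm (B x) * sqrt (?e x)) \<le> (\<Prod>k\<in>{..<4}. integral ?V (f k) powr w k)"
  proof -
    have "continuous_on ?V (\<lambda>x. norm (v x) * norm (B x) * sqrt (?e x))" by (intro cont)
    then show ?thesis
      using c unfolding cell_def
      by (intro integral_weighted_holder w0 w1 f0 le box_cell_nonempty L) auto
  qed
  also have "\<dots> = integral ?V (\<lambda>x. norm (v x) powr r) powr (1 / r) * (integral ?V (\<lambda>x. (norm (B x))\<^sup>2) powr ((r - 3) / (2 * r))
      * (integral ?V (\<lambda>x. norm (B x) ^ 6) powr (1 / (2 * r)) * ?G powr (1 / 2)))"
    unfolding K by (simp add: f4 w4 dirichlet_energy_def del: One_nat_def)
  also have "\<dots> \<le> integral ?V (\<lambda>x. norm (v x) powr r) powr (1 / r) * ((C_P Lx Ly * sqrt ?G) powr ((r - 3) / r)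
      * ((C_S Lx Ly * sqrt ?G) powr (3 / r) * sqrt ?G))"
  proof (intro mult_left_mono mult_mono)
    have "integral ?V (\<lambda>x. (norm (B x))\<^sup>2) powr ((r - 3) / (2 * r)) \<le> ((C_P Lx Ly * sqrt ?G)\<^sup>2) powr ((r - 3) / (2 * r))"
      using poincare r G0 by (intro powr_mono2 integral_nonneg integrable_cell cont) (auto simp: power_mult_distrib)
    also have "\<dots> = (C_P Lx Ly * sqrt ?G) powr ((r - 3) / r)"
    proof -
      have "real 2 * ((r - 3) / (2 * r)) = (r - 3) / r" using r by (simp add: field_simps)
      then show ?thesis using C_P_pos[OF L] G0 by (subst power_powr_real) simp_all
    qed
    finally show "integral ?V (\<lambda>x. (norm (B x))\<^sup>2) powr ((r - 3) / (2 * r)) \<le> (C_P Lx Ly * sqrt ?G) powr ((r - 3) / r)" .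
    have "integral ?V (\<lambda>x. norm (B x) ^ 6) powr (1 / (2 * r)) \<le> ((C_S Lx Ly * sqrt ?G) ^ 6) powr (1 / (2 * r))"
      using sobolev r by (intro powr_mono2 integral_nonneg integrable_cell cont) auto
    also have "\<dots> = (C_S Lx Ly * sqrt ?G) powr (3 / r)"
    proof -
      have "real 6 * (1 / (2 * r)) = 3 / r" using r by (simp add: field_simps)
      then show ?thesis using C_S_nonneg[OF L] G0 by (subst power_powr_real) simp_all
    qed
    finally show "integral ?V (\<lambda>x. norm (B x) ^ 6) powr (1 / (2 * r)) \<le> (C_S Lx Ly * sqrt ?G) powr (3 / r)" .
    show "?G powr (1 / 2) \<le> sqrt ?G" using G0 by (simp add: powr_half_sqrt)
  qed (use C_P_pos[OF L] C_S_nonneg[OF L] in auto)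
  also have "\<dots> = A_p Lx Ly (ereal r) * Lp_norm (ereal r) ?V v * ?G"
  proof -
    have "LINT x|lebesgue_on ?V. norm (v x) powr r = integral ?V (\<lambda>x. norm (v x) powr r)"
      using c[of 0] by (intro lebesgue_integral_cell) (simp add: f4)
    moreover have "sqrt ?G powr ((r - 3) / r) * (sqrt ?G powr (3 / r) * sqrt ?G) = ?G"
    proof (cases "?G = 0")
      case False
      then have "0 < sqrt ?G" using G0 by simp
      moreover have "(r - 3) / r + 3 / r = 1" using r by (simp add: field_simps)
      ultimately have "sqrt ?G powr ((r - 3) / r) * sqrt ?G powr (3 / r) = sqrt ?G"
        by (simp only: powr_add[symmetric]) simp
      then show ?thesis using G0 by (simp add: mult.assoc[symmetric])
    qed simp
    ultimately show ?thesis
      using C_P_pos[OF L] C_S_nonneg[OF L] G0 by (simp add: A_p_def Lp_norm_def powr_mult mult_ac)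
  qed
  finally show ?thesis .
qed

lemma integral_advection_bound:
  fixes v B :: "real^3 \<Rightarrow> real^3" and p :: ereal
  assumes L: "Lx > 0" "Ly > 0" and v: "C1_slab v" and B: "C1_slab B" and p: "3 \<le> p"
    and poincare: "integral (cell Lx Ly) (\<lambda>x. (norm (B x))\<^sup>2) \<le> (C_P Lx Ly)\<^sup>2 * dirichlet_energy Lx Ly B"
    and sobolev: "integral (cell Lx Ly) (\<lambda>x. norm (B x) ^ 6) \<le> (C_S Lx Ly * sqrt (dirichlet_energy Lx Ly B)) ^ 6"
  shows "integral (cell Lx Ly) (\<lambda>x. norm (v x) * norm (B x) * sqrt (\<Sum>i\<in>UNIV. (norm (pd i B x))\<^sup>2))
    \<le> A_p Lx Ly p * Lp_norm p (cell Lx Ly) v * dirichlet_energy Lx Ly B"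
proof (cases p)
  case (real r)
  then show ?thesis using integral_advection_bound_finite[OF L v B _ poincare sobolev, of r] p by simp
next
  case PInf
  let ?V = "cell Lx Ly" and ?G = "dirichlet_energy Lx Ly B"
  let ?s = "\<lambda>x. sqrt (\<Sum>i\<in>UNIV. (norm (pd i B x))\<^sup>2)"
  note cont = continuous_intros C1_slab_continuous_cell B
  have G0: "0 \<le> ?G" by (rule dirichlet_energy_nonneg[OF B])
  \<comment> \<open>At infinity no \<open>L6\<close> norm is involved: Cauchy-Schwarz and Poincare
    give the constant \<open>C_P\<close>.\<close>
  have "integral ?V (\<lambda>x. norm (v x) * (norm (B x) * ?s x)) \<le> Lp_norm \<infinity> ?V v * integral ?V (\<lambda>x. norm (B x) * ?s x)"
    by (intro Lp_norm_infinity_bound L C1_slab_continuous_cell v cont) (simp add: sum_nonneg)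
  also have "\<dots> \<le> Lp_norm \<infinity> ?V v * (C_P Lx Ly * ?G)"
  proof (intro mult_left_mono)
    have "integral ?V (\<lambda>x. norm (B x) * ?s x) \<le> sqrt (integral ?V (\<lambda>x. (norm (B x))\<^sup>2)) * sqrt (integral ?V (\<lambda>x. (?s x)\<^sup>2))"
      by (intro integral_Cauchy_Schwarz integrable_cell cont)
    also have "integral ?V (\<lambda>x. (?s x)\<^sup>2) = ?G" by (simp add: dirichlet_energy_def sum_nonneg)
    also have "sqrt (integral ?V (\<lambda>x. (norm (B x))\<^sup>2)) * sqrt ?G \<le> sqrt ((C_P Lx Ly)\<^sup>2 * ?G) * sqrt ?G"
      using poincare G0 by (intro mult_right_mono real_sqrt_le_mono) auto
    also have "\<dots> = C_P Lx Ly * ?G" using C_P_pos[OF L] G0 by (simp add: real_sqrt_mult)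
    finally show "integral ?V (\<lambda>x. norm (B x) * ?s x) \<le> C_P Lx Ly * ?G" .
    \<comment> \<open>Testing the same bound with the constant function \<open>1\<close> shows that
      the norm is nonnegative.\<close>
    have "0 \<le> integral ?V (\<lambda>x. norm (v x) * 1)"
      by (intro integral_nonneg integrable_cell continuous_intros C1_slab_continuous_cell v) auto
    also have "\<dots> \<le> Lp_norm \<infinity> ?V v * integral ?V (\<lambda>x. 1)"
      by (intro Lp_norm_infinity_bound L C1_slab_continuous_cell v cont) simp
    finally have "0 \<le> Lp_norm \<infinity> ?V v * measure lborel (cbox 0 (vector [Lx, Ly, 1] :: real^3))" by (simp add: cell_def)
    moreover have "0 < measure lborel (cbox 0 (vector [Lx, Ly, 1] :: real^3))"
      using content_pos_lt_eq[of 0 "vector [Lx, Ly, 1] :: real^3"] box_cell_nonempty[OF L] by (simp add: box_ne_empty(2))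
    ultimately show "0 \<le> Lp_norm \<infinity> ?V v" by (simp add: zero_le_mult_iff)
  qed
  finally show ?thesis using PInf by (simp add: A_p_def mult_ac)
qed (use p in simp)

section \<open>The lower bound for dynamo action\<close>

lemma magnetic_poincare_sobolev:
  fixes B :: "real^3 \<Rightarrow> real^3"
  assumes L: "Lx > 0" "Ly > 0" and B: "C1_slab B" "periodic_xy Lx Ly B" "ferromagnetic B"
    and div: "\<And>x. x \<in> slab \<Longrightarrow> divg B x = 0" and exact: "magnetic_flux_exact Lx Ly B"
  shows "integral (cell Lx Ly) (\<lambda>x. (norm (B x))\<^sup>2) \<le> (C_P Lx Ly)\<^sup>2 * dirichlet_energy Lx Ly B"
    and "integral (cell Lx Ly) (\<lambda>x. norm (B x) ^ 6) \<le> (C_S Lx Ly * sqrt (dirichlet_energy Lx Ly B)) ^ 6"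
proof -
  have "continuous_on (cbox (0, 0) (Lx, Ly)) (\<lambda>q. n_minus \<bullet> B (vector [fst q, snd q, 0]))"
    by (intro continuous_intros continuous_on_slab_vector[OF C1_slab_continuous[OF B(1)]]) auto
  then have "integral (cbox (0, 0) (Lx, Ly)) (\<lambda>q. n_minus \<bullet> B (vector [fst q, snd q, 0])) = flux_minus Lx Ly B"
    unfolding flux_minus_def split_beta
    by (intro lebesgue_integral_eq_integral[symmetric] continuous_imp_integrable) auto
  also have "\<dots> = 0" using exact by (simp add: magnetic_flux_exact_def)
  finally have flux: "integral (cbox (0, 0) (Lx, Ly)) (\<lambda>q. B (vector [fst q, snd q, 0]) $ 3) = 0"
    by (simp add: n_minus_def e_z_def inner_axis')
  show poincare: "integral (cell Lx Ly) (\<lambda>x. (norm (B x))\<^sup>2) \<le> (C_P Lx Ly)\<^sup>2 * dirichlet_energy Lx Ly B"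
    using ferromagnetic_boundary(1,2)[OF B(1,3) div]
    by (intro poincare_cell L B(1,2) div flux) auto
  show "integral (cell Lx Ly) (\<lambda>x. norm (B x) ^ 6) \<le> (C_S Lx Ly * sqrt (dirichlet_energy Lx Ly B)) ^ 6"
    by (rule sobolev_cell[OF L B(1,2) poincare])
qed

text \<open>Otherwise Poincare makes the \<open>L2\<close> norm of \<open>B\<close> vanish, and
  continuity makes \<open>B\<close> vanish on the whole cell.\<close>

lemma dirichlet_energy_pos:
  assumes L: "Lx > 0" "Ly > 0" and B: "C1_slab B" and nontrivial: "x \<in> cell Lx Ly" "B x \<noteq> 0"
    and poincare: "integral (cell Lx Ly) (\<lambda>x. (norm (B x))\<^sup>2) \<le> (C_P Lx Ly)\<^sup>2 * dirichlet_energy Lx Ly B"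
  shows "0 < dirichlet_energy Lx Ly B"
proof (rule ccontr)
  assume "\<not> 0 < dirichlet_energy Lx Ly B"
  then have "dirichlet_energy Lx Ly B = 0" using dirichlet_energy_nonneg[OF B] by (simp add: order_antisym)
  moreover have cB: "continuous_on (cell Lx Ly) (\<lambda>x. (norm (B x))\<^sup>2)"
    by (intro continuous_intros C1_slab_continuous_cell B)
  moreover have "0 \<le> integral (cell Lx Ly) (\<lambda>x. (norm (B x))\<^sup>2)"
    by (intro integral_nonneg integrable_cell cB) simp
  ultimately have "integral (cell Lx Ly) (\<lambda>x. (norm (B x))\<^sup>2) = 0" using poincare by simp
  then have "\<forall>x\<in>cell Lx Ly. (norm (B x))\<^sup>2 = 0"
    using integral_cbox_eq_0_iff[OF cB[unfolded cell_def] box_cell_nonempty[OF L]] by (simp add: cell_def)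
  then show False using nontrivial by simp
qed

lemma dynamo_energy_inequality:
  fixes u B :: "real \<Rightarrow> real^3 \<Rightarrow> real^3" and P T :: "real \<Rightarrow> real^3 \<Rightarrow> real" and uA :: "real^3 \<Rightarrow> real^3"
  assumes L: "Lx > 0" "Ly > 0" and pos: "Ek > 0" "\<Lambda> > 0" and I: "is_interval I" "interior I \<noteq> {}"
    and solution: "viscous_inertialess_solution Lx Ly Ek \<Lambda> Ra Rm Pe Q Tm Tp I u B P T"
    and t: "t \<in> I" and dynamo: "dynamo_action_at Lx Ly I B t"
    and arch: "archimedean_velocity Lx Ly Ek Ra (T t) uA"
  shows "1 / Rm * dirichlet_energy Lx Ly (B t)
    \<le> integral (cell Lx Ly) (\<lambda>x. norm (uA x) * norm (B t x) * sqrt (\<Sum>i\<in>UNIV. (norm (pd i (B t) x))\<^sup>2))"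
proof -
  let ?V = "cell Lx Ly" and ?G = "dirichlet_energy Lx Ly (B t)"
  note sol = solution[unfolded viscous_inertialess_solution_def]
  have evo: "smooth_periodic_evolution Lx Ly I u" "smooth_periodic_evolution Lx Ly I B" "smooth_periodic_evolution Lx Ly I P"
    using sol by auto
  note slice = smooth_periodic_evolution_slice[OF evo(1) t] smooth_periodic_evolution_slice[OF evo(2) t]
    smooth_periodic_evolution_slice[OF evo(3) t]
  note u = smooth_on_slab_C1[OF slice(1)] slice(2) and B = smooth_on_slab_C1[OF slice(3)] slice(4)
    and P = smooth_on_slab_C1(1)[OF slice(5)] slice(6)
  have bc: "no_penetration (u t)" "stress_free (u t)" "ferromagnetic (B t)" using sol t by auto
  have divu: "divg (u t) x = 0" and divB: "divg (B t) x = 0"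
    and mom: "cross3 e_z (u t x) + grad (P t) x - Ek *\<^sub>R lap (u t) x
          = \<Lambda> *\<^sub>R cross3 (curl (B t) x) (B t x) + (Ra * T t x) *\<^sub>R e_z"
    and ind: "vector_derivative (\<lambda>s. B s x) (at t within I) - curl (\<lambda>y. cross3 (u t y) (B t y)) x
          = (1 / Rm) *\<^sub>R lap (B t) x"
    if "x \<in> slab" for x
    using sol t that by auto
  note arch' = arch[unfolded archimedean_velocity_def]
  obtain PA where PA: "smooth_on slab PA" "periodic_xy Lx Ly PA"
    and momA: "\<And>x. x \<in> slab \<Longrightarrow> - (Ek *\<^sub>R lap uA x) + cross3 e_z (uA x) + grad PA x = (Ra * T t x) *\<^sub>R e_z"
    using arch' by blast
  have uA: "C1_slab uA" "\<And>i. C1_slab (pd i uA)" "periodic_xy Lx Ly uA" "no_penetration uA" "stress_free uA"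
    and divA: "\<And>x. x \<in> slab \<Longrightarrow> divg uA x = 0"
    using arch' smooth_on_slab_C1 by auto
  obtain D where D: "0 \<le> D" "((\<lambda>s. magnetic_energy Lx Ly (B s)) has_real_derivative D) (at t within I)"
    using dynamo by (auto simp: dynamo_action_at_def)
  \<comment> \<open>An interval that is not a point is perfect, so the derivative within
    \<open>I\<close> is unique even at an end of the interval. This identifies \<open>D\<close> with
    the computed derivative of the energy.\<close>
  have nonsingular: "I \<noteq> {s}" for s using I(2) by auto
  have bot: "at t within I \<noteq> bot"
    using connected_imp_perfect[OF is_interval_connected[OF I(1)] t nonsingular]
    by (simp add: trivial_limit_within)
  have "C_k_on (Suc 0) (I \<times> slab) (\<lambda>(s, x). B s x)"
    using evo(2) unfolding smooth_periodic_evolution_def smooth_on_def by blast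
  then have "((\<lambda>s. magnetic_energy Lx Ly (B s)) has_real_derivative
      integral ?V (\<lambda>x. B t x \<bullet> vector_derivative (\<lambda>s. B s x) (at t within I))) (at t within I)"
    by (rule magnetic_energy_has_derivative[OF is_interval_convex[OF I(1)] t bot])
  then have "D = integral ?V (\<lambda>x. B t x \<bullet> vector_derivative (\<lambda>s. B s x) (at t within I))"
    using D(2) vector_derivative_unique_within[OF bot] by (simp add: has_real_derivative_iff_has_vector_derivative)
  also have "\<dots> = - integral ?V (\<lambda>x. u t x \<bullet> cross3 (curl (B t) x) (B t x)) - 1 / Rm * ?G"
    by (rule induction_energy_balance[OF L u(1,3) B bc(3) divB ind])
  finally have "1 / Rm * ?G \<le> - integral ?V (\<lambda>x. u t x \<bullet> cross3 (curl (B t) x) (B t x))"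
    using D(1) by simp
  also have "\<dots> \<le> - integral ?V (\<lambda>x. uA x \<bullet> cross3 (curl (B t) x) (B t x))"
  proof -
    have int: "(\<lambda>x. v x \<bullet> cross3 (curl (B t) x) (B t x)) integrable_on ?V" if "C1_slab v" for v
      by (intro integrable_cell continuous_on_inner continuous_on_cross C1_slab_continuous_cell(1) continuous_on_curl_cell that B)
    have "0 \<le> integral ?V (\<lambda>x. (u t x - uA x) \<bullet> cross3 (curl (B t) x) (B t x))"
      by (rule lorentz_work_nonneg[OF L pos(2,1) u bc(1,2) uA P smooth_on_slab_C1(1)[OF PA(1)] PA(2) divu divA mom momA])
    also have "\<dots> = integral ?V (\<lambda>x. u t x \<bullet> cross3 (curl (B t) x) (B t x))
        - integral ?V (\<lambda>x. uA x \<bullet> cross3 (curl (B t) x) (B t x))"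
      unfolding inner_diff_left by (intro Henstock_Kurzweil_Integration.integral_diff int u uA)
    finally show ?thesis by simp
  qed
  also have "\<dots> \<le> integral ?V (\<lambda>x. norm (uA x) * norm (B t x) * sqrt (\<Sum>i\<in>UNIV. (norm (pd i (B t) x))\<^sup>2))"
    by (rule lorentz_work_le[OF L uA(1,3) B(1,3) divA stress_free_boundary(1)[OF uA(1,4,5)]])
  finally show ?thesis .
qed

theorem theorem3p10:
  fixes Lx Ly Ek \<Lambda> Ra Rm Pe Tm Tp t :: real
    and Q :: "real^3 \<Rightarrow> real"
    and I :: "real set"
    and u B :: "real \<Rightarrow> real^3 \<Rightarrow> real^3"
    and P T :: "real \<Rightarrow> real^3 \<Rightarrow> real"
    and uA :: "real^3 \<Rightarrow> real^3"
    and p :: ereal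
  assumes "Lx > 0" "Ly > 0" "Ek > 0" "\<Lambda> > 0" "Ra > 0" "Rm > 0" "Pe > 0"
    and "is_interval I" "interior I \<noteq> {}"
    and "viscous_inertialess_solution Lx Ly Ek \<Lambda> Ra Rm Pe Q Tm Tp I u B P T"
    and "\<forall>s\<in>I. magnetic_flux_exact Lx Ly (B s)"
    and "t \<in> I"
    and "\<exists>x\<in>cell Lx Ly. B t x \<noteq> 0"
    and "dynamo_action_at Lx Ly I B t"
    and "archimedean_velocity Lx Ly Ek Ra (T t) uA"
    and "3 \<le> p"
  shows "A_p Lx Ly p * Lp_norm p (cell Lx Ly) uA \<ge> 1 / Rm"
proof -
  note L = \<open>Lx > 0\<close> \<open>Ly > 0\<close> and t = \<open>t \<in> I\<close> and sol = assms(10)[unfolded viscous_inertialess_solution_def]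
  have B: "smooth_on slab (B t)" "periodic_xy Lx Ly (B t)" "ferromagnetic (B t)"
    and div: "\<And>x. x \<in> slab \<Longrightarrow> divg (B t) x = 0"
    using sol t smooth_periodic_evolution_slice[of Lx Ly I B t] by auto
  note BC1 = smooth_on_slab_C1(1)[OF B(1)]
  have "magnetic_flux_exact Lx Ly (B t)" using assms(11) t by blast
  note estimates = magnetic_poincare_sobolev[OF L BC1 B(2,3) div this]
  have G: "0 < dirichlet_energy Lx Ly (B t)"
    using assms(13) dirichlet_energy_pos[OF L BC1 _ _ estimates(1)] by blast
  have "smooth_on slab uA" using assms(15) by (simp add: archimedean_velocity_def)
  then have "C1_slab uA" by (rule smooth_on_slab_C1)
  have "1 / Rm * dirichlet_energy Lx Ly (B t) \<le>
      integral (cell Lx Ly) (\<lambda>x. norm (uA x) * norm (B t x) * sqrt (\<Sum>i\<in>UNIV. (norm (pd i (B t) x))\<^sup>2))"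
    by (rule dynamo_energy_inequality[OF L assms(3,4,8,9,10,12,14,15)])
  also have "\<dots> \<le> A_p Lx Ly p * Lp_norm p (cell Lx Ly) uA * dirichlet_energy Lx Ly (B t)"
    by (rule integral_advection_bound[OF L \<open>C1_slab uA\<close> BC1 assms(16) estimates])
  finally show ?thesis by (rule mult_right_le_imp_le) (rule G)
qed

end
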